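(* Let $\mathcal{Z},\mathcal{X}$ be Polish spaces and assume: (1) $\mu_n=\frac1n\sum_{i=1}^n\delta_{z_{n,i}}\to\mu$ in $\mathcal{P}(\mathcal{Z})$; (2) for each $k\ge1$, $(P^k_z;z\in\mathcal{Z})$ is a Feller system on $\mathcal{X}$; (3) for each $z\in\mathcal{Z}$, $(P^k_z)_{k\ge1}$ obeys the $k$-LDP in $\mathcal{X}$ with a good rate function $J_z$. For $k,n\ge1$ let $X^k_{n,1},\dots,X^k_{n,n}$ be independent with $X^k_{n,i}\sim P^k_{z_{n,i}}$ and $K^k_n=\frac1n\sum_{i=1}^n\delta_{(z_{n,i},X^k_{n,i})}$. Then $\{K^k_n\}_{k,n\ge1}$ obeys the $(k,n)$-LDP in $\mathcal{P}(\mathcal{Z}\times\mathcal{X})$ with the affine good rate function $$i(q)=\begin{cases}\int_{\mathcal{Z}\times\mathcal{X}}J_z(x)\,q(dzdx)&\text{if }q_{\mathcal{Z}}=\mu,\\+\infty&\text{otherwise,}\end{cases}\qquad q\in\mathcal{P}(\mathcal{Z}\times\mathcal{X}).$$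
   Context: $\mathcal{P}(E)$: Borel probability measures on Polish $E$ with narrow topology. Feller system: $z\mapsto\int f\,dP^k_z$ continuous for all bounded continuous $f$. $k$-LDP with good rate function $J$: compact level sets, $-\inf_{\mathrm{int}A}J\le\liminf\frac1k\log P^k(A)\le\limsup\frac1k\log P^k(A)\le-\inf_{\mathrm{cl}A}J$. $(k,n)$-LDP with rate $I$: for all measurable $B$, $-\inf_{\mathrm{int}B}I\le\liminf_k\liminf_n\frac1{kn}\log\mathbb{P}(K^k_n\in B)\le\limsup_k\limsup_n\frac1{kn}\log\mathbb{P}(K^k_n\in B)\le-\inf_{\mathrm{cl}B}I$. $q_{\mathcal{Z}}$ is the $\mathcal{Z}$-marginal of $q$. *)

theory Defs
  imports "HOL-Probability.Probability"
begin

definition prob_measures :: "'a::topological_space measure set" where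
  "prob_measures = {M. prob_space M \<and> sets M = sets borel}"

definition bcont :: "('a::topological_space \<Rightarrow> real) set" where
  "bcont = {f. continuous_on UNIV f \<and> bounded (range f)}"

definition narrow_topology :: "'a::topological_space measure topology" where
  "narrow_topology = topology_generated_by
     {{q \<in> prob_measures. (\<integral>x. f x \<partial>q) \<in> U} | f U. f \<in> bcont \<and> open U}"

definition borel_sets_of :: "'a topology \<Rightarrow> 'a set set" where
  "borel_sets_of T = sigma_sets (topspace T) {U. openin T U}"

definition elog :: "real \<Rightarrow> ereal" where
  "elog x = (if x \<le> 0 then -\<infinity> else ereal (ln x))"

definition empirical :: "nat \<Rightarrow> (nat \<Rightarrow> 'a::topological_space) \<Rightarrow> 'a measure" where
  "empirical n p = measure_of UNIV (sets borel)
     (\<lambda>A. ennreal (real (card {i\<in>{1..n}. p i \<in> A}) / real n))"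

definition feller_system :: "('z::topological_space \<Rightarrow> 'x::topological_space measure) \<Rightarrow> bool" where
  "feller_system P \<longleftrightarrow> (\<forall>z. P z \<in> prob_measures) \<and>
     (\<forall>f\<in>bcont. continuous_on UNIV (\<lambda>z. \<integral>x. f x \<partial>P z))"

definition good_rate_function :: "('x::topological_space \<Rightarrow> ereal) \<Rightarrow> bool" where
  "good_rate_function J \<longleftrightarrow> (\<forall>x. 0 \<le> J x) \<and> (\<forall>c::real. compact {x. J x \<le> ereal c})"

definition good_rate_function_on :: "'a topology \<Rightarrow> ('a \<Rightarrow> ereal) \<Rightarrow> bool" where
  "good_rate_function_on T I \<longleftrightarrow> (\<forall>x\<in>topspace T. 0 \<le> I x) \<and>
     (\<forall>c::real. compactin T {x \<in> topspace T. I x \<le> ereal c})"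

definition k_LDP :: "(nat \<Rightarrow> 'x::topological_space measure) \<Rightarrow> ('x \<Rightarrow> ereal) \<Rightarrow> bool" where
  "k_LDP P J \<longleftrightarrow> (\<forall>A\<in>sets borel.
     - (INF x\<in>interior A. J x) \<le> liminf (\<lambda>k. ereal (1 / real k) * elog (measure (P k) A)) \<and>
     limsup (\<lambda>k. ereal (1 / real k) * elog (measure (P k) A)) \<le> - (INF x\<in>closure A. J x))"

text \<open>(k,n)-LDP: p k n B is the probability that the (k,n)-th random element lies in B.\<close>
definition kn_LDP :: "'a topology \<Rightarrow> (nat \<Rightarrow> nat \<Rightarrow> 'a set \<Rightarrow> real) \<Rightarrow> ('a \<Rightarrow> ereal) \<Rightarrow> bool" where
  "kn_LDP T p I \<longleftrightarrow> (\<forall>B\<in>borel_sets_of T.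
     - (INF q\<in>T interior_of B. I q)
        \<le> liminf (\<lambda>k. liminf (\<lambda>n. ereal (1 / (real k * real n)) * elog (p k n B))) \<and>
     limsup (\<lambda>k. limsup (\<lambda>n. ereal (1 / (real k * real n)) * elog (p k n B)))
        \<le> - (INF q\<in>T closure_of B. I q))"

definition sample_space :: "(nat \<Rightarrow> 'z \<Rightarrow> 'x measure) \<Rightarrow> (nat \<Rightarrow> nat \<Rightarrow> 'z) \<Rightarrow> nat \<Rightarrow> nat \<Rightarrow> (nat \<Rightarrow> 'x) measure" where
  "sample_space P z k n = PiM {1..n} (\<lambda>i. P k (z n i))"

definition K_emp :: "(nat \<Rightarrow> nat \<Rightarrow> 'z::topological_space) \<Rightarrow> nat \<Rightarrow> (nat \<Rightarrow> 'x::topological_space) \<Rightarrow> ('z \<times> 'x) measure" where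
  "K_emp z n \<omega> = empirical n (\<lambda>i. (z n i, \<omega> i))"

definition prob_K :: "(nat \<Rightarrow> 'z::topological_space \<Rightarrow> 'x::topological_space measure) \<Rightarrow> (nat \<Rightarrow> nat \<Rightarrow> 'z)
    \<Rightarrow> nat \<Rightarrow> nat \<Rightarrow> ('z \<times> 'x) measure set \<Rightarrow> real" where
  "prob_K P z k n B = measure (sample_space P z k n)
     {\<omega> \<in> space (sample_space P z k n). K_emp z n \<omega> \<in> B}"

definition rate_i :: "('z::topological_space \<Rightarrow> 'x::topological_space \<Rightarrow> ereal) \<Rightarrow> 'z measure \<Rightarrow> ('z \<times> 'x) measure \<Rightarrow> ereal" where
  "rate_i J \<mu> q = (if distr q borel fst = \<mu>
      then enn2ereal (\<integral>\<^sup>+ p. e2ennreal (J (fst p) (snd p)) \<partial>q) else \<infinity>)"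

end

theory Submission
  imports Defs
begin

text \<open>
  Upper bound: for bounded Lipschitz \<open>f\<close>, Chernoff's inequality for the product measure, the Feller
  property (limit in \<open>n\<close>) and Varadhan's upper bound with dominated convergence (limit in \<open>k\<close>) give
  \<open>{q. \<integral> f dq \<ge> s}\<close> the rate \<open>s - L f\<close>, where \<open>L f\<close> bounds \<open>\<integral> sup\<^sub>x (f(z,x) - J\<^sub>z(x)) \<mu>(dz)\<close>. A countable
  family of such half spaces detects \<open>{i \<le> a}\<close> and forces tightness along sequences, so finitely many
  of them cover a closed set on which \<open>i > a\<close>, and level sets of \<open>i\<close> are compact.

  Lower bound: split \<open>q\<close> into cells where \<open>x\<close> is near a point \<open>x\<^sub>l\<close> and \<open>J\<^sub>z(x)\<close> is nearly constant; the
  densities of the cells with respect to \<open>\<mu>\<close> are approximated by continuous weights \<open>\<theta>\<^sub>l\<close>, cut off where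
  \<open>P\<^sup>k\<^sub>z\<close> charges the ball around \<open>x\<^sub>l\<close> too little. A greedy choice gives every \<open>i \<le> n\<close> a target ball (or none)
  with frequencies close to \<open>\<theta>\<close>, and \<open>K\<close> is near \<open>q\<close> as soon as every \<open>X\<^sub>i\<close> hits its ball.
\<close>

section \<open>Bounded Lipschitz functions\<close>

text \<open>The large deviation principle is given for each \<open>z\<close> separately, without
  uniformity in \<open>z\<close>, and \<open>J\<close> is not assumed to be measurable in
  \<open>z\<close>. This shapes the proof in three ways. The supremum over \<open>x\<close> of
  \<open>f (z, x) - J z x\<close> is never formed; a bounded Borel majorant of it is supplied by
  hand wherever an exponential bound is needed. Convergence in \<open>k\<close> is pointwise in
  \<open>z\<close> and becomes usable only after integration against \<open>\<mu>\<close> or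
  \<open>q\<close>. And every average over the points \<open>pts n i\<close> whose limit is taken
  has to be that of a function continuous in \<open>z\<close>, because narrow convergence of the
  empirical measures tests nothing else; hence the continuous cumulants and weights. Bounded
  Lipschitz functions serve as observables since the Feller property speaks about functions of
  \<open>x\<close> only: a Lipschitz bound makes the dependence on \<open>z\<close> uniform in
  \<open>x\<close>. Spaces of measures are handled through countably many integrals, that is, inside
  the metrizable product of countably many real lines.\<close>

definition blip :: "('a::metric_space \<Rightarrow> real) \<Rightarrow> bool" where
  "blip f \<longleftrightarrow> (\<exists>M. \<forall>x. \<bar>f x\<bar> \<le> M) \<and> (\<exists>L. \<forall>x y. \<bar>f x - f y\<bar> \<le> L * dist x y)"

lemma blipI:
  assumes "\<And>x. \<bar>f x\<bar> \<le> M" "\<And>x y. \<bar>f x - f y\<bar> \<le> L * dist x y"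
  shows "blip f"
  using assms unfolding blip_def by blast

lemma blipE:
  fixes f :: "'a::metric_space \<Rightarrow> real"
  assumes "blip f"
  obtains M L where "M > 0" "L > 0" "\<And>x. \<bar>f x\<bar> \<le> M" "\<And>x y. \<bar>f x - f y\<bar> \<le> L * dist x y"
proof -
  obtain M L where 1: "\<And>x. \<bar>f x\<bar> \<le> M" "\<And>x y. \<bar>f x - f y\<bar> \<le> L * dist x y"
    using assms unfolding blip_def by blast
  show ?thesis
  proof (rule that[of "max 1 M" "max 1 L"])
    fix x y :: 'a
    show "\<bar>f x\<bar> \<le> max 1 M" using 1(1)[of x] by simp
    have "L * dist x y \<le> max 1 L * dist x y" by (rule mult_right_mono) auto
    then show "\<bar>f x - f y\<bar> \<le> max 1 L * dist x y" using 1(2)[of x y] by simp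
  qed auto
qed

lemma blip_const: "blip (\<lambda>x. c)"
  by (rule blipI[of _ "\<bar>c\<bar>" 0]) auto

lemma blip_add: assumes "blip f" "blip g" shows "blip (\<lambda>x. f x + g x)"
proof -
  obtain M L where f: "\<And>x. \<bar>f x\<bar> \<le> M" "\<And>x y. \<bar>f x - f y\<bar> \<le> L * dist x y" using assms(1) blipE by metis
  obtain M' L' where g: "\<And>x. \<bar>g x\<bar> \<le> M'" "\<And>x y. \<bar>g x - g y\<bar> \<le> L' * dist x y" using assms(2) blipE by metis
  show ?thesis
  proof (rule blipI[of _ "M + M'" "L + L'"])
    show "\<bar>f x + g x\<bar> \<le> M + M'" for x using f(1)[of x] g(1)[of x] by linarith
    show "\<bar>f x + g x - (f y + g y)\<bar> \<le> (L + L') * dist x y" for x y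
      using f(2)[of x y] g(2)[of x y] by (simp add: distrib_right)
  qed
qed

lemma blip_mult: assumes "blip f" "blip g" shows "blip (\<lambda>x. f x * g x)"
proof -
  obtain M L where f: "M > 0" "\<And>x. \<bar>f x\<bar> \<le> M" "\<And>x y. \<bar>f x - f y\<bar> \<le> L * dist x y" using assms(1) blipE by metis
  obtain M' L' where g: "M' > 0" "\<And>x. \<bar>g x\<bar> \<le> M'" "\<And>x y. \<bar>g x - g y\<bar> \<le> L' * dist x y" using assms(2) blipE by metis
  show ?thesis
  proof (rule blipI[of _ "M * M'" "M * L' + M' * L"])
    show "\<bar>f x * g x\<bar> \<le> M * M'" for x
      using f(2)[of x] g(2)[of x] f(1) by (auto simp: abs_mult intro!: mult_mono)
    fix x y
    have "f x * g x - f y * g y = f x * (g x - g y) + g y * (f x - f y)" by (simp add: algebra_simps)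
    then have "\<bar>f x * g x - f y * g y\<bar> \<le> \<bar>f x\<bar> * \<bar>g x - g y\<bar> + \<bar>g y\<bar> * \<bar>f x - f y\<bar>"
      by (metis abs_mult abs_triangle_ineq)
    also have "\<dots> \<le> M * (L' * dist x y) + M' * (L * dist x y)"
      using f g by (intro add_mono mult_mono) auto
    finally show "\<bar>f x * g x - f y * g y\<bar> \<le> (M * L' + M' * L) * dist x y" by (simp add: algebra_simps)
  qed
qed

lemma blip_cmult: "blip f \<Longrightarrow> blip (\<lambda>x. c * f x)"
  by (intro blip_mult blip_const)

lemma blip_max: fixes f g :: "'a::metric_space \<Rightarrow> real" assumes "blip f" "blip g" shows "blip (\<lambda>x. max (f x) (g x))"
proof -
  obtain M L where f: "L > 0" "\<And>x. \<bar>f x\<bar> \<le> M" "\<And>x y. \<bar>f x - f y\<bar> \<le> L * dist x y" using assms(1) blipE by metis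
  obtain M' L' where g: "L' > 0" "\<And>x. \<bar>g x\<bar> \<le> M'" "\<And>x y. \<bar>g x - g y\<bar> \<le> L' * dist x y" using assms(2) blipE by metis
  show ?thesis
  proof (rule blipI[of _ "max M M'" "L + L'"])
    show "\<bar>max (f x) (g x)\<bar> \<le> max M M'" for x using f(2)[of x] g(2)[of x] by linarith
    fix x y :: 'a
    have "0 \<le> L * dist x y" "0 \<le> L' * dist x y" using f g by simp_all
    then show "\<bar>max (f x) (g x) - max (f y) (g y)\<bar> \<le> (L + L') * dist x y"
      using f(3)[of x y] g(3)[of x y] unfolding distrib_right by linarith
  qed
qed

lemma blip_comp:
  assumes "blip f" "\<And>x y. dist (h x) (h y) \<le> dist x y" shows "blip (\<lambda>x. f (h x))"
proof -
  obtain M L where f: "L > 0" "\<And>x. \<bar>f x\<bar> \<le> M" "\<And>x y. \<bar>f x - f y\<bar> \<le> L * dist x y" using assms(1) blipE by metis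
  show ?thesis
  proof (rule blipI[of _ M L])
    show "\<bar>f (h x) - f (h y)\<bar> \<le> L * dist x y" for x y
      using f(3)[of "h x" "h y"] mult_left_mono[OF assms(2)[of x y], of L] f(1) by linarith
  qed (use f in auto)
qed

lemma blip_fst: "blip f \<Longrightarrow> blip (\<lambda>p. f (fst p))"
  by (erule blip_comp) (rule dist_fst_le)

lemma blip_snd: "blip f \<Longrightarrow> blip (\<lambda>p. f (snd p))"
  by (erule blip_comp) (rule dist_snd_le)

lemma blip_exp: assumes "blip f" shows "blip (\<lambda>x. exp (f x))"
proof -
  obtain M L where f: "L > 0" "\<And>x. \<bar>f x\<bar> \<le> M" "\<And>x y. \<bar>f x - f y\<bar> \<le> L * dist x y" using assms(1) blipE by metis
  \<comment> \<open>\<open>1 - exp (b - a)\<close> is at most \<open>a - b\<close> by convexity;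
    using the one-sided estimate in both orders gives the Lipschitz bound.\<close>
  have *: "exp a - exp b \<le> exp M * \<bar>a - b\<bar>" if "a \<le> M" for a b :: real
  proof -
    have "1 - exp (b - a) \<le> \<bar>a - b\<bar>" using exp_ge_add_one_self[of "b - a"] by linarith
    then have "exp a * (1 - exp (b - a)) \<le> exp a * \<bar>a - b\<bar>" by simp
    also have "\<dots> \<le> exp M * \<bar>a - b\<bar>" using that by (intro mult_right_mono) auto
    finally show ?thesis by (simp add: algebra_simps exp_diff)
  qed
  show ?thesis
  proof (rule blipI[of _ "exp M" "exp M * L"])
    show "\<bar>exp (f x)\<bar> \<le> exp M" for x using f(2)[of x] by simp
    fix x y
    have "\<bar>exp (f x) - exp (f y)\<bar> \<le> exp M * \<bar>f x - f y\<bar>"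
      using *[of "f x" "f y"] *[of "f y" "f x"] f(2)[of x] f(2)[of y] by (simp add: abs_minus_commute abs_le_iff)
    also have "\<dots> \<le> exp M * (L * dist x y)" using f(3)[of x y] by simp
    finally show "\<bar>exp (f x) - exp (f y)\<bar> \<le> exp M * L * dist x y" by simp
  qed
qed

lemma continuous_on_if_dist_bound:
  fixes f :: "'a::metric_space \<Rightarrow> real"
  assumes "\<And>x y. \<bar>f x - f y\<bar> \<le> L * dist x y"
  shows "continuous_on A f"
proof -
  have "(\<bar>L\<bar>)-lipschitz_on A f"
  proof (rule lipschitz_onI)
    fix x y :: 'a
    have "L * dist x y \<le> \<bar>L\<bar> * dist x y" by (intro mult_right_mono) auto
    then show "dist (f x) (f y) \<le> \<bar>L\<bar> * dist x y" using assms[of x y] by (simp add: dist_real_def)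
  qed auto
  then show ?thesis by (rule lipschitz_on_continuous_on)
qed

lemma blip_continuous: "blip f \<Longrightarrow> continuous_on UNIV f"
  unfolding blip_def using continuous_on_if_dist_bound by blast

lemma blip_bcont: "blip f \<Longrightarrow> f \<in> bcont"
  using blip_continuous[of f] unfolding bcont_def blip_def bounded_iff by auto

section \<open>Bounded continuous functions and Borel probability measures\<close>

lemma bcontE:
  assumes "f \<in> bcont" obtains M where "M > 0" "\<And>x. \<bar>f x\<bar> \<le> M"
proof -
  obtain b where "\<And>x. \<bar>f x\<bar> \<le> b" using assms unfolding bcont_def bounded_iff by auto
  then show ?thesis using that[of "max 1 b"] by (metis less_max_iff_disj max.coboundedI2 zero_less_one)
qed

lemma bcont_measurable: "f \<in> bcont \<Longrightarrow> f \<in> borel_measurable borel"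
  unfolding bcont_def by (auto intro: borel_measurable_continuous_onI)

lemma prob_measuresD:
  assumes "q \<in> prob_measures"
  shows "prob_space q" "sets q = sets borel" "space q = UNIV"
  using assms sets_eq_imp_space_eq[of q borel] unfolding prob_measures_def by auto

lemma bounded_integrable:
  assumes "q \<in> prob_measures" "f \<in> borel_measurable borel" "\<And>x. \<bar>f x\<bar> \<le> (M::real)"
  shows "integrable q f"
proof -
  interpret prob_space q using prob_measuresD[OF assms(1)] by simp
  show ?thesis
    by (rule integrable_const_bound[of _ M])
      (use assms prob_measuresD(2)[OF assms(1)] in \<open>auto cong: measurable_cong_sets\<close>)
qed

lemma bcont_integrable: "q \<in> prob_measures \<Longrightarrow> f \<in> bcont \<Longrightarrow> integrable q f"
  by (metis bcontE bcont_measurable bounded_integrable)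

lemma blip_integrable: "q \<in> prob_measures \<Longrightarrow> blip f \<Longrightarrow> integrable q f"
  by (metis blip_bcont bcont_integrable)

text \<open>Makes everything proved for a single Polish space available on the pair space that
  carries the measures \<open>K_emp\<close>.\<close>

instance prod :: (polish_space, polish_space) polish_space ..

section \<open>A countable family of test functions\<close>

text \<open>A sequence rather than a dense set: indices let test functions be coded by natural
  numbers and give a least index in \<open>code\<close>.\<close>

definition dense_sequence :: "nat \<Rightarrow> 'a::polish_space" where
  "dense_sequence = (SOME e. \<forall>x. \<forall>r>0. \<exists>j. dist x (e j) < r)"

lemma dense_sequence: fixes x :: "'a::polish_space" shows "r > 0 \<Longrightarrow> \<exists>j. dist x (dense_sequence j) < r"
proof -
  obtain D :: "'a set" where D: "countable D" "\<And>X. open X \<Longrightarrow> X \<noteq> {} \<Longrightarrow> \<exists>d\<in>D. d \<in> X"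
    using countable_dense_setE by blast
  have "D \<noteq> {}" using D(2)[of UNIV] by auto
  have "\<exists>j. dist x (from_nat_into D j) < r" if "r > 0" for x r
  proof -
    have "ball x r \<noteq> {}" using that by (metis centre_in_ball empty_iff)
    then obtain d where "d \<in> D" "d \<in> ball x r" using D(2)[of "ball x r"] by blast
    then show ?thesis using from_nat_into_surj[OF D(1), of d] by auto
  qed
  then have "\<exists>e. \<forall>x::'a. \<forall>r>0. \<exists>j::nat. dist x (e j) < r" by blast
  then have "\<forall>x::'a. \<forall>r>0. \<exists>j. dist x (dense_sequence j) < r"
    unfolding dense_sequence_def by (rule someI_ex)
  then show "r > 0 \<Longrightarrow> \<exists>j. dist x (dense_sequence j) < r" by blast
qed

text \<open>A triple holds the index of the centre, the height and the slope of a cone. Starting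
  from the constant 0 keeps all members nonnegative, and a list instead of a single triple gives
  closure under maxima.\<close>

primrec cone_max :: "(nat \<times> rat \<times> nat) list \<Rightarrow> 'a::polish_space \<Rightarrow> real" where
  "cone_max [] = (\<lambda>x. 0)"
| "cone_max (c # cs) = (\<lambda>x. max (real_of_rat (fst (snd c)) - real (snd (snd c)) * dist x (dense_sequence (fst c)))
     (cone_max cs x))"

lemma cone_max_nonneg: "0 \<le> cone_max cs x"
  by (induction cs) auto

lemma blip_cone_max: "blip (cone_max cs :: 'a::polish_space \<Rightarrow> real)"
proof -
  \<comment> \<open>Members are nonnegative, so an upper bound suffices for boundedness;
    \<open>L \<ge> 0\<close> is carried along since each cone adds its slope to the Lipschitz
    constant.\<close>
  have "(\<exists>M. \<forall>x::'a. cone_max cs x \<le> M) \<and> (\<exists>L\<ge>0. \<forall>x y::'a. \<bar>cone_max cs x - cone_max cs y\<bar> \<le> L * dist x y)"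
  proof (induction cs)
    case (Cons c cs)
    obtain n a b where c: "c = (n, a, b)" by (cases c) auto
    obtain M L where M: "\<And>x::'a. cone_max cs x \<le> M" and L: "L \<ge> 0"
      "\<And>x y::'a. \<bar>cone_max cs x - cone_max cs y\<bar> \<le> L * dist x y" using Cons by blast
    have "cone_max (c # cs) x \<le> max (real_of_rat a) M" for x :: 'a
      using M[of x] by (simp add: c max_def zero_le_mult_iff) (smt (verit) mult_nonneg_nonneg of_nat_0_le_iff zero_le_dist)
    moreover have "\<bar>cone_max (c # cs) x - cone_max (c # cs) y\<bar> \<le> (L + real b) * dist x y" for x y :: 'a
    proof -
      let ?d = "dense_sequence n :: 'a"
      have "\<bar>dist x ?d - dist y ?d\<bar> \<le> dist x y" by (metis abs_dist_diff_le dist_commute)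
      then have "\<bar>real b * dist x ?d - real b * dist y ?d\<bar> \<le> real b * dist x y"
        by (metis abs_mult abs_of_nat mult_left_mono of_nat_0_le_iff right_diff_distrib)
      moreover have "0 \<le> real b * dist x y" "0 \<le> L * dist x y" using L by auto
      ultimately show ?thesis using L(2)[of x y] unfolding c cone_max.simps fst_conv snd_conv distrib_right by linarith
    qed
    ultimately show ?case using L(1) by (meson add_nonneg_nonneg of_nat_0_le_iff)
  qed (auto intro: exI[of _ 0])
  then obtain M L where "\<And>x::'a. cone_max cs x \<le> M" "\<And>x y::'a. \<bar>cone_max cs x - cone_max cs y\<bar> \<le> L * dist x y" by blast
  then show ?thesis by (intro blipI[of _ M L]) (simp_all add: abs_of_nonneg cone_max_nonneg)
qed

lemma cone_max_append: "cone_max (cs @ ds) x = max (cone_max cs x) (cone_max ds x)"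
  using cone_max_nonneg[of ds x] by (induction cs) auto

text \<open>The maxima make every nonnegative lower semicontinuous function an increasing limit of members
  of this countable family; its integrals serve as coordinates for the narrow topology.\<close>

definition tst :: "nat \<Rightarrow> 'a::polish_space \<Rightarrow> real" where
  "tst m = cone_max (from_nat m)"

lemma tst_nonneg: "0 \<le> tst m x" unfolding tst_def by (rule cone_max_nonneg)
lemma blip_tst: "blip (tst m)" unfolding tst_def by (rule blip_cone_max)

lemma tst_max: "\<exists>l. \<forall>x. tst l x = max (tst m x) (tst n x)"
  unfolding tst_def by (rule exI[of _ "to_nat (from_nat m @ from_nat n :: (nat \<times> rat \<times> nat) list)"])
    (simp add: cone_max_append)

text \<open>A single cone suffices: its height is a rational between \<open>t\<close> and a value
  \<open>a'\<close> still below \<open>F x\<close>, its apex is near \<open>x\<close>, and its slope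
  is so steep that it is positive only inside a ball around \<open>x\<close> where
  \<open>F > a'\<close>. For negative \<open>t\<close> the zero function does it.\<close>

lemma tst_below_lsc:
  fixes F :: "'a::polish_space \<Rightarrow> ereal"
  assumes nonneg: "\<And>x. 0 \<le> F x" and lsc: "\<And>t::real. open {y. ereal t < F y}" and "ereal t < F x"
  shows "\<exists>m. (\<forall>y. ereal (tst m y) \<le> F y) \<and> t < tst m x"
proof (cases "t < 0")
  case True
  then show ?thesis using nonneg by (intro exI[of _ "to_nat ([] :: (nat \<times> rat \<times> nat) list)"])
    (simp add: tst_def zero_ereal_def)
next
  case False
  obtain a' where a': "t < a'" "ereal a' < F x"
    using ereal_dense2[OF assms(3)] by auto
  obtain a where a: "t < real_of_rat a" "real_of_rat a < a'"
    using of_rat_dense[OF a'(1)] by auto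
  obtain \<rho> where \<rho>: "\<rho> > 0" "ball x \<rho> \<subseteq> {y. ereal a' < F y}"
    using lsc[of a'] a'(2) by (metis mem_Collect_eq open_contains_ball)
  obtain b :: nat where b: "real_of_rat a / (\<rho>/2) < real b" using reals_Archimedean2 by blast
  have "real_of_rat a > 0" using a False by linarith
  then have b0: "real b > 0" using b \<rho>(1) by (smt (verit) divide_pos_pos half_gt_zero)
  obtain n where n: "dist x (dense_sequence n) < min (\<rho>/2) ((real_of_rat a - t) / real b)"
    using dense_sequence[of "min (\<rho>/2) ((real_of_rat a - t) / real b)" x] \<rho> a b0 by auto
  let ?m = "to_nat [(n, a, b)]"
  have tst: "tst ?m y = max (real_of_rat a - real b * dist y (dense_sequence n)) 0" for y :: 'a
    by (simp add: tst_def)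
  show ?thesis
  proof (intro exI[of _ ?m] conjI allI)
    have "real b * dist x (dense_sequence n) < real_of_rat a - t" using n b0 by (simp add: field_simps)
    then show "t < tst ?m x" by (simp add: tst)
    fix y
    show "ereal (tst ?m y) \<le> F y"
    proof (cases "real b * dist y (dense_sequence n) < real_of_rat a")
      case True
      then have "dist y (dense_sequence n) < real_of_rat a / real b" using b0 by (simp add: field_simps)
      also have "\<dots> < \<rho>/2" using b b0 \<rho>(1) by (simp add: field_simps)
      finally have "dist x y < \<rho>" using n dist_triangle[of x y "dense_sequence n"] by (simp add: dist_commute)
      then have "ereal a' < F y" using \<rho>(2) by auto
      moreover have "0 \<le> real b * dist y (dense_sequence n)" by simp
      then have "tst ?m y \<le> a'" using a \<open>\<not> t < 0\<close> unfolding tst by linarith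
      ultimately show ?thesis by (meson ereal_less_eq(3) less_imp_le order_trans)
    next
      case False
      then show ?thesis using nonneg[of y] by (simp add: tst zero_ereal_def)
    qed
  qed
qed

text \<open>Among all test functions below \<open>F\<close>, \<open>f i\<close> dominates those with
  index less than \<open>i\<close>; taking maxima of consecutive choices makes the sequence
  increasing without leaving the minorants of \<open>F\<close>.\<close>

lemma incseq_tst_lsc:
  fixes F :: "'a::polish_space \<Rightarrow> ereal"
  assumes nonneg: "\<And>x. 0 \<le> F x" and lsc: "\<And>t::real. open {y. ereal t < F y}"
  shows "\<exists>s::nat\<Rightarrow>nat. (\<forall>x::'a. incseq (\<lambda>i. tst (s i) x)) \<and> (\<forall>i x. ereal (tst (s i) x) \<le> F x)
     \<and> (\<forall>x. (SUP i. ereal (tst (s i) x)) = F x)"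
proof -
  define S where "S = {m. \<forall>y. ereal (tst m y) \<le> F y}"
  have "\<exists>m. m \<in> S \<and> (\<forall>x::'a. \<forall>j\<in>S \<inter> {..<i}. tst j x \<le> tst m x)" for i
  proof (induction i)
    case 0
    then show ?case using nonneg by (intro exI[of _ "to_nat ([] :: (nat \<times> rat \<times> nat) list)"])
      (simp add: tst_def S_def zero_ereal_def)
  next
    case (Suc i)
    then obtain m where m: "m \<in> S" "\<And>(x::'a) j. j\<in>S \<Longrightarrow> j < i \<Longrightarrow> tst j x \<le> tst m x"
      by (metis IntI lessThan_iff)
    show ?case
    proof (cases "i \<in> S")
      case True
      obtain l where l: "\<And>x::'a. tst l x = max (tst m x) (tst i x)" using tst_max by blast
      have "l \<in> S" using m(1) True unfolding S_def by (auto simp: l max_def)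
      then show ?thesis using m(2) by (intro exI[of _ l]) (force simp: l less_Suc_eq le_max_iff_disj)
    next
      case False
      then show ?thesis using m by (intro exI[of _ m]) (auto simp: less_Suc_eq)
    qed
  qed
  then have "\<exists>f. \<forall>i. f i \<in> S \<and> (\<forall>x::'a. \<forall>j\<in>S \<inter> {..<i}. tst j x \<le> tst (f i) x)" by metis
  then obtain f where f: "\<And>i. f i \<in> S" "\<And>i (x::'a) j. j\<in>S \<Longrightarrow> j < i \<Longrightarrow> tst j x \<le> tst (f i) x" by auto
  have "\<exists>s. \<forall>i. s i \<in> S \<and> (\<forall>x::'a. tst (s i) x \<le> tst (s (Suc i)) x \<and> tst (f i) x \<le> tst (s (Suc i)) x)"
  proof -
    have *: "\<exists>l. l \<in> S \<and> (\<forall>x::'a. tst m x \<le> tst l x \<and> tst (f i) x \<le> tst l x)" if "m \<in> S" for m i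
    proof -
      obtain l where l: "\<And>x::'a. tst l x = max (tst m x) (tst (f i) x)" using tst_max by blast
      have "l \<in> S" using that f(1)[of i] unfolding S_def by (auto simp: l max_def)
      then show ?thesis by (intro exI[of _ l]) (auto simp: l)
    qed
    show ?thesis
      by (rule dependent_nat_choice[of "\<lambda>_ m. m \<in> S" "\<lambda>i m l. \<forall>x::'a. tst m x \<le> tst l x \<and> tst (f i) x \<le> tst l x"])
        (use f(1) * in blast)+
  qed
  then obtain s where s: "\<And>i. s i \<in> S" "\<And>i (x::'a). tst (s i) x \<le> tst (s (Suc i)) x" "\<And>i (x::'a). tst (f i) x \<le> tst (s (Suc i)) x"
    by blast
  show ?thesis
  proof (intro exI[of _ s] conjI allI)
    show "incseq (\<lambda>i. tst (s i) x)" for x :: 'a using s(2) by (auto intro: incseq_SucI)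
    show le: "ereal (tst (s i) x) \<le> F x" for i x using s(1) unfolding S_def by auto
    fix x
    show "(SUP i. ereal (tst (s i) x)) = F x"
    proof (rule antisym)
      show "(SUP i. ereal (tst (s i) x)) \<le> F x" using le by (intro SUP_least)
      show "F x \<le> (SUP i. ereal (tst (s i) x))"
      proof (rule ereal_le_real)
        fix t assume *: "(SUP i. ereal (tst (s i) x)) \<le> ereal t"
        show "F x \<le> ereal t"
        proof (rule ccontr)
          assume "\<not> F x \<le> ereal t"
          then obtain m where m: "m \<in> S" "t < tst m x" using tst_below_lsc[OF nonneg lsc, of t x] unfolding S_def not_le by blast
          have "tst m x \<le> tst (s (Suc (Suc m))) x" using f(2)[OF m(1), of "Suc m" x] s(3)[of "Suc m" x] by simp
          then have "ereal t < ereal (tst (s (Suc (Suc m))) x)" using m by simp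
          also have "\<dots> \<le> (SUP i. ereal (tst (s i) x))" by (rule SUP_upper) simp
          finally show False using * by simp
        qed
      qed
    qed
  qed
qed

text \<open>Monotone convergence. The sequence \<open>s\<close> is found before the measure, so one
  choice serves all \<open>q\<close>.\<close>

lemma nn_integral_lsc_SUP_tst:
  fixes F :: "'a::polish_space \<Rightarrow> ereal"
  assumes "\<And>x. 0 \<le> F x" and "\<And>t::real. open {y. ereal t < F y}"
  obtains s :: "nat \<Rightarrow> nat" where "\<And>i x. ereal (tst (s i) x) \<le> F x"
    "\<And>q. q \<in> prob_measures \<Longrightarrow> (\<integral>\<^sup>+x. e2ennreal (F x) \<partial>q) = (SUP i. ennreal (\<integral>x. tst (s i) x \<partial>q))"
proof -
  obtain s :: "nat \<Rightarrow> nat" where s: "\<And>x::'a. incseq (\<lambda>i. tst (s i) x)" "\<And>i x. ereal (tst (s i) x) \<le> F x"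
    "\<And>x. (SUP i. ereal (tst (s i) x)) = F x"
    using incseq_tst_lsc[OF assms] by blast
  show thesis
  proof (rule that[OF s(2)])
    fix q :: "'a measure" assume q: "q \<in> prob_measures"
    have "e2ennreal (F x) = (SUP i. ennreal (tst (s i) x))" for x
    proof -
      have inc: "incseq (\<lambda>i. e2ennreal (ereal (tst (s i) x)))"
        using s(1)[of x] by (auto simp: incseq_def intro!: ennreal_leI)
      have "(\<lambda>i. ereal (tst (s i) x)) \<longlonglongrightarrow> F x"
        using LIMSEQ_SUP[of "\<lambda>i. ereal (tst (s i) x)"] s(1)[of x] by (simp add: s(3) incseq_def)
      then have "(\<lambda>i. e2ennreal (ereal (tst (s i) x))) \<longlonglongrightarrow> e2ennreal (F x)"
        by (rule continuous_on_tendsto_compose[OF continuous_on_e2ennreal[of UNIV]]) auto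
      moreover have "(\<lambda>i. e2ennreal (ereal (tst (s i) x))) \<longlonglongrightarrow> (SUP i. e2ennreal (ereal (tst (s i) x)))"
        by (rule LIMSEQ_SUP[OF inc])
      ultimately have "e2ennreal (F x) = (SUP i. e2ennreal (ereal (tst (s i) x)))" by (rule LIMSEQ_unique)
      then show ?thesis by (simp add: e2ennreal_ereal)
    qed
    then have "(\<integral>\<^sup>+x. e2ennreal (F x) \<partial>q) = (\<integral>\<^sup>+x. (SUP i. ennreal (tst (s i) x)) \<partial>q)" by simp
    also have "\<dots> = (SUP i. \<integral>\<^sup>+x. ennreal (tst (s i) x) \<partial>q)"
    proof (rule nn_integral_monotone_convergence_SUP)
      have "tst (s m) x \<le> tst (s n) x" if "m \<le> n" for m n and x :: 'a
        using s(1)[of x] that by (auto simp: incseq_def)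
      then show "incseq (\<lambda>i (x::'a). ennreal (tst (s i) x))"
        by (intro monoI le_funI ennreal_leI)
      show "(\<lambda>x::'a. ennreal (tst (s i) x)) \<in> borel_measurable q" for i
        using measurable_compose[OF bcont_measurable[OF blip_bcont[OF blip_tst]] measurable_ennreal] prob_measuresD(2)[OF q]
        by (simp cong: measurable_cong_sets)
    qed
    also have "\<dots> = (SUP i. ennreal (\<integral>x. tst (s i) x \<partial>q))"
      using blip_integrable[OF q blip_tst] by (intro SUP_cong refl nn_integral_eq_integral) (auto simp: tst_nonneg)
    finally show "(\<integral>\<^sup>+x. e2ennreal (F x) \<partial>q) = (SUP i. ennreal (\<integral>x. tst (s i) x \<partial>q))" .
  qed
qed

text \<open>A strict lower bound on the integral of a lower semicontinuous function is witnessed by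
  one test function. This is how open conditions on measures turn into conditions on single
  coordinates.\<close>

lemma tst_below_integral:
  fixes f :: "'a::polish_space \<Rightarrow> real"
  assumes f: "\<And>x. 0 \<le> f x" "\<And>t. open {y. t < f y}" and q: "q \<in> prob_measures" "integrable q f"
    and t: "t < (\<integral>x. f x \<partial>q)"
  obtains m where "\<And>x. tst m x \<le> f x" "t < (\<integral>x. tst m x \<partial>q)"
proof -
  obtain s :: "nat \<Rightarrow> nat" where s: "\<And>i x. ereal (tst (s i) x) \<le> ereal (f x)"
    "\<And>q. q \<in> prob_measures \<Longrightarrow> (\<integral>\<^sup>+x. e2ennreal (ereal (f x)) \<partial>q) = (SUP i. ennreal (\<integral>x. tst (s i) x \<partial>q))"
    using nn_integral_lsc_SUP_tst[of "\<lambda>x. ereal (f x)"] f by (auto simp: zero_ereal_def)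
  have "(\<integral>\<^sup>+x. e2ennreal (ereal (f x)) \<partial>q) = ennreal (\<integral>x. f x \<partial>q)"
    using nn_integral_eq_integral[OF q(2)] f(1) by (simp add: e2ennreal_ereal)
  then have eq: "(SUP i. ennreal (\<integral>x. tst (s i) x \<partial>q)) = ennreal (\<integral>x. f x \<partial>q)" using s(2)[OF q(1)] by simp
  have "\<exists>i. t < (\<integral>x. tst (s i) x \<partial>q)"
  proof (rule ccontr)
    assume "\<not> ?thesis"
    then have *: "(\<integral>x. tst (s i) x \<partial>q) \<le> t" for i by (auto simp: not_less)
    then have "(SUP i. ennreal (\<integral>x. tst (s i) x \<partial>q)) \<le> ennreal t" by (intro SUP_least ennreal_leI)
    \<comment> \<open>\<open>ennreal\<close> truncates negative numbers to 0, so comparing the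
      suprema is informative only for nonnegative \<open>t\<close>.\<close>
    moreover have "0 \<le> t" using *[of 0] Bochner_Integration.integral_nonneg[of q "tst (s 0)"] tst_nonneg by (meson order_trans)
    ultimately show False using t unfolding eq by (simp add: ennreal_le_iff)
  qed
  then show ?thesis using that s(1) by auto
qed

lemma tst_below_bcont:
  fixes f :: "'a::polish_space \<Rightarrow> real"
  assumes f: "f \<in> bcont" "\<And>x. 0 \<le> f x" and q: "q \<in> prob_measures" and t: "t < (\<integral>x. f x \<partial>q)"
  obtains m where "\<And>x. tst m x \<le> f x" "t < (\<integral>x. tst m x \<partial>q)"
proof (rule tst_below_integral[OF f(2) _ q bcont_integrable[OF q f(1)] t])
  show "open {y. t < f y}" for t using f(1) unfolding bcont_def by (simp add: open_Collect_less)
qed (rule that)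

lemma tst_below_open:
  fixes U :: "'a::polish_space set"
  assumes U: "open U" and q: "q \<in> prob_measures" and t: "t < measure q U"
  obtains m where "\<And>x. tst m x \<le> indicator U x" "t < (\<integral>x. tst m x \<partial>q)"
proof (rule tst_below_integral[of "indicator U" q t])
  interpret prob_space q using prob_measuresD[OF q] by simp
  have "{y. t < indicator U y} = (if t < 0 then UNIV else if t < 1 then U else {})" for t :: real
    by (auto simp: indicator_def)
  then show "open {y. t < indicator U y}" for t :: real using U by simp
  show "integrable q (indicator U :: _ \<Rightarrow> real)" "t < (\<integral>x. indicator U x \<partial>q)"
    using U t prob_measuresD(2,3)[OF q] by (simp_all add: less_top[symmetric])
qed (use q that in auto)

text \<open>Test functions exhaust indicators of open sets from below, so the integrals determine
  the measures of open sets, which form a generating \<pi>-system.\<close>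

lemma prob_measures_eqI:
  fixes q q' :: "'a::polish_space measure"
  assumes q: "q \<in> prob_measures" and q': "q' \<in> prob_measures"
    and eq: "\<And>m. (\<integral>x. tst m x \<partial>q) = (\<integral>x. tst m x \<partial>q')"
  shows "q = q'"
proof -
  have le: "measure q U \<le> measure q' U"
    if "open U" and q: "q \<in> prob_measures" "q' \<in> prob_measures"
      and eq: "\<And>m. (\<integral>x. tst m x \<partial>q) = (\<integral>x. tst m x \<partial>q')" for q q' :: "'a measure" and U
  proof (rule ccontr)
    assume "\<not> ?thesis"
    then obtain m where m: "\<And>x. tst m x \<le> indicator U x" "measure q' U < (\<integral>x. tst m x \<partial>q)"
      using tst_below_open[OF \<open>open U\<close> q(1), of "measure q' U"] unfolding not_le by metis
    interpret prob_space q' using prob_measuresD[OF q(2)] by simp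
    have "(\<integral>x. tst m x \<partial>q') \<le> (\<integral>x. indicator U x \<partial>q')"
      using m(1) \<open>open U\<close> by (intro integral_mono blip_integrable[OF q(2) blip_tst] bounded_integrable[OF q(2), of _ 1])
        (auto simp del: indicator_simps(1) split: split_indicator)
    also have "\<dots> = measure q' U" using \<open>open U\<close> prob_measuresD[OF q(2)] by simp
    finally show False using m(2) eq by simp
  qed
  interpret q: prob_space q using prob_measuresD[OF q] by simp
  interpret q': prob_space q' using prob_measuresD[OF q'] by simp
  show ?thesis
  proof (rule measure_eqI_generator_eq[of "{U. open U}" UNIV q q' "\<lambda>_. UNIV"])
    show "emeasure q U = emeasure q' U" if "U \<in> {U. open U}" for U
      using le[OF _ q q' eq, of U] le[OF _ q' q eq[symmetric], of U] that
      by (simp add: q.emeasure_eq_measure q'.emeasure_eq_measure)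
  qed (auto simp: Int_stable_def prob_measuresD[OF q] prob_measuresD[OF q'] borel_def)
qed

section \<open>The narrow topology\<close>

definition coords :: "'a::polish_space measure \<Rightarrow> nat \<Rightarrow> real" where
  "coords q m = (\<integral>x. tst m x \<partial>q)"

text \<open>Test functions only give lower bounds on integrals; applying them to the nonnegative
  functions \<open>M + f\<close> and \<open>M - f\<close> bounds the integral of \<open>f\<close>
  from both sides, so two coordinates suffice.\<close>

lemma narrow_basis_coords:
  fixes f :: "'a::polish_space \<Rightarrow> real"
  assumes f: "f \<in> bcont" and U: "open U" and q: "q \<in> prob_measures" "(\<integral>x. f x \<partial>q) \<in> U"
  obtains V where "open V" "coords q \<in> V" "\<And>q'. q' \<in> prob_measures \<Longrightarrow> coords q' \<in> V \<Longrightarrow> (\<integral>x. f x \<partial>q') \<in> U"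
proof -
  obtain e where e: "e > 0" "ball (\<integral>x. f x \<partial>q) e \<subseteq> U" using U q(2) open_contains_ball by blast
  obtain M where M: "\<And>x. \<bar>f x\<bar> \<le> M" using bcontE[OF f] by metis
  have f1: "(\<lambda>x. M + f x) \<in> bcont" and f2: "(\<lambda>x. M - f x) \<in> bcont"
  proof -
    have "continuous_on UNIV f" using f unfolding bcont_def by simp
    moreover have "\<bar>M + f x\<bar> \<le> 2 * M" "\<bar>M - f x\<bar> \<le> 2 * M" for x using M[of x] by linarith+
    ultimately show "(\<lambda>x. M + f x) \<in> bcont" "(\<lambda>x. M - f x) \<in> bcont"
      unfolding bcont_def bounded_iff by (auto intro!: continuous_intros)
  qed
  have int: "(\<integral>x. M + f x \<partial>q') = M + (\<integral>x. f x \<partial>q')" "(\<integral>x. M - f x \<partial>q') = M - (\<integral>x. f x \<partial>q')"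
    if "q' \<in> prob_measures" for q'
  proof -
    interpret prob_space q' using prob_measuresD[OF that] by simp
    show "(\<integral>x. M + f x \<partial>q') = M + (\<integral>x. f x \<partial>q')" "(\<integral>x. M - f x \<partial>q') = M - (\<integral>x. f x \<partial>q')"
      using bcont_integrable[OF that f] prob_space by simp_all
  qed
  have nn: "0 \<le> M + f x" "0 \<le> M - f x" for x using M[of x] by linarith+
  obtain m1 where m1: "\<And>x. tst m1 x \<le> M + f x" "M + (\<integral>x. f x \<partial>q) - e < (\<integral>x. tst m1 x \<partial>q)"
    using tst_below_bcont[OF f1 _ q(1), of "M + (\<integral>x. f x \<partial>q) - e"] nn int[OF q(1)] e(1) by auto
  obtain m2 where m2: "\<And>x. tst m2 x \<le> M - f x" "M - (\<integral>x. f x \<partial>q) - e < (\<integral>x. tst m2 x \<partial>q)"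
    using tst_below_bcont[OF f2 _ q(1), of "M - (\<integral>x. f x \<partial>q) - e"] nn int[OF q(1)] e(1) by auto
  define V where "V = {y::nat\<Rightarrow>real. M + (\<integral>x. f x \<partial>q) - e < y m1} \<inter> {y. M - (\<integral>x. f x \<partial>q) - e < y m2}"
  show ?thesis
  proof (rule that[of V])
    show "open V" unfolding V_def by (intro open_Int open_Collect_less continuous_intros continuous_on_product_coordinates)
    show "coords q \<in> V" using m1 m2 by (simp add: V_def coords_def)
    fix q' :: "'a measure" assume q': "q' \<in> prob_measures" "coords q' \<in> V"
    have "(\<integral>x. tst m1 x \<partial>q') \<le> M + (\<integral>x. f x \<partial>q')"
      using integral_mono[OF blip_integrable[OF q'(1) blip_tst] bcont_integrable[OF q'(1) f1] m1(1)] int[OF q'(1)] by simp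
    moreover have "(\<integral>x. tst m2 x \<partial>q') \<le> M - (\<integral>x. f x \<partial>q')"
      using integral_mono[OF blip_integrable[OF q'(1) blip_tst] bcont_integrable[OF q'(1) f2] m2(1)] int[OF q'(1)] by simp
    ultimately have "(\<integral>x. f x \<partial>q') \<in> ball (\<integral>x. f x \<partial>q) e" using q'(2) by (auto simp: V_def coords_def dist_real_def)
    then show "(\<integral>x. f x \<partial>q') \<in> U" using e by auto
  qed
qed

text \<open>The topology induced by the countably many coordinates is as fine as the narrow one.
  Closedness, compactness, neighbourhoods and Borel measurability are transferred through this to a
  metrizable space.\<close>

lemma openin_narrow_coords:
  assumes "openin (narrow_topology :: 'a::polish_space measure topology) W"
  shows "\<exists>V. open V \<and> W = {q \<in> prob_measures. coords q \<in> V}"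
proof -
  have "generate_topology_on {{q \<in> prob_measures. (\<integral>x. f x \<partial>q) \<in> U} | f U. f \<in> bcont \<and> open U} W"
    using assms unfolding narrow_topology_def openin_topology_generated_by_iff .
  then show ?thesis
  proof (induction rule: generate_topology_on.induct)
    case Empty
    then show ?case by (intro exI[of _ "{}"]) auto
  next
    case (Int a b)
    then obtain V V' where "open V" "open V'" "a = {q \<in> prob_measures. coords q \<in> V}" "b = {q \<in> prob_measures. coords q \<in> V'}"
      by blast
    then show ?case by (intro exI[of _ "V \<inter> V'"]) auto
  next
    case (UN K)
    then obtain V where V: "\<And>k. k \<in> K \<Longrightarrow> open (V k)" "\<And>k. k \<in> K \<Longrightarrow> k = {q \<in> prob_measures. coords q \<in> V k}"
      by metis
    have "\<Union>K = {q \<in> prob_measures. coords q \<in> (\<Union>k\<in>K. V k)}" using V(2) by auto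
    then show ?case using V(1) by (intro exI[of _ "\<Union>k\<in>K. V k"]) blast
  next
    case (Basis s)
    then obtain f and U :: "real set" where s: "s = {q \<in> prob_measures. (\<integral>x. f x \<partial>q) \<in> U}" and f: "f \<in> bcont" "open U"
      by auto
    \<comment> \<open>The union of all open sets whose preimage lies in \<open>s\<close>; this
      avoids choosing a neighbourhood for each point.\<close>
    define \<V> where "\<V> = {V. open V \<and> (\<forall>q\<in>prob_measures. coords q \<in> V \<longrightarrow> q \<in> s)}"
    have "s \<subseteq> {q \<in> prob_measures. coords q \<in> \<Union>\<V>}"
    proof
      fix q assume "q \<in> s"
      then have q: "q \<in> prob_measures" "(\<integral>x. f x \<partial>q) \<in> U" by (auto simp: s)
      obtain V where "open V" "coords q \<in> V" "\<And>q'. q' \<in> prob_measures \<Longrightarrow> coords q' \<in> V \<Longrightarrow> (\<integral>x. f x \<partial>q') \<in> U"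
        using narrow_basis_coords[OF f q] by metis
      then show "q \<in> {q \<in> prob_measures. coords q \<in> \<Union>\<V>}" using q(1) by (auto simp: \<V>_def s)
    qed
    then have "s = {q \<in> prob_measures. coords q \<in> \<Union>\<V>}" by (auto simp: \<V>_def)
    then show ?case by (intro exI[of _ "\<Union>\<V>"]) (auto simp: \<V>_def)
  qed
qed

lemma openin_narrow_basis:
  assumes "f \<in> bcont" "open U"
  shows "openin narrow_topology {q \<in> prob_measures. (\<integral>x. f x \<partial>q) \<in> U}"
  unfolding narrow_topology_def openin_topology_generated_by_iff
  by (rule generate_topology_on.Basis) (use assms in blast)

lemma topspace_narrow: "topspace narrow_topology = (prob_measures :: 'a::topological_space measure set)"
proof -
  have "{q \<in> prob_measures. (\<integral>x. 0 \<partial>q) \<in> (UNIV::real set)} \<in>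
    {{q \<in> prob_measures. (\<integral>x. f x \<partial>q) \<in> U} | f U. f \<in> (bcont :: ('a \<Rightarrow> real) set) \<and> open (U::real set)}"
    by (auto simp: bcont_def intro!: exI[of _ "\<lambda>_. 0"] exI[of _ UNIV])
  then show ?thesis unfolding narrow_topology_def topology_generated_by_topspace by auto
qed

lemma narrow_closed_coords:
  fixes F :: "'a::polish_space measure set"
  assumes F: "closedin narrow_topology F" and q: "q \<in> prob_measures" and x: "\<And>n. x n \<in> F"
    and lim: "\<And>m. (\<lambda>n. coords (x n) m) \<longlonglongrightarrow> coords q m"
  shows "q \<in> F"
proof (rule ccontr)
  assume "q \<notin> F"
  obtain V where V: "open V" "topspace narrow_topology - F = {q \<in> prob_measures. coords q \<in> V}"
    using openin_narrow_coords F unfolding closedin_def by blast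
  have "(\<lambda>n. coords (x n)) \<longlonglongrightarrow> coords q"
    using lim limitin_componentwise[of "\<lambda>_. euclidean" UNIV "\<lambda>n. coords (x n)" "coords q" sequentially]
    by (simp add: euclidean_product_topology flip: limitin_canonical_iff)
  moreover have "coords q \<in> V" using \<open>q \<notin> F\<close> q V(2) by (auto simp: topspace_narrow)
  ultimately have "eventually (\<lambda>n. coords (x n) \<in> V) sequentially"
    using V(1) topological_tendstoD by blast
  then obtain n where "coords (x n) \<in> V" by (auto simp: eventually_sequentially)
  moreover have "x n \<in> prob_measures" using x F by (metis closedin_subset subsetD topspace_narrow)
  ultimately show False using V(2) x by auto
qed

text \<open>The countable product of real lines is metrizable, so sequential compactness of the
  image under \<open>coords\<close> gives compactness, and a narrow open cover is the preimage of an
  open cover of that image.\<close>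

lemma narrow_compactI:
  fixes S :: "'a::polish_space measure set"
  assumes S: "S \<subseteq> prob_measures"
    and seq: "\<And>x::nat \<Rightarrow> 'a measure. (\<And>n. x n \<in> S) \<Longrightarrow>
       \<exists>r q. strict_mono r \<and> q \<in> S \<and> (\<forall>m. (\<lambda>n. coords (x (r n)) m) \<longlonglongrightarrow> coords q m)"
  shows "compactin narrow_topology S"
proof -
  have "seq_compact (coords ` S)"
  proof (rule seq_compactI)
    fix f :: "nat \<Rightarrow> nat \<Rightarrow> real" assume "\<forall>n. f n \<in> coords ` S"
    then have "\<forall>n. \<exists>q. q \<in> S \<and> f n = coords q" by blast
    from choice[OF this] obtain x where "\<forall>n. x n \<in> S \<and> f n = coords (x n)" ..
    then have x: "\<And>n. x n \<in> S" "\<And>n. f n = coords (x n)" by simp_all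
    obtain r q where r: "strict_mono r" "q \<in> S" "\<And>m. (\<lambda>n. coords (x (r n)) m) \<longlonglongrightarrow> coords q m"
      using seq[of x, OF x(1)] by blast
    have "(\<lambda>n. coords (x (r n))) \<longlonglongrightarrow> coords q"
      using r(3) limitin_componentwise[of "\<lambda>_. euclidean" UNIV "\<lambda>n. coords (x (r n))" "coords q" sequentially]
      by (simp add: euclidean_product_topology flip: limitin_canonical_iff)
    then show "\<exists>l\<in>coords ` S. \<exists>r. strict_mono r \<and> (f \<circ> r) \<longlonglongrightarrow> l"
      using r(1,2) by (auto simp: o_def x(2))
  qed
  then have comp: "compact (coords ` S)" by (simp add: compact_eq_seq_compact_metric)
  show ?thesis unfolding compactin_def topspace_narrow
  proof (intro conjI S allI impI)
    fix \<U> assume U: "Ball \<U> (openin (narrow_topology :: 'a measure topology)) \<and> S \<subseteq> \<Union>\<U>"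
    then have "\<forall>W\<in>\<U>. \<exists>V. open V \<and> W = {q \<in> prob_measures. coords q \<in> V}"
      using openin_narrow_coords by blast
    then obtain V where V: "\<And>W. W \<in> \<U> \<Longrightarrow> open (V W)" "\<And>W. W \<in> \<U> \<Longrightarrow> W = {q \<in> prob_measures. coords q \<in> V W}"
      by metis
    have "coords ` S \<subseteq> (\<Union>W\<in>\<U>. V W)" using U V(2) by blast
    then obtain \<F> where F: "\<F> \<subseteq> \<U>" "finite \<F>" "coords ` S \<subseteq> (\<Union>W\<in>\<F>. V W)"
      using compactE_image[OF comp, of \<U> V] V(1) by metis
    have "S \<subseteq> \<Union>\<F>"
    proof
      fix q assume q: "q \<in> S"
      then obtain W where W: "W \<in> \<F>" "coords q \<in> V W" using F(3) by auto
      then show "q \<in> \<Union>\<F>" using V(2)[of W] F(1) q S by blast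
    qed
    then show "\<exists>\<F>. finite \<F> \<and> \<F> \<subseteq> \<U> \<and> S \<subseteq> \<Union>\<F>" using F by blast
  qed
qed

section \<open>Sequential compactness of tight sequences\<close>

text \<open>Splits the space into countably many Borel cells of radius \<open>d\<close> around dense
  points, by the first index that is close enough. Tightness becomes boundedness in probability of
  this integer.\<close>

definition code :: "real \<Rightarrow> 'a::polish_space \<Rightarrow> nat" where
  "code d x = (LEAST j. dist x (dense_sequence j) < d)"

lemma code_dist: "d > 0 \<Longrightarrow> dist x (dense_sequence (code d x)) < d"
  unfolding code_def by (rule LeastI_ex) (rule dense_sequence)

lemma code_le: "dist x (dense_sequence j) < d \<Longrightarrow> code d x \<le> j"
  unfolding code_def by (rule Least_le)

lemma measurable_code [measurable]: "code d \<in> measurable borel (count_space UNIV)"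
  unfolding code_def by measurable

text \<open>Tightness scale by scale, with finite unions of balls and only eventually along the
  sequence. Completeness turns this into relative compactness, and it is the form that half-space
  constraints deliver.\<close>

definition tight_seq :: "(nat \<Rightarrow> 'a::polish_space measure) \<Rightarrow> bool" where
  "tight_seq q \<longleftrightarrow> (\<forall>d>0. \<forall>e>0. \<exists>S. finite S \<and>
     (\<forall>\<^sub>F n in sequentially. measure (q n) (UNIV - (\<Union>s\<in>S. ball s d)) \<le> e))"

text \<open>The radius is halved so that each centre can be moved to a dense point nearby; the
  largest index of these finitely many points is \<open>b\<close>.\<close>

lemma tight_code:
  fixes q :: "nat \<Rightarrow> 'a::polish_space measure"
  assumes tight: "tight_seq q" and q: "\<And>n. q n \<in> prob_measures" and "d > 0" "e > 0"
  shows "\<exists>b. \<forall>\<^sub>F n in sequentially. measure (q n) {x. b < code d x} \<le> e"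
proof -
  have "d/2 > 0" using assms by simp
  then obtain S where S: "finite S" "\<forall>\<^sub>F n in sequentially. measure (q n) (UNIV - (\<Union>s\<in>S. ball s (d/2))) \<le> e"
    using tight \<open>e > 0\<close> unfolding tight_seq_def by blast
  obtain j where j: "\<And>s::'a. dist s (dense_sequence (j s)) < d/2"
    using dense_sequence[OF \<open>d/2 > 0\<close>] by metis
  define b where "b = Max (insert 0 (j ` S))"
  have b: "j s \<le> b" if "s \<in> S" for s unfolding b_def using S(1) that by (intro Max_ge) auto
  have sub: "{x. b < code d x} \<subseteq> UNIV - (\<Union>s\<in>S. ball s (d/2))"
  proof (rule subsetI, rule DiffI[OF UNIV_I], rule notI)
    fix x assume "x \<in> {x. b < code d x}" "x \<in> (\<Union>s\<in>S. ball s (d/2))"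
    then obtain s where "b < code d x" "s \<in> S" "x \<in> ball s (d/2)" by blast
    have "dist x (dense_sequence (j s)) < d"
      using j[of s] \<open>x \<in> ball s (d/2)\<close> dist_triangle[of x "dense_sequence (j s)" s] by (simp add: dist_commute)
    then show False using code_le[of x "j s" d] b[OF \<open>s \<in> S\<close>] \<open>b < code d x\<close> by simp
  qed
  from S(2) have "\<forall>\<^sub>F n in sequentially. measure (q n) {x. b < code d x} \<le> e"
  proof eventually_elim
    case (elim n)
    interpret prob_space "q n" using prob_measuresD[OF q] by simp
    have "open (\<Union>s\<in>S. ball s (d/2))" by blast
    then have "UNIV - (\<Union>s\<in>S. ball s (d/2)) \<in> sets (q n)" using prob_measuresD(2)[OF q] by auto
    from finite_measure_mono[OF sub this] elim show ?case by linarith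
  qed
  then show ?thesis by blast
qed

section \<open>Words of codes at dyadic scales and their cylinders\<close>

primrec code_path :: "nat \<Rightarrow> 'a::polish_space \<Rightarrow> nat list" where
  "code_path 0 x = []"
| "code_path (Suc l) x = code ((1/2)^l) x # code_path l x"

definition cyl :: "nat list \<Rightarrow> 'a::polish_space set" where
  "cyl w = {x. code_path (length w) x = w}"

lemma length_code_path [simp]: "length (code_path l x) = l" by (induction l) auto

lemma cyl_Nil: "cyl [] = UNIV" unfolding cyl_def by simp

lemma cyl_Cons: "cyl (j # w) = cyl w \<inter> {x. code ((1/2)^length w) x = j}"
  unfolding cyl_def by auto

lemma cyl_measurable [measurable]: "(cyl w :: 'a::polish_space set) \<in> sets borel"
proof (induction w)
  case (Cons j w)
  have "{x::'a. code ((1/2)^length w) x = j} \<in> sets borel" by measurable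
  then show ?case using Cons unfolding cyl_Cons by (intro sets.Int)
qed (simp add: cyl_Nil)

text \<open>A union bound over the \<open>l\<close> scales: outside an event of probability at most
  \<open>e\<close> all letters are at most \<open>b\<close>, so finitely many words carry almost all
  the mass.\<close>

lemma tight_path:
  fixes q :: "nat \<Rightarrow> 'a::polish_space measure"
  assumes tight: "tight_seq q" and q: "\<And>n. q n \<in> prob_measures" and "e > 0"
  shows "\<exists>b. \<forall>\<^sub>F n in sequentially.
    1 - e \<le> measure (q n) (\<Union>w\<in>{w. length w = l \<and> set w \<subseteq> {..b}}. cyl w)"
proof -
  \<comment> \<open>\<open>Suc l\<close> keeps the share of \<open>e\<close> positive also for the
    empty word.\<close>
  have "\<exists>b. \<forall>\<^sub>F n in sequentially. measure (q n) {x. b < code ((1/2)^i) x} \<le> e / Suc l" for i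
    by (rule tight_code[OF tight q]) (use \<open>e > 0\<close> in auto)
  then obtain B where B: "\<And>i. \<forall>\<^sub>F n in sequentially. measure (q n) {x. B i < code ((1/2)^i) x} \<le> e / Suc l"
    by metis
  define b where "b = Max (B ` {..l})"
  have b: "B i \<le> b" if "i \<le> l" for i unfolding b_def using that by (intro Max_ge) auto
  define W where "W = {w. length w = l \<and> set w \<subseteq> {..b}}"
  have path_set: "set (code_path m x) \<subseteq> {..b}" if "\<And>i. i < m \<Longrightarrow> code ((1/2)^i) x \<le> b" for m and x :: 'a
    using that by (induction m) auto
  have sub: "UNIV - (\<Union>w\<in>W. cyl w :: 'a set) \<subseteq> (\<Union>i\<in>{..<l}. {x. B i < code ((1/2)^i) x})"
  proof (rule subsetI, rule ccontr)
    fix x :: 'a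
    assume "x \<in> UNIV - (\<Union>w\<in>W. cyl w)" "x \<notin> (\<Union>i\<in>{..<l}. {x. B i < code ((1/2)^i) x})"
    then have x: "x \<notin> (\<Union>w\<in>W. cyl w)" "\<And>i. i < l \<Longrightarrow> code ((1/2)^i) x \<le> B i"
      by (auto simp: not_less)
    have "code ((1/2)^i) x \<le> b" if "i < l" for i
      using x(2)[OF that] b[of i] that by linarith
    then have "code_path l x \<in> W" using path_set[of l x] unfolding W_def by simp
    moreover have "x \<in> cyl (code_path l x)" unfolding cyl_def by simp
    ultimately show False using x(1) by blast
  qed
  have "\<forall>\<^sub>F n in sequentially. \<forall>i\<in>{..<l}. measure (q n) {x. B i < code ((1/2)^i) x} \<le> e / Suc l"
    by (rule eventually_ball_finite) (use B in auto)
  then have "\<forall>\<^sub>F n in sequentially. 1 - e \<le> measure (q n) (\<Union>w\<in>W. cyl w)"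
  proof eventually_elim
    case (elim n)
    interpret prob_space "q n" using prob_measuresD[OF q] by simp
    note [measurable_cong] = prob_measuresD(2)[OF q]
    have s: "sets (q n) = sets borel" "space (q n) = UNIV" using prob_measuresD[OF q] by auto
    have finW: "finite W" unfolding W_def using finite_lists_length_eq[of "{..b}" l] by (simp add: conj_commute)
    have WM: "(\<Union>w\<in>W. cyl w) \<in> sets (q n)" unfolding s using finW by (intro sets.finite_UN) auto
    have "measure (q n) (UNIV - (\<Union>w\<in>W. cyl w)) \<le> measure (q n) (\<Union>i\<in>{..<l}. {x. B i < code ((1/2)^i) x})"
      by (rule finite_measure_mono[OF sub]) (simp add: s)
    also have "\<dots> \<le> (\<Sum>i<l. measure (q n) {x. B i < code ((1/2)^i) x})"
      by (rule measure_UNION_le) (auto simp: s)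
    also have "\<dots> \<le> (\<Sum>i<l. e / Suc l)" using elim by (intro sum_mono) auto
    also have "\<dots> \<le> e" using \<open>e > 0\<close> by (simp add: field_simps)
    finally show ?case using prob_compl[OF WM] s(2) by (simp add: Compl_eq_Diff_UNIV)
  qed
  then show ?thesis unfolding W_def by blast
qed

text \<open>Compactness and metrizability of the countable power of the unit interval take the place
  of an explicit diagonal extraction.\<close>

lemma unit_interval_diagonal:
  fixes u :: "nat \<Rightarrow> nat \<Rightarrow> real"
  assumes "\<And>n m. u n m \<in> {0..1}"
  obtains r y where "strict_mono r" "\<And>m. (\<lambda>n. u (r n) m) \<longlonglongrightarrow> y m"
proof -
  have "compactin (product_topology (\<lambda>_::nat. euclidean) UNIV) (PiE UNIV (\<lambda>_. {0..1::real}))"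
    by (subst compactin_PiE) auto
  then have "compact (PiE UNIV (\<lambda>_::nat. {0..1::real}))" by (simp add: euclidean_product_topology)
  then have "seq_compact (PiE UNIV (\<lambda>_::nat. {0..1::real}))" by (simp add: compact_eq_seq_compact_metric)
  then obtain y r where "strict_mono r" "(u \<circ> r) \<longlonglongrightarrow> y"
    using assms by (elim seq_compactE[of _ u]) auto
  then have "strict_mono r" "\<And>m. (\<lambda>n. u (r n) m) \<longlonglongrightarrow> y m"
    using limitin_componentwise[of "\<lambda>_. euclidean" UNIV "u \<circ> r" y sequentially]
    by (simp_all add: euclidean_product_topology flip: limitin_canonical_iff)
  then show ?thesis using that by blast
qed

text \<open>Words are stored in reverse, so that extending a word is consing. Nested intervals of
  length \<open>p w\<close> realise prescribed cylinder probabilities on the unit interval.\<close>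

locale word_tree =
  fixes p :: "nat list \<Rightarrow> real"
  assumes nonneg: "p w \<ge> 0" and Nil: "p [] = 1" and sums: "(\<lambda>j. p (j # w)) sums p w"
begin

text \<open>Left end point of the interval of a word, whose right end is \<open>lo w + p w\<close>.
  The children of \<open>w\<close> are laid out side by side, from left to right, inside the
  interval of \<open>w\<close>.\<close>

primrec lo :: "nat list \<Rightarrow> real" where
  "lo [] = 0"
| "lo (j # w) = lo w + (\<Sum>i<j. p (i # w))"

primrec word :: "nat \<Rightarrow> real \<Rightarrow> nat list" where
  "word 0 u = []"
| "word (Suc l) u = (LEAST j. u < lo (j # word l u) + p (j # word l u)) # word l u"

lemma length_word [simp]: "length (word l u) = l" by (induction l) auto

lemma hi_Cons: "lo (j # w) + p (j # w) = lo w + (\<Sum>i<Suc j. p (i # w))"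
  by simp

lemma partial_le: "(\<Sum>i<j. p (i # w)) \<le> p w"
  using sum_le_suminf[of "\<lambda>i. p (i # w)" "{..<j}"] sums[of w] nonneg by (simp add: sums_iff)

lemma interval_subset: "{lo (j # w)..<lo (j # w) + p (j # w)} \<subseteq> {lo w..<lo w + p w}"
proof -
  have "0 \<le> (\<Sum>i<j. p (i # w))" using nonneg by (intro sum_nonneg) auto
  then show ?thesis using partial_le[where j = "Suc j" and w = w] by auto
qed

text \<open>The children fill the interval of \<open>w\<close> since their lengths sum to
  \<open>p w\<close>; hence some child ends beyond \<open>u\<close>, and the first such child also
  begins at or before \<open>u\<close>.\<close>

lemma word_in: "u \<in> {0..<1} \<Longrightarrow> u \<in> {lo (word l u)..<lo (word l u) + p (word l u)}"
proof (induction l)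
  case 0
  then show ?case by (simp add: Nil)
next
  case (Suc l)
  define w where "w = word l u"
  have u: "lo w \<le> u" "u < lo w + p w" using Suc by (auto simp: w_def)
  have "(\<lambda>n. \<Sum>i<n. p (i # w)) \<longlonglongrightarrow> p w" using sums[of w] unfolding sums_def .
  then have "eventually (\<lambda>n. u - lo w < (\<Sum>i<n. p (i # w))) sequentially"
    by (rule order_tendstoD) (use u in simp)
  then obtain n where "u - lo w < (\<Sum>i<n. p (i # w))" by (auto simp: eventually_sequentially)
  moreover have "(\<Sum>i<n. p (i # w)) \<le> (\<Sum>i<Suc n. p (i # w))" using nonneg by simp
  ultimately have ex: "\<exists>j. u < lo (j # w) + p (j # w)" unfolding hi_Cons by (intro exI[of _ n]) linarith
  define j where "j = (LEAST j. u < lo (j # w) + p (j # w))"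
  have 1: "u < lo (j # w) + p (j # w)" unfolding j_def by (rule LeastI_ex[OF ex])
  have 2: "lo (j # w) \<le> u"
  proof (cases j)
    case 0
    then show ?thesis using u by simp
  next
    case (Suc i)
    then have "\<not> u < lo (i # w) + p (i # w)" unfolding j_def by (metis lessI not_less_Least)
    then show ?thesis unfolding hi_Cons using Suc by simp
  qed
  show ?case unfolding word.simps w_def[symmetric] j_def[symmetric] using 1 2 by simp
qed

lemma word_eq: "u \<in> {lo w..<lo w + p w} \<Longrightarrow> word (length w) u = w"
proof (induction w)
  case (Cons j w)
  then have w: "word (length w) u = w" using interval_subset[of j w] by auto
  have "(LEAST j. u < lo (j # w) + p (j # w)) = j"
  proof (rule Least_equality)
    show "u < lo (j # w) + p (j # w)" using Cons by simp
    fix i assume i: "u < lo (i # w) + p (i # w)"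
    show "j \<le> i"
    proof (rule ccontr)
      assume "\<not> j \<le> i"
      then have "(\<Sum>m<Suc i. p (m # w)) \<le> (\<Sum>m<j. p (m # w))" using nonneg by (intro sum_mono2) auto
      then show False using i Cons.prems unfolding hi_Cons by simp
    qed
  qed
  then show ?case using w by simp
qed simp

lemma interval_unit: "{lo w..<lo w + p w} \<subseteq> {0..<1}"
proof (induction w)
  case (Cons j w)
  then show ?case using interval_subset[of j w] by (meson order_trans)
qed (simp add: Nil)

lemma word_vimage: "{u\<in>{0..<1}. word l u = w} = (if length w = l then {lo w..<lo w + p w} else {})"
proof (cases "length w = l")
  case True
  have "u \<in> {0..<1} \<and> word l u = w \<longleftrightarrow> u \<in> {lo w..<lo w + p w}" for u
    using word_in[of u l] word_eq[of u w] interval_unit[of w] True by blast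
  then have "{u\<in>{0..<1}. word l u = w} = {lo w..<lo w + p w}" by (simp only: set_eq_iff mem_Collect_eq simp_thms)
  then show ?thesis by (simp only: if_P[OF True])
next
  case False
  then have "{u\<in>{0..<1}. word l u = w} = {}" using length_word[of l] by blast
  then show ?thesis by (simp only: if_not_P[OF False])
qed

text \<open>The half-open interval of the word contains \<open>u\<close>, so it is not empty. Thus
  only words of positive limiting mass are ever visited.\<close>

lemma p_word_pos: "u \<in> {0..<1} \<Longrightarrow> p (word l u) > 0"
  using word_in[of u l] by auto

abbreviation "unif \<equiv> restrict_space lborel {0..<1::real}"

lemma prob_space_unif: "prob_space unif"
  by (rule prob_spaceI) (simp add: emeasure_restrict_space space_restrict_space)

lemma measurable_word [measurable]: "word l \<in> measurable unif (count_space UNIV)"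
proof (subst measurable_count_space_eq_countable, safe)
  fix w
  have "word l -` {w} \<inter> space unif = {u\<in>{0..<1}. word l u = w}" by (auto simp: space_restrict_space)
  also have "\<dots> \<in> sets unif" unfolding word_vimage using interval_unit[of w] by (auto simp: sets_restrict_space_iff)
  finally show "word l -` {w} \<inter> space unif \<in> sets unif" .
qed auto

lemma measure_word: "measure unif {u\<in>space unif. word (length w) u = w} = p w"
  using interval_unit[of w] nonneg[of w] word_vimage[of "length w" w]
  by (simp add: space_restrict_space measure_restrict_space)

end

text \<open>Replaces \<open>f\<close> by constants on finitely many cells: the error is
  \<open>d\<close> on the cells and at most \<open>B\<close> on the remaining mass, which is at most
  \<open>e\<close>. Only masses of cells appear in the approximation, so it can be used on both
  sides of a limit.\<close>

lemma step_approx: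
  fixes f :: "'a \<Rightarrow> real"
  assumes "prob_space M" and W: "finite W" "\<And>w. w \<in> W \<Longrightarrow> C w \<in> sets M" "disjoint_family_on C W"
    and f: "f \<in> borel_measurable M" "\<And>x. x \<in> space M \<Longrightarrow> \<bar>f x\<bar> \<le> B"
    and c: "\<And>w x. w \<in> W \<Longrightarrow> x \<in> C w \<Longrightarrow> \<bar>f x - c w\<bar> \<le> d" and "d \<ge> 0"
    and e: "1 - e \<le> (\<Sum>w\<in>W. measure M (C w))"
  shows "\<bar>(\<integral>x. f x \<partial>M) - (\<Sum>w\<in>W. c w * measure M (C w))\<bar> \<le> d + B * e"
proof -
  interpret prob_space M by fact
  obtain x0 where "x0 \<in> space M" using not_empty by auto
  then have "B \<ge> 0" using f(2)[of x0] by linarith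
  define A where "A = space M - (\<Union>w\<in>W. C w)"
  have U: "(\<Union>w\<in>W. C w) \<in> sets M" using W by auto
  then have A: "A \<in> sets M" unfolding A_def by auto
  define g where "g x = (\<Sum>w\<in>W. c w * indicator (C w) x)" for x
  have int: "integrable M (\<lambda>x. c w * indicator (C w) x)" if "w \<in> W" for w
    using W(2)[OF that] by (simp add: less_top[symmetric])
  have g: "integrable M g" unfolding g_def using int by auto
  have "(\<integral>x. g x \<partial>M) = (\<Sum>w\<in>W. c w * measure M (C w))"
    unfolding g_def using int W(2) by (subst Bochner_Integration.integral_sum) (auto simp: sets.Int_space_eq2)
  moreover have fi: "integrable M f" by (rule integrable_const_bound[of _ B]) (use f in auto)
  ultimately have "\<bar>(\<integral>x. f x \<partial>M) - (\<Sum>w\<in>W. c w * measure M (C w))\<bar> = \<bar>\<integral>x. f x - g x \<partial>M\<bar>"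
    using g by simp
  also have "\<dots> \<le> (\<integral>x. \<bar>f x - g x\<bar> \<partial>M)" by (rule integral_abs_bound)
  also have "\<dots> \<le> (\<integral>x. d + B * indicator A x \<partial>M)"
  proof (rule integral_mono)
    show "integrable M (\<lambda>x. \<bar>f x - g x\<bar>)" using fi g by auto
    show "integrable M (\<lambda>x. d + B * indicator A x)" using A by (simp add: less_top[symmetric])
    fix x assume x: "x \<in> space M"
    show "\<bar>f x - g x\<bar> \<le> d + B * indicator A x"
    proof (cases "x \<in> A")
      case True
      then have "g x = 0" unfolding g_def A_def by (intro sum.neutral) (auto simp: indicator_def)
      then show ?thesis using True f(2)[OF x] \<open>d \<ge> 0\<close> by simp
    next
      case False
      then obtain w where w: "w \<in> W" "x \<in> C w" using x unfolding A_def by auto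
      have "indicator (C v) x = (if v = w then 1 else 0 :: real)" if "v \<in> W" for v
        using w that W(3) unfolding disjoint_family_on_def by (auto simp: indicator_def)
      then have "g x = (\<Sum>v\<in>W. c v * (if v = w then 1 else 0))" unfolding g_def by (intro sum.cong) auto
      also have "\<dots> = c w" using w(1) W(1) by (subst sum.remove[of _ w]) auto
      finally show ?thesis using c[OF w] False by simp
    qed
  qed
  also have "\<dots> = d + B * measure M A" using A by (simp add: prob_space less_top[symmetric] sets.Int_space_eq2)
  also have "measure M A = 1 - (\<Sum>w\<in>W. measure M (C w))"
    unfolding A_def using prob_compl[OF U] finite_measure_finite_Union[OF W(1) _ W(3)] W(2) by auto
  also have "d + B * \<dots> \<le> d + B * e" using e \<open>B \<ge> 0\<close> by (intro add_left_mono mult_left_mono) auto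
  finally show ?thesis .
qed

text \<open>A sequential form of Prokhorov's theorem. Cylinder masses converge along a subsequence
  to a tree \<open>p\<close>; a uniform point of \<open>[0, 1)\<close> follows the tree, the dense
  points attached to its words form a Cauchy sequence, and the law of their limit is the limit
  measure.\<close>

theorem tight_imp_convergent_subseq:
  fixes q :: "nat \<Rightarrow> 'a::polish_space measure"
  assumes q: "\<And>n. q n \<in> prob_measures" and tight: "tight_seq q"
  obtains r l where "strict_mono r" "l \<in> prob_measures"
    "\<And>f. blip f \<Longrightarrow> (\<lambda>n. \<integral>x. f x \<partial>q (r n)) \<longlonglongrightarrow> (\<integral>x. f x \<partial>l)"
proof -
  have qs: "sets (q n) = sets borel" "space (q n) = UNIV" for n using prob_measuresD[OF q] by auto
  obtain r y where r: "strict_mono r" and y: "\<And>m. (\<lambda>n. measure (q (r n)) (cyl (from_nat m))) \<longlonglongrightarrow> y m"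
  proof -
    have "measure (q n) (cyl (from_nat m)) \<in> {0..1}" for n m
    proof -
      interpret prob_space "q n" using prob_measuresD[OF q] by simp
      show ?thesis by simp
    qed
    then show ?thesis by (rule unit_interval_diagonal) (rule that)
  qed
  define p where "p w = y (to_nat w)" for w :: "nat list"
  have lim: "(\<lambda>n. measure (q (r n)) (cyl w)) \<longlonglongrightarrow> p w" for w
    using y[of "to_nat w"] by (simp add: p_def)
  have sub: "\<forall>\<^sub>F n in sequentially. P (r n)" if "\<forall>\<^sub>F n in sequentially. P n" for P
    using eventually_subseq[OF r that] .
  interpret word_tree p
  proof
    show "p w \<ge> 0" for w by (rule LIMSEQ_le_const[OF lim]) simp
    have "measure (q (r n)) (cyl []) = 1" for n
      using prob_space.prob_space[OF prob_measuresD(1)[OF q[of "r n"]]] by (simp add: cyl_Nil qs)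
    then show "p [] = 1" using LIMSEQ_unique[OF lim[of "[]"]] by simp
    fix w :: "nat list"
    define c where "c = (\<lambda>x::'a. code ((1/2)^length w) x)"
    have part: "(\<Sum>j<m. measure (q n) (cyl (j # w))) = measure (q n) (cyl w \<inter> {x. c x < m})" for m n
    proof -
      interpret prob_space "q n" using prob_measuresD[OF q] by simp
      have "(\<Union>j<m. cyl (j # w)) = cyl w \<inter> {x. c x < m}" unfolding cyl_Cons c_def by auto
      moreover have "disjoint_family_on (\<lambda>j. cyl (j # w) :: 'a set) {..<m}"
        unfolding disjoint_family_on_def cyl_Cons by auto
      ultimately show ?thesis using finite_measure_finite_Union[of "{..<m}" "\<lambda>j. cyl (j # w)"] by (auto simp: qs image_subset_iff)
    qed
    have c_meas: "{x. c x < m} \<in> sets borel" "{x. b < c x} \<in> sets borel" for m b unfolding c_def by measurable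
    have le: "(\<Sum>j<m. p (j # w)) \<le> p w" for m
    proof (rule LIMSEQ_le[OF tendsto_sum[OF lim] lim])
      show "\<exists>N. \<forall>n\<ge>N. (\<Sum>j<m. measure (q (r n)) (cyl (j # w))) \<le> measure (q (r n)) (cyl w)"
      proof (intro exI allI impI)
        fix n
        interpret prob_space "q (r n)" using prob_measuresD[OF q] by simp
        show "(\<Sum>j<m. measure (q (r n)) (cyl (j # w))) \<le> measure (q (r n)) (cyl w)"
          unfolding part by (rule finite_measure_mono) (auto simp: qs)
      qed
    qed
    \<comment> \<open>Passing finite sums to the limit only gives \<open>le\<close>. Equality says
      that no mass escapes to letters beyond every bound, and this is what tightness at scale
      \<open>(1/2)^length w\<close> provides.\<close>
    show "(\<lambda>j. p (j # w)) sums p w"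
      unfolding sums_def
    proof (rule LIMSEQ_I)
      fix e :: real assume "e > 0"
      then have "e/2 > 0" by simp
      obtain b where "\<forall>\<^sub>F n in sequentially. measure (q n) {x. b < code ((1/2)^length w) x} \<le> e/2"
        using tight_code[OF tight q, of "(1/2)^length w" "e/2"] \<open>e/2 > 0\<close> by auto
      then have b: "\<forall>\<^sub>F n in sequentially. measure (q (r n)) {x. b < c x} \<le> e/2"
        unfolding c_def by (rule sub)
      have "\<bar>(\<Sum>j<m. p (j # w)) - p w\<bar> < e" if "m \<ge> Suc b" for m
      proof -
        have "(\<lambda>n. measure (q (r n)) (cyl w) - (\<Sum>j<m. measure (q (r n)) (cyl (j # w)))) \<longlonglongrightarrow> p w - (\<Sum>j<m. p (j # w))"
          by (intro tendsto_diff tendsto_sum lim)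
        then have "p w - (\<Sum>j<m. p (j # w)) \<le> e/2"
        proof (rule tendsto_upperbound)
          from b show "\<forall>\<^sub>F n in sequentially. measure (q (r n)) (cyl w) - (\<Sum>j<m. measure (q (r n)) (cyl (j # w))) \<le> e/2"
          proof eventually_elim
            case (elim n)
            interpret prob_space "q (r n)" using prob_measuresD[OF q] by simp
            have "measure (q (r n)) (cyl w) \<le> measure (q (r n)) ((cyl w \<inter> {x. c x < m}) \<union> {x. b < c x})"
              by (rule finite_measure_mono) (use that c_meas in \<open>auto simp: qs\<close>)
            also have "\<dots> \<le> measure (q (r n)) (cyl w \<inter> {x. c x < m}) + measure (q (r n)) {x. b < c x}"
              by (rule measure_Un_le) (use c_meas in \<open>auto simp: qs\<close>)
            finally show ?case using elim unfolding part by simp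
          qed
        qed simp
        then show ?thesis using le[of m] \<open>e > 0\<close> by simp
      qed
      then show "\<exists>no. \<forall>n\<ge>no. norm ((\<Sum>j<n. p (j # w)) - p w) < e" by (intro exI[of _ "Suc b"]) simp
    qed
  qed
  interpret U: prob_space unif by (rule prob_space_unif)
  have spU: "space unif = {0..<1}" by (simp add: space_restrict_space)
  \<comment> \<open>A function of the word alone, hence measurable, and within
    \<open>(1/2)^l\<close> of every point of the cylinder of \<open>word (Suc l) u\<close>: the head
    of a word with \<open>Suc l\<close> letters is the letter of scale
    \<open>(1/2)^l\<close>.\<close>
  define X where "X l u = (dense_sequence (hd (word (Suc l) u)) :: 'a)" for l u
  have cyl_ne: "cyl w \<noteq> ({} :: 'a set)" if "p w > 0" for w
  proof
    assume "cyl w = ({} :: 'a set)"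
    then show False using LIMSEQ_unique[OF lim[of w], of 0] that by simp
  qed
  have cyl_mono: "cyl (word (l + i) u) \<subseteq> (cyl (word l u) :: 'a set)" for l i u
    by (induction i) (auto simp: cyl_Cons)
  have X_near: "dist x (X l u) < (1/2)^l" if "x \<in> cyl (word (Suc l) u)" for x l u
    using that code_dist[of "(1/2)^l" x] unfolding X_def word.simps cyl_Cons by auto
  \<comment> \<open>The longer word has positive limiting mass, so its cylinder contains some
    \<open>x\<close>; this \<open>x\<close> lies in the shorter cylinder too and is close to both
    approximations.\<close>
  have X_dist: "dist (X l u) (X (l + i) u) \<le> 2 * (1/2)^l" if u: "u \<in> {0..<1}" for l i u
  proof -
    obtain x :: 'a where x: "x \<in> cyl (word (Suc (l + i)) u)" using cyl_ne p_word_pos[OF u] by blast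
    then have "x \<in> cyl (word (Suc l) u)" using cyl_mono[of "Suc l" i u] by auto
    moreover have "(1/2::real)^(l + i) \<le> (1/2)^l" by (rule power_decreasing) auto
    ultimately show ?thesis
      using X_near[OF x] X_near[of x l u] dist_triangle2[of "X l u" "X (l + i) u" x]
        dist_commute[of x "X l u"] dist_commute[of x "X (l + i) u"] by linarith
  qed
  have X_conv: "convergent (\<lambda>l. X l u)" if u: "u \<in> {0..<1}" for u
  proof (rule Cauchy_convergent, rule metric_CauchyI)
    fix e :: real assume "e > 0"
    then obtain l where l: "(1/2)^l < e/4" using real_arch_pow_inv[of "e/4" "1/2"] by auto
    show "\<exists>M. \<forall>m\<ge>M. \<forall>n\<ge>M. dist (X m u) (X n u) < e"
    proof (intro exI[of _ l] allI impI)
      fix m n assume "m \<ge> l" "n \<ge> l"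
      then show "dist (X m u) (X n u) < e"
        using X_dist[OF u, of l "m - l"] X_dist[OF u, of l "n - l"] l dist_triangle3[of "X m u" "X n u" "X l u"] by simp
    qed
  qed
  define Y where "Y u = lim (\<lambda>l. X l u)" for u
  have Y_lim: "(\<lambda>l. X l u) \<longlonglongrightarrow> Y u" if "u \<in> {0..<1}" for u
    using X_conv[OF that] by (simp add: Y_def convergent_LIMSEQ_iff)
  have Y_dist: "dist (Y u) (X l u) \<le> 2 * (1/2)^l" if u: "u \<in> {0..<1}" for u l
  proof (rule tendsto_upperbound)
    show "(\<lambda>i. dist (X (i + l) u) (X l u)) \<longlonglongrightarrow> dist (Y u) (X l u)"
      using LIMSEQ_ignore_initial_segment[OF Y_lim[OF u], of l] by (intro tendsto_dist tendsto_const)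
    show "\<forall>\<^sub>F i in sequentially. dist (X (i + l) u) (X l u) \<le> 2 * (1/2)^l"
      using X_dist[OF u, of l] by (intro always_eventually) (simp add: add.commute dist_commute)
  qed simp
  have X_meas: "X l \<in> borel_measurable unif" for l
    unfolding X_def by (rule measurable_compose[OF measurable_word]) simp
  have Y_meas [measurable]: "Y \<in> borel_measurable unif"
    by (rule borel_measurable_LIMSEQ_metric[of X, OF X_meas]) (use Y_lim spU in auto)
  define L where "L = distr unif borel Y"
  have L: "L \<in> prob_measures" unfolding prob_measures_def L_def using U.prob_space_distr[OF Y_meas] by simp
  have "(\<lambda>n. \<integral>x. f x \<partial>q (r n)) \<longlonglongrightarrow> (\<integral>x. f x \<partial>L)" if "blip f" for f
  proof (rule LIMSEQ_I)
    fix e :: real assume "e > 0"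
    obtain B K where B: "B > 0" "\<And>x. \<bar>f x\<bar> \<le> B" and K: "K > 0" "\<And>x y. \<bar>f x - f y\<bar> \<le> K * dist x y"
      using blipE[OF \<open>blip f\<close>] by metis
    note fm [measurable] = bcont_measurable[OF blip_bcont[OF \<open>blip f\<close>]]
    \<comment> \<open>Each of the two comparisons with step functions costs \<open>e / 6\<close> for
      the oscillation within cells and \<open>e / 6\<close> for the mass outside; the remaining
      \<open>e / 3\<close> is for the convergence of the finitely many cylinder masses.\<close>
    define e' where "e' = e / (6 * B)"
    have e': "e' > 0" "B * e' = e / 6" using \<open>e > 0\<close> B(1) by (auto simp: e'_def)
    obtain l where l: "(1/2)^l < e / (12 * K)" using real_arch_pow_inv[of "e / (12 * K)" "1/2"] \<open>e > 0\<close> K(1) by auto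
    then have l': "K * (2 * (1/2)^l) < e / 6" using K(1) by (simp add: field_simps)
    obtain b where b: "\<forall>\<^sub>F n in sequentially.
        1 - e' \<le> measure (q n) (\<Union>w\<in>{w. length w = Suc l \<and> set w \<subseteq> {..b}}. cyl w)"
      using tight_path[OF tight q e'(1)] by blast
    define W where "W = {w. length w = Suc l \<and> set w \<subseteq> {..b}}"
    have finW: "finite W" unfolding W_def using finite_lists_length_eq[of "{..b}" "Suc l"] by (simp add: conj_commute)
    have disj: "disjoint_family_on cyl W" unfolding disjoint_family_on_def W_def cyl_def by auto
    have b': "\<forall>\<^sub>F n in sequentially. 1 - e' \<le> (\<Sum>w\<in>W. measure (q (r n)) (cyl w))"
      using sub[OF b]
    proof eventually_elim
      case (elim n)
      interpret prob_space "q (r n)" using prob_measuresD[OF q] by simp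
      show ?case using elim finite_measure_finite_Union[OF finW _ disj] by (auto simp: qs W_def[symmetric] image_subset_iff)
    qed
    have bp: "1 - e' \<le> (\<Sum>w\<in>W. p w)"
      by (rule tendsto_lowerbound[OF tendsto_sum[OF lim] b']) simp
    define c where "c w = f (dense_sequence (hd w))" for w
    have P1: "\<bar>(\<integral>x. f x \<partial>q n) - (\<Sum>w\<in>W. c w * measure (q n) (cyl w))\<bar> \<le> K * (2 * (1/2)^l) + B * e'"
      if "1 - e' \<le> (\<Sum>w\<in>W. measure (q n) (cyl w))" for n
    proof (rule step_approx[OF prob_measuresD(1)[OF q] finW _ disj _ _ _ _ that])
      fix w and x :: 'a assume w: "w \<in> W" "x \<in> cyl w"
      then obtain j w' where w': "w = j # w'" "length w' = l" by (auto simp: W_def length_Suc_conv)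
      have "dist x (dense_sequence j) < (1/2)^l"
        using w(2) w' code_dist[of "(1/2)^l" x] by (auto simp: cyl_Cons)
      moreover have "0 < (1/2::real)^l" by simp
      ultimately have "dist x (dense_sequence j) \<le> 2 * (1/2)^l" by linarith
      then have "K * dist x (dense_sequence j) \<le> K * (2 * (1/2)^l)" using K(1) by (intro mult_left_mono) auto
      then show "\<bar>f x - c w\<bar> \<le> K * (2 * (1/2)^l)" using K(2)[of x "dense_sequence j"] by (simp add: c_def w')
    next
      show "f \<in> borel_measurable (q n)" using fm qs(1)[of n] by (simp cong: measurable_cong_sets)
    qed (use K B in \<open>auto simp: qs\<close>)
    define D where "D w = {u\<in>space unif. word (length w) u = w}" for w
    have D: "D w = {u\<in>space unif. word (Suc l) u = w}" if "w \<in> W" for w using that by (simp add: D_def W_def)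
    have "(\<integral>x. f x \<partial>L) = (\<integral>u. f (Y u) \<partial>unif)" unfolding L_def by (rule integral_distr) measurable
    moreover have "\<bar>(\<integral>u. f (Y u) \<partial>unif) - (\<Sum>w\<in>W. c w * measure unif (D w))\<bar> \<le> K * (2 * (1/2)^l) + B * e'"
    proof (rule step_approx[OF prob_space_unif finW])
      show "disjoint_family_on D W" unfolding disjoint_family_on_def using D by auto
      show "D w \<in> sets unif" if "w \<in> W" for w unfolding D_def by measurable
      show "1 - e' \<le> (\<Sum>w\<in>W. measure unif (D w))" using bp unfolding D_def measure_word .
      show "\<bar>f (Y u) - c w\<bar> \<le> K * (2 * (1/2)^l)" if "w \<in> W" "u \<in> D w" for w u
      proof -
        have u: "u \<in> {0..<1}" "word (Suc l) u = w" using that D[OF that(1)] spU by auto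
        have "K * dist (Y u) (X l u) \<le> K * (2 * (1/2)^l)" using K(1) Y_dist[OF u(1), of l] by (intro mult_left_mono) auto
        then show ?thesis using K(2)[of "Y u" "X l u"] u(2) by (simp add: c_def X_def del: word.simps)
      qed
    qed (use K B in auto)
    ultimately have P2: "\<bar>(\<integral>x. f x \<partial>L) - (\<Sum>w\<in>W. c w * p w)\<bar> \<le> K * (2 * (1/2)^l) + B * e'"
      unfolding D_def measure_word by simp
    have "(\<lambda>n. \<Sum>w\<in>W. c w * measure (q (r n)) (cyl w)) \<longlonglongrightarrow> (\<Sum>w\<in>W. c w * p w)"
      by (intro tendsto_sum tendsto_mult tendsto_const lim)
    then have "\<forall>\<^sub>F n in sequentially. dist (\<Sum>w\<in>W. c w * measure (q (r n)) (cyl w)) (\<Sum>w\<in>W. c w * p w) < e/3"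
      using \<open>e > 0\<close> by (intro tendstoD) auto
    with b' have "\<forall>\<^sub>F n in sequentially. norm ((\<integral>x. f x \<partial>q (r n)) - (\<integral>x. f x \<partial>L)) < e"
    proof eventually_elim
      case (elim n)
      then show ?case using P1[OF elim(1)] P2 l' unfolding e'(2) dist_real_def real_norm_def by linarith
    qed
    then show "\<exists>no. \<forall>n\<ge>no. norm ((\<integral>x. f x \<partial>q (r n)) - (\<integral>x. f x \<partial>L)) < e"
      by (simp add: eventually_sequentially)
  qed
  then show ?thesis using that[OF r L] by blast
qed

section \<open>Large deviation bounds in exponential form\<close>

text \<open>With \<open>c = 1 / k\<close> or \<open>c = 1 / (k * n)\<close>, this and the next three
  lemmas translate between scaled logarithms, which may be \<open>-\<infinity>\<close>, and
  exponential bounds.\<close>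

lemma elog_gtD:
  assumes "c > 0" "ereal a < ereal c * elog m"
  shows "exp (a / c) < m"
proof -
  have "m > 0" using assms by (rule_tac ccontr) (auto simp: elog_def)
  then have "a < c * ln m" using assms by (simp add: elog_def)
  then have "a / c < ln m" using assms(1) by (simp add: field_simps)
  then show ?thesis using \<open>m > 0\<close> by (metis exp_less_mono exp_ln)
qed

lemma elog_ltD:
  assumes "c > 0" "ereal c * elog m < ereal a"
  shows "m \<le> exp (a / c)"
proof (cases "m > 0")
  case True
  then have "c * ln m < a" using assms by (simp add: elog_def)
  then have "ln m < a / c" using assms(1) by (simp add: field_simps)
  then show ?thesis using True by (metis exp_less_mono exp_ln less_imp_le)
next
  case False
  then show ?thesis by (meson exp_gt_zero less_le_trans linorder_not_less order_less_imp_le not_le)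
qed

lemma elog_geI:
  assumes "c > 0" "exp (a / c) \<le> m"
  shows "ereal a \<le> ereal c * elog m"
proof -
  have "m > 0" using assms(2) by (meson exp_gt_zero less_le_trans)
  then have "a / c \<le> ln m" using assms(2) by (metis exp_le_cancel_iff exp_ln)
  then show ?thesis using \<open>m > 0\<close> assms(1) by (simp add: elog_def field_simps)
qed

lemma elog_leI:
  assumes "c > 0" "m \<le> exp (a / c)"
  shows "ereal c * elog m \<le> ereal a"
proof (cases "m > 0")
  case True
  then have "ln m \<le> a / c" using assms(2) by (metis ln_exp ln_mono)
  then show ?thesis using True assms(1) by (simp add: elog_def field_simps)
next
  case False
  then show ?thesis using assms(1) by (simp add: elog_def)
qed

lemma ldp_lower:
  fixes J :: "'x::topological_space \<Rightarrow> ereal"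
  assumes ldp: "k_LDP Q J" and "open U" "x \<in> U" "J x \<le> ereal t" "e > 0"
  shows "\<forall>\<^sub>F k in sequentially. exp (- real k * (t + e)) \<le> measure (Q k) U"
proof -
  have "(INF x\<in>interior U. J x) \<le> ereal t"
    using assms(2-4) by (intro INF_lower2[of x]) (auto simp: interior_open)
  then have "ereal (- t) \<le> - (INF x\<in>interior U. J x)" by (metis ereal_minus_le_minus uminus_ereal.simps(1))
  also have "\<dots> \<le> liminf (\<lambda>k. ereal (1 / real k) * elog (measure (Q k) U))"
    using ldp \<open>open U\<close> unfolding k_LDP_def by auto
  finally have "ereal (- t - e) < liminf (\<lambda>k. ereal (1 / real k) * elog (measure (Q k) U))"
    using \<open>e > 0\<close> by (meson ereal_less(2) ereal_less_eq(3) less_le_trans less_ereal.simps(1) diff_less_eq less_add_same_cancel1)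
  from less_LiminfD[OF this] eventually_gt_at_top[of 0] show ?thesis
  proof eventually_elim
    case (elim k)
    have "exp ((- t - e) / (1 / real k)) < measure (Q k) U"
      by (rule elog_gtD) (use elim in auto)
    moreover have "(- t - e) / (1 / real k) = - real k * (t + e)" by (simp add: field_simps)
    ultimately show ?case by simp
  qed
qed

lemma ldp_upper:
  fixes J :: "'x::topological_space \<Rightarrow> ereal"
  assumes ldp: "k_LDP Q J" and "closed C" "\<And>x. x \<in> C \<Longrightarrow> ereal t \<le> J x" "e > 0"
  shows "\<forall>\<^sub>F k in sequentially. measure (Q k) C \<le> exp (- real k * (t - e))"
proof -
  have "ereal t \<le> (INF x\<in>closure C. J x)"
    using assms(2,3) by (intro INF_greatest) auto
  then have "- (INF x\<in>closure C. J x) \<le> ereal (- t)" by (metis ereal_minus_le_minus uminus_ereal.simps(1))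
  moreover have "limsup (\<lambda>k. ereal (1 / real k) * elog (measure (Q k) C)) \<le> - (INF x\<in>closure C. J x)"
    using ldp borel_closed[OF \<open>closed C\<close>] unfolding k_LDP_def by blast
  moreover have "ereal (- t) < ereal (- t + e)" using \<open>e > 0\<close> by simp
  ultimately have "limsup (\<lambda>k. ereal (1 / real k) * elog (measure (Q k) C)) < ereal (- t + e)"
    by (meson le_less_trans order_trans)
  from Limsup_lessD[OF this] eventually_gt_at_top[of 0] show ?thesis
  proof eventually_elim
    case (elim k)
    have "measure (Q k) C \<le> exp ((- t + e) / (1 / real k))"
      by (rule elog_ltD) (use elim in auto)
    moreover have "(- t + e) / (1 / real k) = - real k * (t - e)" by (simp add: field_simps)
    ultimately show ?case by simp
  qed
qed

text \<open>The range of \<open>u\<close> is cut into slices of height \<open>h\<close>. On the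
  superlevel set \<open>C i\<close> the rate is at least \<open>c i - s\<close>, so the slice
  starting at \<open>c i\<close> contributes at most \<open>exp (k * (s + 2 * h))\<close> whatever
  \<open>i\<close> is, and the number of slices disappears in \<open>exp (k * h)\<close>.\<close>

lemma varadhan_upper:
  fixes u :: "'x::polish_space \<Rightarrow> real"
  assumes ldp: "k_LDP Q J" and Q: "\<And>k. k \<ge> 1 \<Longrightarrow> Q k \<in> prob_measures"
    and u: "u \<in> bcont" and le: "\<And>x. ereal (u x) \<le> J x + ereal s" and "e > 0"
  shows "\<forall>\<^sub>F k in sequentially. (\<integral>x. exp (real k * u x) \<partial>Q k) \<le> exp (real k * (s + e))"
proof -
  obtain M where M: "M > 0" "\<And>x. \<bar>u x\<bar> \<le> M" using bcontE[OF u] by metis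
  have cu: "continuous_on UNIV u" using u unfolding bcont_def by auto
  \<comment> \<open>One third of \<open>e\<close> each for the height of a slice, the error in the
    large deviation bound and the number of slices.\<close>
  define h where "h = e / 3"
  have h: "h > 0" using \<open>e > 0\<close> by (simp add: h_def)
  \<comment> \<open>Enough levels to climb from \<open>- M\<close> to \<open>M\<close> in steps of
    \<open>h\<close>.\<close>
  obtain N :: nat where N: "2 * M / h < real N" using reals_Archimedean2 by blast
  define c where "c i = - M + real i * h" for i
  define C where "C i = {x. c i \<le> u x}" for i
  have clC: "closed (C i)" for i unfolding C_def by (intro closed_Collect_le continuous_intros cu)
  have "\<forall>\<^sub>F k in sequentially. measure (Q k) (C i) \<le> exp (- real k * ((c i - s) - h))" for i
  proof (rule ldp_upper[OF ldp clC _ h])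
    fix x assume "x \<in> C i"
    then have "ereal (c i) \<le> J x + ereal s" using le[of x] unfolding C_def by (auto intro: order_trans[of _ "ereal (u x)"])
    then show "ereal (c i - s) \<le> J x" by (cases "J x") auto
  qed
  then have 1: "\<forall>\<^sub>F k in sequentially. \<forall>i\<in>{..N}. measure (Q k) (C i) \<le> exp (- real k * ((c i - s) - h))"
    by (intro eventually_ball_finite) auto
  have 2: "\<forall>\<^sub>F k in sequentially. real (Suc N) \<le> exp (real k * h)"
  proof -
    obtain K :: nat where K: "ln (real (Suc N)) / h < real K" using reals_Archimedean2 by blast
    show ?thesis
    proof (rule eventually_sequentiallyI[of K])
      fix k assume "k \<ge> K"
      then have "ln (real (Suc N)) / h < real k" using K by linarith
      then have "ln (real (Suc N)) \<le> real k * h" using h by (simp add: field_simps)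
      then show "real (Suc N) \<le> exp (real k * h)" by (metis exp_le_cancel_iff exp_ln of_nat_0_less_iff zero_less_Suc)
    qed
  qed
  from 1 2 eventually_ge_at_top[of 1] show ?thesis
  proof eventually_elim
    case (elim k)
    note Qk = Q[OF elim(3)]
    interpret prob_space "Q k" using prob_measuresD[OF Qk] by simp
    note sQ = prob_measuresD(2,3)[OF Qk]
    have Cm: "C i \<in> sets (Q k)" for i using clC sQ by auto
    have "(\<integral>x. exp (real k * u x) \<partial>Q k) \<le> (\<integral>x. (\<Sum>i\<le>N. exp (real k * (c i + h)) * indicator (C i) x) \<partial>Q k)"
    proof (rule integral_mono)
      show "integrable (Q k) (\<lambda>x. exp (real k * u x))"
      proof (rule bounded_integrable[OF Qk, of _ "exp (real k * M)"])
        show "(\<lambda>x. exp (real k * u x)) \<in> borel_measurable borel"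
          by (intro borel_measurable_continuous_onI continuous_intros cu)
        show "\<bar>exp (real k * u x)\<bar> \<le> exp (real k * M)" for x
          using M(2)[of x] by (simp add: mult_left_mono)
      qed
      show "integrable (Q k) (\<lambda>x. \<Sum>i\<le>N. exp (real k * (c i + h)) * indicator (C i) x)"
        using Cm by (intro Bochner_Integration.integrable_sum integrable_mult_right) (simp add: less_top[symmetric])
      fix x
      define i where "i = nat \<lfloor>(u x + M) / h\<rfloor>"
      have nn: "0 \<le> (u x + M) / h" using M(2)[of x] h by auto
      have i: "real i \<le> (u x + M) / h" "(u x + M) / h < real i + 1"
        unfolding i_def using nn by (simp_all add: of_nat_nat)
      have "(u x + M) / h \<le> 2 * M / h" using M(2)[of x] h by (simp add: divide_right_mono)
      then have "i \<le> N" using i(1) N by linarith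
      have "real i * h \<le> u x + M" "u x + M < (real i + 1) * h" using i h by (simp_all add: field_simps)
      then have cx: "c i \<le> u x" "u x \<le> c i + h" by (simp_all add: c_def algebra_simps)
      have "exp (real k * u x) \<le> exp (real k * (c i + h)) * indicator (C i) x"
        using cx by (simp add: C_def mult_left_mono)
      also have "\<dots> \<le> (\<Sum>i\<le>N. exp (real k * (c i + h)) * indicator (C i) x)"
        using \<open>i \<le> N\<close> by (intro member_le_sum) auto
      finally show "exp (real k * u x) \<le> (\<Sum>i\<le>N. exp (real k * (c i + h)) * indicator (C i) x)" .
    qed
    also have "\<dots> = (\<Sum>i\<le>N. exp (real k * (c i + h)) * measure (Q k) (C i))"
      using Cm by (subst Bochner_Integration.integral_sum) (auto simp: less_top[symmetric] sQ)
    also have "\<dots> \<le> (\<Sum>i\<le>N. exp (real k * (c i + h)) * exp (- real k * ((c i - s) - h)))"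
      using elim(1) by (intro sum_mono mult_left_mono) auto
    also have "\<dots> = (\<Sum>i\<le>N. exp (real k * (s + 2 * h)))"
      by (intro sum.cong refl) (simp add: exp_add[symmetric] algebra_simps)
    also have "\<dots> = real (Suc N) * exp (real k * (s + 2 * h))" by simp
    also have "\<dots> \<le> exp (real k * h) * exp (real k * (s + 2 * h))" using elim(2) by (intro mult_right_mono) auto
    also have "\<dots> = exp (real k * (s + e))" by (simp add: exp_add[symmetric] h_def algebra_simps)
    finally show ?case .
  qed
qed

section \<open>Scaled cumulants and joint measurability of the rate\<close>

primrec runmax :: "(nat \<Rightarrow> real) \<Rightarrow> nat \<Rightarrow> real" where
  "runmax u 0 = 0"
| "runmax u (Suc n) = max (runmax u n) (u n)"

lemma runmax_nonneg: "0 \<le> runmax u n"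
  by (induction n) (auto simp: le_max_iff_disj)

lemma runmax_le: "0 \<le> c \<Longrightarrow> (\<And>j. j < n \<Longrightarrow> ereal (u j) \<le> c) \<Longrightarrow> ereal (runmax u n) \<le> c"
  by (induction n) (auto simp: zero_ereal_def max_def)

text \<open>A maximum is 1-Lipschitz in each argument. This pays, term by term, for replacing
  indicators by continuous functions.\<close>

lemma runmax_diff: "\<bar>runmax u n - runmax v n\<bar> \<le> (\<Sum>j<n. \<bar>u j - v j\<bar>)"
proof (induction n)
  case (Suc n)
  have "\<bar>runmax u (Suc n) - runmax v (Suc n)\<bar> \<le> \<bar>runmax u n - runmax v n\<bar> + \<bar>u n - v n\<bar>"
    unfolding runmax.simps by linarith
  then show ?case using Suc by simp
qed simp

lemma blip_runmax: "(\<And>j. blip (u j)) \<Longrightarrow> blip (\<lambda>x. runmax (\<lambda>j. u j x) n)"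
  by (induction n) (auto intro: blip_const blip_max)

section \<open>Feller kernels with a large deviation principle at each point\<close>

locale ldp_family =
  fixes P :: "nat \<Rightarrow> 'z::polish_space \<Rightarrow> 'x::polish_space measure"
    and J :: "'z \<Rightarrow> 'x \<Rightarrow> ereal"
  assumes feller: "\<And>k. k \<ge> 1 \<Longrightarrow> feller_system (P k)"
    and rate: "\<And>z. good_rate_function (J z)"
    and ldp: "\<And>z. k_LDP (\<lambda>k. P k z) (J z)"
begin

lemma J_nonneg: "0 \<le> J z x" using rate unfolding good_rate_function_def by blast

lemma J_lsc: "open {y. ereal t < J z y}"
proof -
  have "compact {y. J z y \<le> ereal t}" using rate unfolding good_rate_function_def by blast
  then have "open (- {y. J z y \<le> ereal t})" by (simp add: compact_imp_closed open_Compl)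
  moreover have "- {y. J z y \<le> ereal t} = {y. ereal t < J z y}" by (auto simp: not_le)
  ultimately show ?thesis by simp
qed

lemma P_prob: "k \<ge> 1 \<Longrightarrow> P k z \<in> prob_measures"
  using feller unfolding feller_system_def by blast

lemma blip_section: "blip (u :: 'z \<times> 'x \<Rightarrow> real) \<Longrightarrow> blip (\<lambda>x. u (z, x))"
  by (erule blip_comp) (simp add: dist_Pair_Pair)

text \<open>The Feller property covers functions of \<open>x\<close> only. With \<open>z\<close>
  frozen at \<open>z0\<close> inside \<open>u\<close> it applies, and the Lipschitz bound makes the
  error of freezing at most \<open>L * dist z z0\<close>, uniformly in \<open>x\<close>.\<close>

lemma feller_continuous:
  assumes "k \<ge> 1" and u: "blip (u :: 'z \<times> 'x \<Rightarrow> real)"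
  shows "continuous_on UNIV (\<lambda>z. \<integral>x. u (z, x) \<partial>P k z)"
proof (rule continuous_at_imp_continuous_on, safe)
  fix z0
  obtain L where L: "L > 0" "\<And>p q. \<bar>u p - u q\<bar> \<le> L * dist p q" using blipE[OF u] by metis
  have int: "integrable (P k z') (\<lambda>x. u (z, x))" for z z'
    by (rule blip_integrable[OF P_prob[OF \<open>k \<ge> 1\<close>] blip_section[OF u]])
  have c: "continuous_on UNIV (\<lambda>z. \<integral>x. u (z0, x) \<partial>P k z)"
    using feller[OF \<open>k \<ge> 1\<close>] blip_bcont[OF blip_section[OF u, of z0]] unfolding feller_system_def by blast
  have "((\<lambda>z. (\<integral>x. u (z0, x) \<partial>P k z) + ((\<integral>x. u (z, x) \<partial>P k z) - (\<integral>x. u (z0, x) \<partial>P k z))) \<longlongrightarrow> (\<integral>x. u (z0, x) \<partial>P k z0) + 0) (at z0)"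
  proof (rule tendsto_add)
    show "((\<lambda>z. (\<integral>x. u (z0, x) \<partial>P k z)) \<longlongrightarrow> (\<integral>x. u (z0, x) \<partial>P k z0)) (at z0)"
      using c by (simp add: continuous_on_def)
    have "((\<lambda>z. L * dist z z0) \<longlongrightarrow> L * dist z0 z0) (at z0)" by (intro tendsto_intros)
    then have "((\<lambda>z. L * dist z z0) \<longlongrightarrow> 0) (at z0)" by simp
    then show "((\<lambda>z. (\<integral>x. u (z, x) \<partial>P k z) - (\<integral>x. u (z0, x) \<partial>P k z)) \<longlongrightarrow> 0) (at z0)"
    proof (rule Lim_null_comparison[rotated], intro always_eventually allI)
      fix z
      interpret prob_space "P k z" using prob_measuresD[OF P_prob[OF \<open>k \<ge> 1\<close>]] by simp
      have "norm ((\<integral>x. u (z, x) \<partial>P k z) - (\<integral>x. u (z0, x) \<partial>P k z)) = \<bar>\<integral>x. u (z, x) - u (z0, x) \<partial>P k z\<bar>"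
        using int by simp
      also have "\<dots> \<le> (\<integral>x. \<bar>u (z, x) - u (z0, x)\<bar> \<partial>P k z)" by (rule integral_abs_bound)
      also have "\<dots> \<le> (\<integral>x. L * dist z z0 \<partial>P k z)"
      proof (rule integral_mono)
        fix x show "\<bar>u (z, x) - u (z0, x)\<bar> \<le> L * dist z z0"
          using L(2)[of "(z, x)" "(z0, x)"] by (simp add: dist_Pair_Pair)
      qed (use int in auto)
      finally show "norm ((\<integral>x. u (z, x) \<partial>P k z) - (\<integral>x. u (z0, x) \<partial>P k z)) \<le> L * dist z z0"
        by (simp add: prob_space)
    qed
  qed
  then show "isCont (\<lambda>z. \<integral>x. u (z, x) \<partial>P k z) z0" by (simp add: isCont_def)
qed

text \<open>For \<open>k = 0\<close> division by zero makes this the constant 0.\<close>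

definition Lam :: "nat \<Rightarrow> ('z \<times> 'x \<Rightarrow> real) \<Rightarrow> 'z \<Rightarrow> real" where
  "Lam k f z = ln (\<integral>x. exp (real k * f (z, x)) \<partial>P k z) / real k"

lemma exp_integral_bounds:
  assumes "k \<ge> 1" "blip (f :: 'z \<times> 'x \<Rightarrow> real)" "\<And>p. \<bar>f p\<bar> \<le> M"
  shows "exp (- real k * M) \<le> (\<integral>x. exp (real k * f (z, x)) \<partial>P k z)"
    "(\<integral>x. exp (real k * f (z, x)) \<partial>P k z) \<le> exp (real k * M)"
proof -
  interpret prob_space "P k z" using prob_measuresD[OF P_prob[OF \<open>k \<ge> 1\<close>]] by simp
  have int: "integrable (P k z) (\<lambda>x. exp (real k * f (z, x)))"
    by (intro blip_integrable[OF P_prob[OF \<open>k \<ge> 1\<close>]] blip_exp blip_cmult blip_section assms)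
  have b: "- M \<le> f (z, x)" "f (z, x) \<le> M" for x using assms(3)[of "(z, x)"] by linarith+
  have "(\<integral>x. exp (- real k * M) \<partial>P k z) \<le> (\<integral>x. exp (real k * f (z, x)) \<partial>P k z)"
    using b(1) mult_left_mono[OF b(1), of "real k"] by (intro integral_mono int) auto
  then show "exp (- real k * M) \<le> (\<integral>x. exp (real k * f (z, x)) \<partial>P k z)" by (simp add: prob_space)
  have "(\<integral>x. exp (real k * f (z, x)) \<partial>P k z) \<le> (\<integral>x. exp (real k * M) \<partial>P k z)"
    using mult_left_mono[OF b(2), of "real k"] by (intro integral_mono int) auto
  then show "(\<integral>x. exp (real k * f (z, x)) \<partial>P k z) \<le> exp (real k * M)" by (simp add: prob_space)
qed

lemma exp_integral_Lam:
  assumes "k \<ge> 1" "blip f"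
  shows "(\<integral>x. exp (real k * f (z, x)) \<partial>P k z) = exp (real k * Lam k f z)"
proof -
  obtain M where "\<And>p. \<bar>f p\<bar> \<le> M" using blipE[OF assms(2)] by metis
  then have "0 < (\<integral>x. exp (real k * f (z, x)) \<partial>P k z)"
    using exp_integral_bounds(1)[OF assms] by (meson exp_gt_zero less_le_trans)
  then show ?thesis unfolding Lam_def using assms(1) by simp
qed

lemma Lam_bounded:
  assumes "blip f" "\<And>p. \<bar>f p\<bar> \<le> M"
  shows "\<bar>Lam k f z\<bar> \<le> M"
proof (cases "k = 0")
  case True
  then show ?thesis using assms(2)[of "(z, undefined)"] by (simp add: Lam_def)
next
  case False
  then have k: "k \<ge> 1" by simp
  have "- real k * M \<le> real k * Lam k f z" "real k * Lam k f z \<le> real k * M"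
    using exp_integral_bounds[OF k assms, of z] unfolding exp_integral_Lam[OF k assms(1)] by simp_all
  then have "real k * (- M) \<le> real k * Lam k f z" "real k * Lam k f z \<le> real k * M" by simp_all
  then have "- M \<le> Lam k f z" "Lam k f z \<le> M"
    using k by (simp_all only: mult_le_cancel_left_pos of_nat_0_less_iff less_le_trans[OF zero_less_one])
  then show ?thesis by linarith
qed

lemma Lam_bcont: assumes "blip f" shows "Lam k f \<in> bcont"
proof -
  obtain M where M: "\<And>p. \<bar>f p\<bar> \<le> M" using blipE[OF assms] by metis
  have "continuous_on UNIV (Lam k f)"
  proof (cases "k = 0")
    case True
    then show ?thesis by (simp add: Lam_def[abs_def])
  next
    case False
    then have k: "k \<ge> 1" by simp
    have "continuous_on UNIV (\<lambda>z. \<integral>x. exp (real k * f (z, x)) \<partial>P k z)"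
      by (rule feller_continuous[OF k]) (intro blip_exp blip_cmult assms)
    moreover have "(\<integral>x. exp (real k * f (z, x)) \<partial>P k z) \<noteq> 0" for z
      unfolding exp_integral_Lam[OF k assms] by simp
    ultimately show ?thesis unfolding Lam_def[abs_def] using k by (intro continuous_intros) auto
  qed
  then show ?thesis using Lam_bounded[OF assms M] unfolding bcont_def bounded_iff by auto
qed

text \<open>Only pointwise: how large \<open>k\<close> must be depends on \<open>z\<close>. Bounded
  convergence under \<open>\<mu>\<close> repairs this later.\<close>

lemma Lam_eventually_le:
  assumes f: "blip f" and le: "\<And>x. ereal (f (z, x)) \<le> J z x + ereal s" and "e > 0"
  shows "\<forall>\<^sub>F k in sequentially. Lam k f z \<le> s + e"
proof -
  have "\<forall>\<^sub>F k in sequentially. (\<integral>x. exp (real k * f (z, x)) \<partial>P k z) \<le> exp (real k * (s + e))"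
    by (rule varadhan_upper[OF ldp P_prob blip_bcont[OF blip_section[OF f]] le \<open>e > 0\<close>])
  then show ?thesis using eventually_ge_at_top[of 1]
  proof eventually_elim
    case (elim k)
    then show ?case unfolding exp_integral_Lam[OF elim(2) f] by simp
  qed
qed

text \<open>By Varadhan's lemma this is \<open>{z. \<forall>x. u x \<le> J z x}\<close>; phrasing it through \<open>Lam\<close>, which is continuous
  in \<open>z\<close>, gives measurability without a projection theorem.\<close>

definition below_rate :: "('x \<Rightarrow> real) \<Rightarrow> 'z set" where
  "below_rate u = {z. \<forall>p::nat. \<forall>\<^sub>F k in sequentially. Lam k (\<lambda>q. u (snd q)) z \<le> 1 / real (Suc p)}"

lemma below_rate_measurable:
  assumes "blip u" shows "below_rate u \<in> sets borel"
proof -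
  have [measurable]: "Lam k (\<lambda>q. u (snd q)) \<in> borel_measurable borel" for k
    by (intro bcont_measurable Lam_bcont blip_snd assms)
  show ?thesis unfolding below_rate_def eventually_sequentially by measurable
qed

text \<open>If \<open>J z x < u x\<close> somewhere, the lower large deviation bound on a
  neighbourhood of \<open>x\<close> keeps the cumulant of \<open>u\<close> above a positive number,
  so nonpositivity of its upper limit detects \<open>u \<le> J z\<close>. The converse is Varadhan's
  upper bound with \<open>s = 0\<close>.\<close>

lemma below_rate_iff:
  assumes u: "blip u"
  shows "z \<in> below_rate u \<longleftrightarrow> (\<forall>x. ereal (u x) \<le> J z x)"
proof
  assume "\<forall>x. ereal (u x) \<le> J z x"
  then show "z \<in> below_rate u" unfolding below_rate_def
    using Lam_eventually_le[OF blip_snd[OF u], of z 0] by (auto simp del: of_nat_Suc)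
next
  assume z: "z \<in> below_rate u"
  show "\<forall>x. ereal (u x) \<le> J z x"
  proof (rule ccontr)
    assume "\<not> ?thesis"
    then obtain x where x: "J z x < ereal (u x)" by (auto simp: not_le)
    then obtain t where t: "J z x = ereal t" using J_nonneg[of z x] by (cases "J z x") auto
    \<comment> \<open>A quarter of the gap: \<open>h\<close> is lost on the neighbourhood
      \<open>U\<close>, another \<open>h\<close> in the lower bound, and the remaining
      \<open>2 * h\<close> contradicts the cumulant being below \<open>h\<close>.\<close>
    define h where "h = (u x - t) / 4"
    have h: "h > 0" using x t by (simp add: h_def)
    define U where "U = {y. u x - h < u y}"
    have "open U" unfolding U_def by (intro open_Collect_less continuous_intros blip_continuous u)
    have "\<forall>\<^sub>F k in sequentially. exp (- real k * (t + h)) \<le> measure (P k z) U"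
      by (rule ldp_lower[OF ldp \<open>open U\<close>, of x]) (use h t in \<open>auto simp: U_def\<close>)
    moreover obtain p where p: "1 / real (Suc p) < h" using nat_approx_posE[OF h] by metis
    have "\<forall>\<^sub>F k in sequentially. Lam k (\<lambda>q. u (snd q)) z \<le> 1 / real (Suc p)"
      using z unfolding below_rate_def by blast
    then have "\<forall>\<^sub>F k in sequentially. Lam k (\<lambda>q. u (snd q)) z < h"
      by eventually_elim (use p in linarith)
    ultimately have "\<forall>\<^sub>F k in sequentially. exp (- real k * (t + h)) \<le> measure (P k z) U \<and>
      Lam k (\<lambda>q. u (snd q)) z < h \<and> k \<ge> 1"
      by (intro eventually_conj eventually_ge_at_top)
    then obtain k where k: "exp (- real k * (t + h)) \<le> measure (P k z) U"
      "Lam k (\<lambda>q. u (snd q)) z < h" "k \<ge> 1" by (auto simp: eventually_sequentially)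
    interpret prob_space "P k z" using prob_measuresD[OF P_prob[OF k(3)]] by simp
    have U: "U \<in> sets (P k z)" using \<open>open U\<close> prob_measuresD(2)[OF P_prob[OF k(3)]] by simp
    have "exp (real k * (2 * h)) = exp (real k * (u x - h)) * exp (- real k * (t + h))"
    proof -
      have ux: "u x = t + 4 * h" unfolding h_def by (simp add: field_simps)
      show ?thesis unfolding exp_add[symmetric] ux by (simp add: algebra_simps)
    qed
    also have "\<dots> \<le> exp (real k * (u x - h)) * measure (P k z) U" using k(1) by (intro mult_left_mono) auto
    also have "\<dots> = (\<integral>y. exp (real k * (u x - h)) * indicator U y \<partial>P k z)"
      using U prob_measuresD(3)[OF P_prob[OF k(3)]] by simp
    also have "\<dots> \<le> (\<integral>y. exp (real k * u y) \<partial>P k z)"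
    proof (rule integral_mono)
      show "integrable (P k z) (\<lambda>y. exp (real k * (u x - h)) * indicator U y)" using U by (simp add: less_top[symmetric])
      show "integrable (P k z) (\<lambda>y. exp (real k * u y))"
        by (intro blip_integrable[OF P_prob[OF k(3)]] blip_exp blip_cmult u)
      show "exp (real k * (u x - h)) * indicator U y \<le> exp (real k * u y)" for y
        by (auto simp: U_def indicator_def mult_left_mono)
    qed
    also have "\<dots> = exp (real k * Lam k (\<lambda>q. u (snd q)) z)"
      using exp_integral_Lam[OF k(3) blip_snd[OF u], of z] by simp
    finally have "real k * (2 * h) \<le> real k * Lam k (\<lambda>q. u (snd q)) z" by simp
    then show False using k(2,3) h by simp
  qed
qed

text \<open>\<open>J z\<close> is the supremum of the test functions below it, and
  \<open>below_rate\<close> selects these measurably in \<open>z\<close>; so \<open>J\<close>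
  becomes an increasing limit of jointly Borel functions.\<close>

definition rate_approx :: "nat \<Rightarrow> 'z \<times> 'x \<Rightarrow> real" where
  "rate_approx n p = runmax (\<lambda>j. indicator (below_rate (tst j)) (fst p) * tst j (snd p)) n"

lemma measurable_fst_borel [measurable]: "fst \<in> borel_measurable (borel :: ('z \<times> 'x) measure)"
  by (intro borel_measurable_continuous_onI continuous_intros)

lemma measurable_snd_borel [measurable]: "snd \<in> borel_measurable (borel :: ('z \<times> 'x) measure)"
  by (intro borel_measurable_continuous_onI continuous_intros)

lemma rate_approx_measurable [measurable]: "rate_approx n \<in> borel_measurable borel"
proof (induction n)
  case (Suc n)
  have [measurable]: "below_rate (tst n) \<in> sets borel" by (rule below_rate_measurable[OF blip_tst])
  have [measurable]: "(tst n :: 'x \<Rightarrow> real) \<in> borel_measurable borel" by (intro bcont_measurable blip_bcont blip_tst)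
  have "rate_approx (Suc n) = (\<lambda>p. max (rate_approx n p) (indicator (below_rate (tst n)) (fst p) * tst n (snd p)))"
    by (simp add: rate_approx_def fun_eq_iff)
  then show ?case using Suc by simp
qed (simp add: rate_approx_def[abs_def])

lemma incseq_rate_approx: "incseq (\<lambda>n. rate_approx n p)"
  by (intro incseq_SucI) (simp add: rate_approx_def)

lemma rate_approx_le: "ereal (rate_approx n (z, x)) \<le> J z x"
  unfolding rate_approx_def
proof (rule runmax_le[OF J_nonneg])
  fix j
  show "ereal (indicator (below_rate (tst j)) (fst (z, x)) * tst j (snd (z, x))) \<le> J z x"
    using below_rate_iff[OF blip_tst, of z j] J_nonneg[of z x] by (auto simp: indicator_def zero_ereal_def)
qed

lemma SUP_rate_approx: "(SUP n. ereal (rate_approx n (z, x))) = J z x"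
proof (rule antisym)
  show "(SUP n. ereal (rate_approx n (z, x))) \<le> J z x" by (intro SUP_least rate_approx_le)
  show "J z x \<le> (SUP n. ereal (rate_approx n (z, x)))"
  proof (rule ereal_le_real)
    fix t assume *: "(SUP n. ereal (rate_approx n (z, x))) \<le> ereal t"
    show "J z x \<le> ereal t"
    proof (rule ccontr)
      assume "\<not> J z x \<le> ereal t"
      then obtain m where m: "\<And>y. ereal (tst m y) \<le> J z y" "t < tst m x"
        using tst_below_lsc[of "J z" t x] J_nonneg J_lsc by (auto simp: not_le)
      then have "z \<in> below_rate (tst m)" using below_rate_iff[OF blip_tst] by blast
      then have "tst m x \<le> rate_approx (Suc m) (z, x)" by (simp add: rate_approx_def)
      then have "ereal t < ereal (rate_approx (Suc m) (z, x))" using m(2) by simp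
      also have "\<dots> \<le> (SUP n. ereal (rate_approx n (z, x)))" by (rule SUP_upper) simp
      finally show False using * by simp
    qed
  qed
qed

lemma J_measurable: "(\<lambda>p. J (fst p) (snd p)) \<in> borel_measurable borel"
proof -
  have "(\<lambda>p. J (fst p) (snd p)) = (\<lambda>p. SUP n. ereal (rate_approx n p))"
    by (simp add: fun_eq_iff SUP_rate_approx)
  then show ?thesis by simp
qed

lemma nn_integral_J:
  assumes q: "q \<in> prob_measures"
  shows "(\<integral>\<^sup>+ p. e2ennreal (J (fst p) (snd p)) \<partial>q) = (SUP n. \<integral>\<^sup>+ p. ennreal (rate_approx n p) \<partial>q)"
proof -
  have "e2ennreal (J (fst p) (snd p)) = (SUP n. ennreal (rate_approx n p))" for p
  proof -
    have inc: "incseq (\<lambda>i. e2ennreal (ereal (rate_approx i p)))"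
      using incseq_rate_approx[of p] by (auto simp: incseq_def intro!: ennreal_leI)
    have "(\<lambda>i. ereal (rate_approx i p)) \<longlonglongrightarrow> J (fst p) (snd p)"
      using LIMSEQ_SUP[of "\<lambda>i. ereal (rate_approx i p)"] incseq_rate_approx[of p] SUP_rate_approx[of "fst p" "snd p"]
      by (simp add: incseq_def)
    then have "(\<lambda>i. e2ennreal (ereal (rate_approx i p))) \<longlonglongrightarrow> e2ennreal (J (fst p) (snd p))"
      by (rule continuous_on_tendsto_compose[OF continuous_on_e2ennreal[of UNIV]]) auto
    from LIMSEQ_unique[OF this LIMSEQ_SUP[OF inc]] show ?thesis by simp
  qed
  then have "(\<integral>\<^sup>+ p. e2ennreal (J (fst p) (snd p)) \<partial>q) = (\<integral>\<^sup>+ p. (SUP n. ennreal (rate_approx n p)) \<partial>q)" by simp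
  also have "\<dots> = (SUP n. \<integral>\<^sup>+ p. ennreal (rate_approx n p) \<partial>q)"
  proof (rule nn_integral_monotone_convergence_SUP)
    have "rate_approx m p \<le> rate_approx n p" if "m \<le> n" for m n p
      using incseq_rate_approx[of p] that by (auto simp: incseq_def)
    then show "incseq (\<lambda>i p. ennreal (rate_approx i p))" by (intro monoI le_funI ennreal_leI)
    show "(\<lambda>p. ennreal (rate_approx i p)) \<in> borel_measurable q" for i
      using measurable_compose[OF rate_approx_measurable measurable_ennreal] prob_measuresD(2)[OF q]
      by (simp cong: measurable_cong_sets)
  qed
  finally show ?thesis .
qed

end

section \<open>Empirical measures and exponential bounds\<close>

lemma measurable_prob_measure:
  "q \<in> prob_measures \<Longrightarrow> f \<in> borel_measurable borel \<Longrightarrow> f \<in> borel_measurable q"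
  using measurable_cong_sets[OF prob_measuresD(2) refl] by blast

text \<open>\<open>measure_of\<close> yields the zero measure unless its argument is countably
  additive; the law of \<open>p\<close> at a uniform random index shows that it is, and turns
  integrals into averages.\<close>

lemma empirical_eq_distr:
  assumes "n \<ge> 1"
  shows "empirical n p = distr (measure_pmf (pmf_of_set {1..n})) borel p"
proof -
  let ?M = "distr (measure_pmf (pmf_of_set {1..n})) borel p"
  have "empirical n p = measure_of UNIV (sets borel) (emeasure ?M)"
    unfolding empirical_def
  proof (rule measure_of_eq)
    fix A assume "A \<in> sigma_sets UNIV (sets (borel :: 'a measure))"
    then have A: "A \<in> sets borel" using sets.sigma_sets_eq[of "borel :: 'a measure"] by simp
    have "{1..n} \<inter> p -` A = {i \<in> {1..n}. p i \<in> A}" by auto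
    then show "ennreal (real (card {i \<in> {1..n}. p i \<in> A}) / real n) = emeasure ?M A"
      using A assms by (simp add: emeasure_distr emeasure_pmf_of_set)
  qed auto
  also have "\<dots> = ?M" using measure_of_of_measure[of ?M] by simp
  finally show ?thesis .
qed

lemma empirical_prob: "n \<ge> 1 \<Longrightarrow> empirical n p \<in> prob_measures"
  unfolding prob_measures_def empirical_eq_distr
  by (simp add: measure_pmf.prob_space_distr)

lemma integral_empirical:
  assumes "n \<ge> 1" "f \<in> borel_measurable borel"
  shows "(\<integral>x. f x \<partial>empirical n p) = (\<Sum>i=1..n. f (p i)) / real n"
  using assms by (simp add: empirical_eq_distr integral_distr integral_pmf_of_set)

lemma tendsto_integral_zero:
  assumes q: "q \<in> prob_measures" and f: "\<And>n. f n \<in> borel_measurable borel"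
    and B: "\<And>n x. \<bar>f n x\<bar> \<le> (B::real)" and lim: "\<And>x. (\<lambda>n. f n x) \<longlonglongrightarrow> 0"
  shows "(\<lambda>n. \<integral>x. f n x \<partial>q) \<longlonglongrightarrow> 0"
proof -
  interpret prob_space q using prob_measuresD[OF q] by simp
  have "(\<lambda>n. \<integral>x. f n x \<partial>q) \<longlonglongrightarrow> (\<integral>x. 0 \<partial>q)"
    by (rule integral_dominated_convergence[where w = "\<lambda>_. B"])
      (use f B lim prob_measuresD(2)[OF q] in \<open>auto cong: measurable_cong_sets\<close>)
  then show ?thesis by simp
qed

text \<open>Outer regularity gives an open \<open>U\<close> around \<open>A\<close>, and a test
  function below the indicator of \<open>U\<close> nearly exhausts it; each of the two steps costs
  \<open>e/2\<close>.\<close>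

lemma blip_approx_indicator:
  fixes A :: "'a::polish_space set"
  assumes q: "q \<in> prob_measures" and A: "A \<in> sets borel" and "e > 0"
  obtains g where "blip g" "\<And>x. 0 \<le> g x" "\<And>x. g x \<le> 1" "(\<integral>x. \<bar>g x - indicator A x\<bar> \<partial>q) \<le> e"
proof -
  interpret prob_space q using prob_measuresD[OF q] by simp
  note sq = prob_measuresD(2,3)[OF q]
  have "emeasure q A < ennreal (measure q A + e/2)" using \<open>e > 0\<close> by (simp add: emeasure_eq_measure ennreal_lessI)
  moreover have "emeasure q A = (INF U \<in> {U. A \<subseteq> U \<and> open U}. emeasure q U)"
    by (rule outer_regular) (use sq A in auto)
  ultimately obtain U where U: "A \<subseteq> U" "open U" "emeasure q U < ennreal (measure q A + e/2)"
    by (auto simp: INF_less_iff)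
  have mU: "measure q U < measure q A + e/2"
    using U(3) by (simp add: emeasure_eq_measure ennreal_less_iff)
  obtain m where m: "\<And>x. tst m x \<le> indicator U x" "measure q U - e/2 < (\<integral>x. tst m x \<partial>q)"
    using tst_below_open[OF U(2) q, of "measure q U - e/2"] \<open>e > 0\<close> by auto
  have int: "integrable q (tst m)" "integrable q (indicator A :: _ \<Rightarrow> real)" "integrable q (indicator U :: _ \<Rightarrow> real)"
    using blip_integrable[OF q blip_tst] A U(2) sq by (auto simp: less_top[symmetric])
  have "(\<integral>x. \<bar>tst m x - indicator A x\<bar> \<partial>q) \<le> (\<integral>x. (indicator U x - tst m x) + (indicator U x - indicator A x) \<partial>q)"
  proof (rule integral_mono)
    fix x show "\<bar>tst m x - indicator A x\<bar> \<le> (indicator U x - tst m x) + (indicator U x - indicator A x)"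
      using m(1)[of x] tst_nonneg[of m x] U(1) by (auto simp: indicator_def)
  qed (use int in auto)
  also have "\<dots> = (measure q U - (\<integral>x. tst m x \<partial>q)) + (measure q U - measure q A)"
    using int A U(2) sq by simp
  also have "\<dots> \<le> e" using mU m(2) by simp
  finally have *: "(\<integral>x. \<bar>tst m x - indicator A x\<bar> \<partial>q) \<le> e" .
  have "tst m x \<le> 1" for x :: 'a
    by (rule order_trans[OF m(1)]) (simp add: indicator_def)
  then show ?thesis by (intro that[of "tst m", OF blip_tst tst_nonneg _ *])
qed

section \<open>The sampling model: independent draws at the points \<open>pts n i\<close>\<close>

locale ldp_setup = ldp_family P J
  for P :: "nat \<Rightarrow> 'z::polish_space \<Rightarrow> 'x::polish_space measure"
    and J :: "'z \<Rightarrow> 'x \<Rightarrow> ereal" +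
  fixes pts :: "nat \<Rightarrow> nat \<Rightarrow> 'z" and \<mu> :: "'z measure"
  assumes conv: "limitin narrow_topology (\<lambda>n. empirical n (pts n)) \<mu> sequentially"
begin

lemma \<mu>_prob: "\<mu> \<in> prob_measures"
  using limitin_topspace[OF conv] by (simp add: topspace_narrow)

lemma averages_tendsto:
  assumes G: "G \<in> bcont"
  shows "(\<lambda>n. (\<Sum>i=1..n. G (pts n i)) / real n) \<longlonglongrightarrow> (\<integral>z. G z \<partial>\<mu>)"
proof (rule topological_tendstoI)
  fix S :: "real set" assume S: "open S" "(\<integral>z. G z \<partial>\<mu>) \<in> S"
  then have "\<mu> \<in> {q \<in> prob_measures. (\<integral>x. G x \<partial>q) \<in> S}" using \<mu>_prob by simp
  then have "\<forall>\<^sub>F n in sequentially. empirical n (pts n) \<in> {q \<in> prob_measures. (\<integral>x. G x \<partial>q) \<in> S}"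
    using conv openin_narrow_basis[OF G S(1)] unfolding limitin_def by blast
  then show "\<forall>\<^sub>F n in sequentially. (\<Sum>i=1..n. G (pts n i)) / real n \<in> S"
    using eventually_ge_at_top[of 1]
    by eventually_elim (simp add: integral_empirical bcont_measurable[OF G])
qed

abbreviation "smp k n \<equiv> sample_space P pts k n"

abbreviation "half_space k n f s \<equiv> {\<omega> \<in> space (smp k n). s \<le> (\<integral>p. f p \<partial>K_emp pts n \<omega>)}"

lemma product_P:
  assumes "k \<ge> 1" shows "product_sigma_finite (\<lambda>i. P k (pts n i))"
proof -
  have "prob_space (P k (pts n i))" for i using prob_measuresD(1)[OF P_prob[OF assms]] .
  then show ?thesis
    unfolding product_sigma_finite_def using prob_space_imp_sigma_finite by blast
qed

lemma prob_space_smp: "k \<ge> 1 \<Longrightarrow> prob_space (smp k n)"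
  unfolding sample_space_def by (intro prob_space_PiM prob_measuresD(1)[OF P_prob])

lemma space_smp: "k \<ge> 1 \<Longrightarrow> space (smp k n) = (\<Pi>\<^sub>E i\<in>{1..n}. UNIV)"
  unfolding sample_space_def space_PiM by (intro PiE_cong) (simp add: prob_measuresD(3)[OF P_prob])

lemma K_emp_integral:
  "n \<ge> 1 \<Longrightarrow> f \<in> borel_measurable borel \<Longrightarrow>
    (\<integral>p. f p \<partial>K_emp pts n \<omega>) = (\<Sum>i=1..n. f (pts n i, \<omega> i)) / real n"
  unfolding K_emp_def by (rule integral_empirical)

lemma K_emp_prob: "n \<ge> 1 \<Longrightarrow> K_emp pts n \<omega> \<in> prob_measures"
  unfolding K_emp_def by (rule empirical_prob)

lemma measurable_coordinate:
  assumes "k \<ge> 1" "i \<in> {1..n}" and f: "f \<in> borel_measurable (borel :: ('z \<times> 'x) measure)"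
  shows "(\<lambda>\<omega>. f (pts n i, \<omega> i)) \<in> borel_measurable (smp k n)"
proof -
  have 1: "(\<lambda>\<omega>. \<omega> i) \<in> measurable (smp k n) (P k (pts n i))"
    unfolding sample_space_def by (rule measurable_component_singleton[OF assms(2)])
  have "(\<lambda>x::'x. (pts n i, x)) \<in> borel_measurable borel"
    by (intro borel_measurable_continuous_onI continuous_intros)
  then have "(\<lambda>x. f (pts n i, x)) \<in> borel_measurable (P k (pts n i))"
    by (rule measurable_prob_measure[OF P_prob[OF assms(1)] measurable_compose[OF _ f]])
  from measurable_compose[OF 1 this] show ?thesis .
qed

lemma measurable_K_integral:
  fixes f :: "'z \<times> 'x \<Rightarrow> real"
  assumes "k \<ge> 1" "n \<ge> 1" "f \<in> borel_measurable borel"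
  shows "(\<lambda>\<omega>. \<integral>p. f p \<partial>K_emp pts n \<omega>) \<in> borel_measurable (smp k n)"
  unfolding K_emp_integral[OF assms(2,3)] using assms
  by (intro borel_measurable_divide borel_measurable_sum borel_measurable_const measurable_coordinate) auto

text \<open>Markov's inequality for \<open>g\<close>, the exponential of \<open>k * n\<close> times
  the excess of the integral over \<open>s\<close>. It is a product of functions of single
  coordinates, so independence splits its mean into the integrals that define
  \<open>Lam\<close>.\<close>

lemma chernoff:
  assumes "k \<ge> 1" "n \<ge> 1" and f: "blip f"
  shows "measure (smp k n) (half_space k n f s)
     \<le> exp (- real k * real n * (s - (\<Sum>i=1..n. Lam k f (pts n i)) / real n))"
proof -
  interpret product_sigma_finite "\<lambda>i. P k (pts n i)" by (rule product_P[OF assms(1)])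
  define h where "h i x = exp (real k * (f (pts n i, x) - s))" for i x
  define g where "g \<omega> = (\<Prod>i\<in>{1..n}. h i (\<omega> i))" for \<omega>
  have hi: "integrable (P k (pts n i)) (h i)" for i
  proof -
    have "blip (\<lambda>x. exp (real k * (f (pts n i, x) + (- s))))"
      by (intro blip_exp blip_cmult blip_add blip_const blip_section f)
    from blip_integrable[OF P_prob[OF assms(1)] this] show ?thesis by (simp add: h_def[abs_def])
  qed
  have h_int: "(\<integral>x. h i x \<partial>P k (pts n i)) = exp (real k * (Lam k f (pts n i) - s))" for i
  proof -
    have "(\<integral>x. h i x \<partial>P k (pts n i)) = (\<integral>x. exp (real k * f (pts n i, x)) / exp (real k * s) \<partial>P k (pts n i))"
      unfolding h_def by (simp add: right_diff_distrib exp_diff)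
    also have "\<dots> = exp (real k * Lam k f (pts n i)) / exp (real k * s)"
      by (simp add: exp_integral_Lam[OF assms(1) f])
    finally show ?thesis by (simp add: right_diff_distrib exp_diff)
  qed
  have gi: "integrable (smp k n) g"
    unfolding g_def sample_space_def by (rule product_integrable_prod) (use hi in auto)
  have g_eq: "g \<omega> = exp (real k * real n * ((\<integral>p. f p \<partial>K_emp pts n \<omega>) - s))" for \<omega>
    unfolding g_def h_def exp_sum[symmetric, OF finite_atLeastAtMost]
      K_emp_integral[OF assms(2) bcont_measurable[OF blip_bcont[OF f]]]
    using assms(2) by (simp add: sum_distrib_left[symmetric] sum_subtractf right_diff_distrib)
  have "1 \<le> g \<omega> \<longleftrightarrow> s \<le> (\<integral>p. f p \<partial>K_emp pts n \<omega>)" for \<omega>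
  proof -
    have "real k * real n > 0" using assms by simp
    then show ?thesis unfolding g_eq by (simp only: one_le_exp_iff zero_le_mult_iff) auto
  qed
  then have "half_space k n f s = {\<omega> \<in> space (smp k n). 1 \<le> g \<omega>}"
    by simp
  also have "measure (smp k n) \<dots> \<le> (\<integral>\<omega>. g \<omega> \<partial>smp k n) / 1"
    by (rule integral_Markov_inequality_measure[OF gi sets.empty_sets]) (auto simp: g_eq)
  also have "(\<integral>\<omega>. g \<omega> \<partial>smp k n) = (\<Prod>i\<in>{1..n}. \<integral>x. h i x \<partial>P k (pts n i))"
    unfolding g_def sample_space_def by (rule product_integral_prod) (use hi in auto)
  also have "\<dots> = exp (\<Sum>i=1..n. real k * (Lam k f (pts n i) - s))"
    unfolding h_int by (rule exp_sum[symmetric]) simp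
  also have "(\<Sum>i=1..n. real k * (Lam k f (pts n i) - s)) = - real k * real n * (s - (\<Sum>i=1..n. Lam k f (pts n i)) / real n)"
    using assms(2) by (simp add: sum_distrib_left[symmetric] sum_subtractf right_diff_distrib)
  finally show ?thesis by simp
qed

text \<open>\<open>L\<close> bounds the limit of \<open>\<integral> Lam k f d\<mu>\<close>, so the half space \<open>{q. s \<le> \<integral> f dq}\<close> has rate at least \<open>s - L\<close>.\<close>

definition exp_bound :: "('z \<times> 'x \<Rightarrow> real) \<Rightarrow> real \<Rightarrow> bool" where
  "exp_bound f L \<longleftrightarrow> blip f \<and> (\<forall>e>0. \<forall>\<^sub>F k in sequentially. \<forall>\<^sub>F n in sequentially. \<forall>s.
     measure (smp k n) (half_space k n f s)
       \<le> exp (- real k * real n * (s - L - e)))"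

lemma exp_bound_mono:
  assumes "exp_bound f L" "L \<le> L'" shows "exp_bound f L'"
  unfolding exp_bound_def
proof (intro conjI allI impI)
  show "blip f" using assms(1) unfolding exp_bound_def by blast
  fix e :: real assume "e > 0"
  have le: "exp (- real k * real n * (s - L - e)) \<le> exp (- real k * real n * (s - L' - e))" for k n s
  proof -
    have "(real k * real n) * (s - L' - e) \<le> (real k * real n) * (s - L - e)"
      using assms(2) by (intro mult_left_mono) auto
    then show ?thesis by simp
  qed
  have "\<forall>\<^sub>F k in sequentially. \<forall>\<^sub>F n in sequentially. \<forall>s.
     measure (smp k n) (half_space k n f s) \<le> exp (- real k * real n * (s - L - e))"
    using assms(1) \<open>e > 0\<close> unfolding exp_bound_def by blast
  then show "\<forall>\<^sub>F k in sequentially. \<forall>\<^sub>F n in sequentially. \<forall>s.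
     measure (smp k n) (half_space k n f s) \<le> exp (- real k * real n * (s - L' - e))"
    by (elim eventually_mono) (meson le order_trans)
qed

text \<open>\<open>g\<close> is a measurable majorant of the supremum over \<open>x\<close> of
  \<open>f (z, x) - J z x\<close>. Only the positive part of \<open>Lam k f - g\<close> matters; it
  is bounded and tends to 0 at every \<open>z\<close>, so its \<open>\<mu>\<close>-integral does.
  Narrow convergence then handles \<open>n\<close> because \<open>Lam k f\<close> is continuous.
  Half of \<open>e\<close> goes to each limit.\<close>

lemma exp_boundI:
  assumes f: "blip f" and g: "g \<in> borel_measurable borel" "\<And>z. \<bar>g z\<bar> \<le> B"
    and le: "\<And>z x. ereal (f (z, x)) \<le> J z x + ereal (g z)"
  shows "exp_bound f (\<integral>z. g z \<partial>\<mu>)"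
  unfolding exp_bound_def
proof (intro conjI allI impI)
  show "blip f" by fact
  fix e :: real assume "e > 0"
  interpret mu: prob_space \<mu> using prob_measuresD[OF \<mu>_prob] by simp
  obtain M where M: "\<And>p. \<bar>f p\<bar> \<le> M" using blipE[OF f] by metis
  have Lm [measurable]: "Lam k f \<in> borel_measurable borel" for k by (intro bcont_measurable Lam_bcont f)
  note g(1) [measurable]
  have "(\<lambda>k. \<integral>z. max 0 (Lam k f z - g z) \<partial>\<mu>) \<longlonglongrightarrow> 0"
  proof (rule tendsto_integral_zero[OF \<mu>_prob, where B = "M + B"])
    show "(\<lambda>z. max 0 (Lam k f z - g z)) \<in> borel_measurable borel" for k by measurable
    show "\<bar>max 0 (Lam k f z - g z)\<bar> \<le> M + B" for k z
      using Lam_bounded[OF f M, of k z] g(2)[of z] by linarith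
    show "(\<lambda>k. max 0 (Lam k f z - g z)) \<longlonglongrightarrow> 0" for z
    proof (rule LIMSEQ_I)
      fix r :: real assume "r > 0"
      then have "\<forall>\<^sub>F k in sequentially. Lam k f z \<le> g z + r/2" by (intro Lam_eventually_le[OF f le]) auto
      then have "\<forall>\<^sub>F k in sequentially. norm (max 0 (Lam k f z - g z) - 0) < r"
        by eventually_elim (use \<open>r > 0\<close> in auto)
      then show "\<exists>no. \<forall>k\<ge>no. norm (max 0 (Lam k f z - g z) - 0) < r" by (simp add: eventually_sequentially)
    qed
  qed
  then have "\<forall>\<^sub>F k in sequentially. (\<integral>z. max 0 (Lam k f z - g z) \<partial>\<mu>) < e/2"
    by (rule order_tendstoD) (use \<open>e > 0\<close> in auto)
  then show "\<forall>\<^sub>F k in sequentially. \<forall>\<^sub>F n in sequentially. \<forall>s.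
     measure (smp k n) (half_space k n f s)
       \<le> exp (- real k * real n * (s - (\<integral>z. g z \<partial>\<mu>) - e))"
    using eventually_ge_at_top[of 1]
  proof eventually_elim
    case (elim k)
    have int: "integrable \<mu> (Lam k f)" "integrable \<mu> g" "integrable \<mu> (\<lambda>z. max 0 (Lam k f z - g z))"
      using bcont_integrable[OF \<mu>_prob Lam_bcont[OF f]] bounded_integrable[OF \<mu>_prob g]
      by (auto intro!: integrable_max)
    have "(\<integral>z. Lam k f z \<partial>\<mu>) \<le> (\<integral>z. g z + max 0 (Lam k f z - g z) \<partial>\<mu>)"
      by (rule integral_mono) (use int in auto)
    also have "\<dots> < (\<integral>z. g z \<partial>\<mu>) + e/2" using int elim(1) by simp
    finally have "\<forall>\<^sub>F n in sequentially. (\<Sum>i=1..n. Lam k f (pts n i)) / real n < (\<integral>z. g z \<partial>\<mu>) + e/2"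
      by (rule order_tendstoD(2)[OF averages_tendsto[OF Lam_bcont[OF f]]])
    then show ?case using eventually_ge_at_top[of 1]
    proof (eventually_elim, intro allI)
      case (elim n)
      fix s
      have "(real k * real n) * (s - (\<integral>z. g z \<partial>\<mu>) - e) \<le> (real k * real n) * (s - (\<Sum>i=1..n. Lam k f (pts n i)) / real n)"
        using elim(1) \<open>e > 0\<close> by (intro mult_left_mono) auto
      then have "exp (- real k * real n * (s - (\<Sum>i=1..n. Lam k f (pts n i)) / real n)) \<le> exp (- real k * real n * (s - (\<integral>z. g z \<partial>\<mu>) - e))"
        by simp
      then show "measure (smp k n) (half_space k n f s)
       \<le> exp (- real k * real n * (s - (\<integral>z. g z \<partial>\<mu>) - e))"
        using chernoff[OF \<open>1 \<le> k\<close> elim(2) f, of s] by linarith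
    qed
  qed
qed

section \<open>A countable family of half spaces detecting the rate function\<close>

text \<open>\<open>J \<ge> 0\<close> makes the function itself a majorant. The factor
  \<open>c\<close> may have any sign and size: letting it run through the integers later forces
  equality of the marginals.\<close>

lemma exp_bound_marginal: "exp_bound (\<lambda>p. c * tst m (fst p)) (c * (\<integral>z. tst m z \<partial>\<mu>))"
proof -
  obtain M where M: "\<And>z::'z. \<bar>tst m z\<bar> \<le> M" using blipE[OF blip_tst] by metis
  have "exp_bound (\<lambda>p. c * tst m (fst p)) (\<integral>z. c * tst m z \<partial>\<mu>)"
  proof (rule exp_boundI[where B = "\<bar>c\<bar> * M"])
    show "blip (\<lambda>p. c * tst m (fst p))" by (intro blip_cmult blip_fst blip_tst)
    show "(\<lambda>z. c * tst m z) \<in> borel_measurable borel" by (intro bcont_measurable blip_bcont blip_cmult blip_tst)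
    show "\<bar>c * tst m z\<bar> \<le> \<bar>c\<bar> * M" for z :: 'z using M[of z] by (simp add: abs_mult mult_left_mono)
    show "ereal (c * tst m (fst (z, x))) \<le> J z x + ereal (c * tst m z)" for z x
      using J_nonneg[of z x] by (cases "J z x") auto
  qed
  then show ?thesis by simp
qed

end

text \<open>A Lipschitz substitute for the indicator of what lies far from the first
  \<open>b + 1\<close> dense points: 0 within \<open>d / 2\<close> of them, 1 from distance
  \<open>d\<close> on.\<close>

definition tail :: "real \<Rightarrow> nat \<Rightarrow> 'a::polish_space \<Rightarrow> real" where
  "tail d b x = max 0 (min 1 (2 * infdist x (dense_sequence ` {..b}) / d - 1))"

lemma tail_bounds: "0 \<le> tail d b x" "tail d b x \<le> 1" unfolding tail_def by auto

lemma blip_tail: assumes "d > 0" shows "blip (tail d b)"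
proof (rule blipI[of _ 1 "2 / d"])
  show "\<bar>tail d b x\<bar> \<le> 1" for x :: 'a using tail_bounds[of d b x] by simp
  fix x y :: 'a
  have "\<bar>2 * infdist x (dense_sequence ` {..b}) / d - 2 * infdist y (dense_sequence ` {..b}) / d\<bar> =
    2 / d * \<bar>infdist x (dense_sequence ` {..b}) - infdist y (dense_sequence ` {..b})\<bar>"
  proof -
    have "\<bar>2 * s / d - 2 * t / d\<bar> = 2 / d * \<bar>s - t\<bar>" for s t :: real
    proof -
      have "2 * s / d - 2 * t / d = 2 / d * (s - t)" by (simp add: right_diff_distrib)
      then show ?thesis using assms by (simp only: abs_mult) simp
    qed
    then show ?thesis .
  qed
  also have "\<dots> \<le> 2 / d * dist x y" by (rule mult_left_mono[OF infdist_triangle_abs]) (use assms in simp)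
  finally have *: "\<bar>2 * infdist x (dense_sequence ` {..b}) / d - 2 * infdist y (dense_sequence ` {..b}) / d\<bar> \<le> 2 / d * dist x y" .
  have "\<bar>max 0 (min 1 (s - 1)) - max 0 (min 1 (t - 1))\<bar> \<le> \<bar>s - t\<bar>" for s t :: real
    by (auto simp: max_def min_def)
  then show "\<bar>tail d b x - tail d b y\<bar> \<le> 2 / d * dist x y" unfolding tail_def using * by (rule order_trans)
qed

lemma tail_zero:
  assumes "d > 0" "i \<le> b" "dist x (dense_sequence i) < d / 2" shows "tail d b x = 0"
proof -
  have "infdist x (dense_sequence ` {..b}) \<le> dist x (dense_sequence i)" using assms(2) by (intro infdist_le) auto
  then have "infdist x (dense_sequence ` {..b}) < d / 2" using assms(3) by linarith
  then show ?thesis unfolding tail_def using assms(1) by (simp add: field_simps max_def min_def)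
qed

lemma tail_less_one:
  assumes "d > 0" "tail d b x < 1" obtains i where "i \<le> b" "dist x (dense_sequence i) < d"
proof -
  have "infdist x (dense_sequence ` {..b}) < d" using assms unfolding tail_def by (simp add: field_simps max_def min_def split: if_splits)
  then have "(INF a\<in>dense_sequence ` {..b}. dist x a) < d" by (simp add: infdist_notempty)
  then obtain a where "a \<in> dense_sequence ` {..b}" "dist x a < d" using cInf_lessD[of "dist x ` dense_sequence ` {..b}" d] by auto
  then show ?thesis using that by auto
qed

context ldp_setup begin

text \<open>Compactness of level sets enters here: the set where \<open>J z \<le> c\<close> is
  covered by balls around the first dense points once \<open>b\<close> is large. There the tail
  function is 0, and elsewhere \<open>c\<close> times it is at most \<open>c < J z\<close>. The
  bound 1 on the right is the same for all \<open>c\<close>, which is what yields tightness.\<close>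

lemma exp_bound_tail:
  assumes "d > 0" "c > 0"
  shows "\<exists>b. exp_bound (\<lambda>p. c * (tail d b (fst p) + tail d b (snd p))) 1"
proof -
  define A where "A b = - below_rate (\<lambda>x. c * tail d b x)" for b
  have Am [measurable]: "A b \<in> sets borel" for b
    unfolding A_def by (intro borel_comp below_rate_measurable blip_cmult blip_tail assms)
  have [measurable]: "(tail d b :: 'z \<Rightarrow> real) \<in> borel_measurable borel" for b
    by (intro bcont_measurable blip_bcont blip_tail assms)
  \<comment> \<open>For \<open>z\<close> outside \<open>A b\<close> the part in \<open>x\<close> is
    absorbed by \<open>J z\<close>; on \<open>A b\<close> it is bounded by \<open>c\<close>. Both
    terms vanish at each \<open>z\<close> for large \<open>b\<close>.\<close>
  define g where "g b z = c * tail d b z + c * indicator (A b) z" for b z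
  have gm: "g b \<in> borel_measurable borel" for b unfolding g_def by measurable
  have gB: "\<bar>g b z\<bar> \<le> 2 * c" for b z
  proof -
    have "c * tail d b z \<le> c * 1" "0 \<le> c * tail d b z" using tail_bounds[of d b z] assms by (auto intro: mult_left_mono)
    moreover have "c * indicator (A b) z \<le> c * 1" "0 \<le> c * indicator (A b) z" using assms by (auto simp: indicator_def)
    ultimately show ?thesis unfolding g_def by linarith
  qed
  have "(\<lambda>b. \<integral>z. g b z \<partial>\<mu>) \<longlonglongrightarrow> 0"
  proof (rule tendsto_integral_zero[OF \<mu>_prob gm gB])
    fix z :: 'z
    obtain i where i: "dist z (dense_sequence i) < d / 2" using dense_sequence[of "d/2" z] assms by auto
    have comp: "compact {x. J z x \<le> ereal c}" using rate unfolding good_rate_function_def by blast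
    have "{x. J z x \<le> ereal c} \<subseteq> (\<Union>j\<in>UNIV. ball (dense_sequence j) (d/2))"
      using dense_sequence[of "d/2"] assms by (auto simp: dist_commute)
    then obtain S where S: "finite S" "{x. J z x \<le> ereal c} \<subseteq> (\<Union>j\<in>S. ball (dense_sequence j) (d/2))"
      using compactE_image[OF comp, of UNIV "\<lambda>j. ball (dense_sequence j) (d/2)"] by auto
    have "g b z = 0" if b: "b \<ge> Max (insert i S)" for b
    proof -
      have bi: "j \<le> b" if "j \<in> insert i S" for j using Max_ge[OF _ that] b S(1) by (meson finite_insert order_trans)
      have "ereal (c * tail d b x) \<le> J z x" for x
      proof (cases "J z x \<le> ereal c")
        case True
        then obtain j where j: "j \<in> S" "dist x (dense_sequence j) < d / 2" using S(2) by (auto simp: dist_commute)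
        then have "tail d b x = 0" using bi assms by (intro tail_zero[of d j]) auto
        then show ?thesis using J_nonneg[of z x] by (simp add: zero_ereal_def)
      next
        case False
        have "c * tail d b x \<le> c * 1" using tail_bounds[of d b x] assms by (intro mult_left_mono) auto
        then have "ereal (c * tail d b x) \<le> ereal c" by simp
        then show ?thesis using False by (meson le_cases order_trans)
      qed
      then have "z \<notin> A b" unfolding A_def using below_rate_iff[OF blip_cmult[OF blip_tail[OF assms(1)]]] by blast
      moreover have "tail d b z = 0" using i bi assms by (intro tail_zero[of d i]) auto
      ultimately show ?thesis by (simp add: g_def)
    qed
    then show "(\<lambda>b. g b z) \<longlonglongrightarrow> 0"
      by (intro tendsto_eventually eventually_sequentiallyI)
  qed
  then have "\<forall>\<^sub>F b in sequentially. (\<integral>z. g b z \<partial>\<mu>) < 1" by (rule order_tendstoD) simp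
  then obtain b where b: "(\<integral>z. g b z \<partial>\<mu>) < 1" by (auto simp: eventually_sequentially)
  have "exp_bound (\<lambda>p. c * (tail d b (fst p) + tail d b (snd p))) (\<integral>z. g b z \<partial>\<mu>)"
  proof (rule exp_boundI[OF _ gm gB])
    show "blip (\<lambda>p. c * (tail d b (fst p) + tail d b (snd p)) :: real)"
      by (intro blip_cmult blip_add blip_fst blip_snd blip_tail assms)
    fix z x
    show "ereal (c * (tail d b (fst (z, x)) + tail d b (snd (z, x)))) \<le> J z x + ereal (g b z)"
    proof (cases "z \<in> A b")
      case True
      have "c * tail d b x \<le> c * 1" using tail_bounds[of d b x] assms by (intro mult_left_mono) auto
      then show ?thesis using True J_nonneg[of z x] by (cases "J z x") (auto simp: g_def algebra_simps)
    next
      case False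
      then have "ereal (c * tail d b x) \<le> J z x"
        unfolding A_def using below_rate_iff[OF blip_cmult[OF blip_tail[OF assms(1)]]] by blast
      then show ?thesis using False by (cases "J z x") (auto simp: g_def algebra_simps)
    qed
  qed
  then show ?thesis using exp_bound_mono b by (meson less_imp_le)
qed

lemma rate_approx_integrable:
  assumes q: "q \<in> prob_measures" shows "integrable q (rate_approx N)"
proof -
  have "\<exists>M. \<forall>x::'x. \<bar>tst j x\<bar> \<le> M" for j using blipE[OF blip_tst] by metis
  then obtain M where M: "\<And>j (x::'x). \<bar>tst j x\<bar> \<le> M j" by metis
  have "\<bar>rate_approx N p\<bar> \<le> (\<Sum>j<N. M j)" for p
  proof -
    have z: "runmax (\<lambda>j. 0) N = 0" by (induction N) auto
    have "\<bar>rate_approx N p\<bar> \<le> (\<Sum>j<N. \<bar>indicator (below_rate (tst j)) (fst p) * tst j (snd p) - 0\<bar>)"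
      using runmax_diff[of _ N "\<lambda>_. 0"] unfolding rate_approx_def z by simp
    also have "\<dots> \<le> (\<Sum>j<N. M j)"
    proof (rule sum_mono)
      fix j show "\<bar>indicator (below_rate (tst j)) (fst p) * tst j (snd p) - 0\<bar> \<le> M j"
        using M[of j "snd p"] by (auto simp: indicator_def)
    qed
    finally show ?thesis .
  qed
  then show ?thesis by (rule bounded_integrable[OF q rate_approx_measurable])
qed

lemma integral_fst_marginal:
  fixes q :: "('z \<times> 'x) measure"
  assumes q: "q \<in> prob_measures" "distr q borel fst = \<mu>" and g: "g \<in> borel_measurable borel"
  shows "(\<integral>p. g (fst p) \<partial>q) = (\<integral>z. (g z :: real) \<partial>\<mu>)"
  unfolding q(2)[symmetric]
  by (rule integral_distr[symmetric, OF measurable_prob_measure[OF q(1) measurable_fst_borel] g])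

text \<open>\<open>rate_approx N\<close> jumps in \<open>z\<close>, so its indicators are replaced
  by Lipschitz functions close to them in mean under \<open>\<mu>\<close>. The error
  \<open>h\<close> depends on \<open>z\<close> alone, so it has the same integral under all
  \<open>q\<close> with first marginal \<open>\<mu>\<close>; the same \<open>h\<close> is the
  majorant for the exponential bound.\<close>

lemma exp_bound_rate_approx:
  assumes "e > 0"
  shows "\<exists>f. exp_bound f e \<and> (\<forall>q\<in>prob_measures. distr q borel fst = \<mu> \<longrightarrow>
     (\<integral>p. rate_approx N p \<partial>q) \<le> (\<integral>p. f p \<partial>q) + e)"
proof -
  have "\<exists>M>0. \<forall>x::'x. \<bar>tst j x\<bar> \<le> M" for j using blipE[OF blip_tst] by metis
  then obtain M where M: "\<And>j. M j > 0" "\<And>j (x::'x). \<bar>tst j x\<bar> \<le> M j" by metis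
  define A where "A j = below_rate (tst j)" for j
  have Am [measurable]: "A j \<in> sets borel" for j unfolding A_def by (rule below_rate_measurable[OF blip_tst])
  \<comment> \<open>Makes the sum of the \<open>N\<close> errors, each weighted with the bound
    \<open>M j\<close> of its test function, at most \<open>e\<close>; \<open>Suc N\<close> avoids
    division by 0.\<close>
  define d where "d j = e / (real (Suc N) * M j)" for j
  have d: "d j > 0" for j using assms M(1)[of j] by (simp add: d_def)
  have "\<exists>g. blip g \<and> (\<forall>x. 0 \<le> g x \<and> g x \<le> 1) \<and> (\<integral>x. \<bar>g x - indicator (A j) x\<bar> \<partial>\<mu>) \<le> d j" for j
    using blip_approx_indicator[OF \<mu>_prob Am d] by metis
  then obtain g where g: "\<And>j. blip (g j)" "\<And>j x. 0 \<le> g j x" "\<And>j x. g j x \<le> 1"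
    "\<And>j. (\<integral>x. \<bar>g j x - indicator (A j) x\<bar> \<partial>\<mu>) \<le> d j" by metis
  have [measurable]: "g j \<in> borel_measurable borel" for j by (intro bcont_measurable blip_bcont g)
  define f where "f p = runmax (\<lambda>j. g j (fst p) * tst j (snd p)) N" for p :: "'z \<times> 'x"
  define h where "h z = (\<Sum>j<N. M j * \<bar>g j z - indicator (A j) z\<bar>)" for z
  have hm [measurable]: "h \<in> borel_measurable borel" unfolding h_def by measurable
  have g1: "\<bar>g j z - indicator (A j) z\<bar> \<le> 1" for j z using g(2)[of j z] g(3)[of j z] by (auto simp: indicator_def)
  have hB: "\<bar>h z\<bar> \<le> (\<Sum>j<N. M j)" for z
  proof -
    have "0 \<le> h z" unfolding h_def using M(1) by (intro sum_nonneg mult_nonneg_nonneg) (auto simp: less_imp_le)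
    moreover have "h z \<le> (\<Sum>j<N. M j * 1)" unfolding h_def using M(1) g1 by (intro sum_mono mult_left_mono) (auto simp: less_imp_le)
    ultimately show ?thesis by simp
  qed
  have diff: "\<bar>f p - rate_approx N p\<bar> \<le> h (fst p)" for p
  proof -
    have "\<bar>f p - rate_approx N p\<bar> \<le> (\<Sum>j<N. \<bar>g j (fst p) * tst j (snd p) - indicator (A j) (fst p) * tst j (snd p)\<bar>)"
      unfolding f_def rate_approx_def A_def by (rule runmax_diff)
    also have "\<dots> \<le> h (fst p)" unfolding h_def
    proof (rule sum_mono)
      fix j
      have "\<bar>g j (fst p) * tst j (snd p) - indicator (A j) (fst p) * tst j (snd p)\<bar> = \<bar>tst j (snd p)\<bar> * \<bar>g j (fst p) - indicator (A j) (fst p)\<bar>"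
        by (simp add: abs_mult[symmetric] algebra_simps)
      also have "\<dots> \<le> M j * \<bar>g j (fst p) - indicator (A j) (fst p)\<bar>" using M(2) by (intro mult_right_mono) auto
      finally show "\<bar>g j (fst p) * tst j (snd p) - indicator (A j) (fst p) * tst j (snd p)\<bar> \<le> M j * \<bar>g j (fst p) - indicator (A j) (fst p)\<bar>" .
    qed
    finally show ?thesis .
  qed
  have h_int: "(\<integral>z. h z \<partial>\<mu>) \<le> e"
  proof -
    have i: "integrable \<mu> (\<lambda>z. M j * \<bar>g j z - indicator (A j) z\<bar>)" for j
      by (intro integrable_mult_right bounded_integrable[OF \<mu>_prob, of _ 1]) (use g1 in auto)
    have "(\<integral>z. h z \<partial>\<mu>) = (\<Sum>j<N. M j * (\<integral>z. \<bar>g j z - indicator (A j) z\<bar> \<partial>\<mu>))"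
      unfolding h_def using i by (subst Bochner_Integration.integral_sum) auto
    also have "\<dots> \<le> (\<Sum>j<N. M j * d j)" using g(4) M(1) by (intro sum_mono mult_left_mono) (auto simp: less_imp_le)
    also have "\<dots> = (\<Sum>j<N. e / real (Suc N))"
      using M(1) by (intro sum.cong refl) (simp add: d_def less_imp_neq[THEN not_sym])
    also have "\<dots> \<le> e" using assms by (simp add: field_simps)
    finally show ?thesis .
  qed
  have f: "blip f" unfolding f_def by (intro blip_runmax blip_mult blip_fst blip_snd g blip_tst)
  have "exp_bound f (\<integral>z. h z \<partial>\<mu>)"
  proof (rule exp_boundI[OF f hm hB])
    fix z x
    have "f (z, x) \<le> rate_approx N (z, x) + h z" using diff[of "(z, x)"] by simp
    then have "ereal (f (z, x)) \<le> ereal (rate_approx N (z, x)) + ereal (h z)" by simp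
    also have "\<dots> \<le> J z x + ereal (h z)" by (intro add_right_mono rate_approx_le)
    finally show "ereal (f (z, x)) \<le> J z x + ereal (h z)" .
  qed
  then have 1: "exp_bound f e" using exp_bound_mono h_int by blast
  have 2: "(\<integral>p. rate_approx N p \<partial>q) \<le> (\<integral>p. f p \<partial>q) + e" if q: "q \<in> prob_measures" "distr q borel fst = \<mu>" for q
  proof -
    have hi: "integrable q (\<lambda>p. h (fst p))"
      by (rule bounded_integrable[OF q(1), of _ "\<Sum>j<N. M j"]) (use hB in auto)
    have fi: "integrable q f" by (rule blip_integrable[OF q(1) f])
    have "(\<integral>p. rate_approx N p \<partial>q) \<le> (\<integral>p. f p + h (fst p) \<partial>q)"
    proof (rule integral_mono[OF rate_approx_integrable[OF q(1)]])
      show "rate_approx N p \<le> f p + h (fst p)" for p using diff[of p] by linarith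
    qed (use hi fi in auto)
    also have "\<dots> = (\<integral>p. f p \<partial>q) + (\<integral>z. h z \<partial>\<mu>)" using hi fi integral_fst_marginal[OF q hm] by simp
    finally show ?thesis using h_int by simp
  qed
  show ?thesis using 1 2 by blast
qed

text \<open>Three kinds of constraints: integer multiples of coordinates of the first marginal
  (\<open>T1\<close>), large multiples of tail functions (\<open>T2\<close>), and continuous
  versions of \<open>rate_approx\<close> (\<open>T3\<close>). A sequence that eventually meets each
  of them is tight by \<open>T2\<close>, and a limit point inherits the marginal
  \<open>\<mu>\<close> from \<open>T1\<close> and rate at most \<open>a\<close> from
  \<open>T3\<close>. Countability later allows the first \<open>n\<close> constraints to be imposed
  on the \<open>n\<close>-th term of a sequence.\<close>

lemma rate_detecting_half_spaces:
  obtains F :: "nat \<Rightarrow> 'z \<times> 'x \<Rightarrow> real" and L :: "nat \<Rightarrow> real" where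
    "\<And>i. exp_bound (F i) (L i)"
    "\<And>(a::real) q. (\<And>n. q n \<in> prob_measures) \<Longrightarrow> (\<And>i. \<forall>\<^sub>F n in sequentially. (\<integral>p. F i p \<partial>q n) \<le> a + L i) \<Longrightarrow>
       \<exists>r l. strict_mono r \<and> l \<in> prob_measures \<and> (\<forall>m. (\<lambda>n. coords (q (r n)) m) \<longlonglongrightarrow> coords l m) \<and> rate_i J \<mu> l \<le> ereal a"
proof -
  define T1 where "T1 = (\<lambda>(m::nat, c::int). (\<lambda>p::'z \<times> 'x. of_int c * tst m (fst p), of_int c * (\<integral>z. tst m z \<partial>\<mu>)))"
  have "\<forall>j c::nat. \<exists>b. exp_bound (\<lambda>p. real (Suc c) * (tail (1 / real (Suc j)) b (fst p) + tail (1 / real (Suc j)) b (snd p))) 1"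
    by (intro allI exp_bound_tail) auto
  then obtain b where b: "\<And>j c::nat. exp_bound (\<lambda>p. real (Suc c) * (tail (1 / real (Suc j)) (b j c) (fst p) + tail (1 / real (Suc j)) (b j c) (snd p))) 1"
    by metis
  define T2 where "T2 = (\<lambda>(j, c). (\<lambda>p::'z \<times> 'x. real (Suc c) * (tail (1 / real (Suc j)) (b j c) (fst p) + tail (1 / real (Suc j)) (b j c) (snd p)), 1::real))"
  have "\<forall>N j::nat. \<exists>f. exp_bound f (1 / real (Suc j)) \<and> (\<forall>q\<in>prob_measures. distr q borel fst = \<mu> \<longrightarrow>
     (\<integral>p. rate_approx N p \<partial>q) \<le> (\<integral>p. f p \<partial>q) + 1 / real (Suc j))"
    by (intro allI exp_bound_rate_approx) auto
  then obtain f where f: "\<And>N j::nat. exp_bound (f N j) (1 / real (Suc j))"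
    "\<And>(N::nat) (j::nat) q. q\<in>prob_measures \<Longrightarrow> distr q borel fst = \<mu> \<Longrightarrow>
       (\<integral>p. rate_approx N p \<partial>q) \<le> (\<integral>p. f N j p \<partial>q) + 1 / real (Suc j)"
    by metis
  define T3 where "T3 = (\<lambda>(N, j). (f N j, 1 / real (Suc j)))"
  define T where "T = range T1 \<union> range T2 \<union> range T3"
  have cT: "countable T" unfolding T_def by (intro countable_Un countable_image countableI_type)
  have neT: "T \<noteq> {}" unfolding T_def by auto
  have eT: "exp_bound (fst t) (snd t)" if "t \<in> T" for t
    using that exp_bound_marginal b f(1) unfolding T_def T1_def T2_def T3_def by (auto simp: case_prod_beta)
  define F where "F i = fst (from_nat_into T i)" for i
  define L where "L i = snd (from_nat_into T i)" for i
  show ?thesis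
  proof (rule that[of F L])
    show "exp_bound (F i) (L i)" for i unfolding F_def L_def by (rule eT[OF from_nat_into[OF neT]])
    fix a :: real and q :: "nat \<Rightarrow> ('z \<times> 'x) measure"
    assume q: "\<And>n. q n \<in> prob_measures" and ev: "\<And>i. \<forall>\<^sub>F n in sequentially. (\<integral>p. F i p \<partial>q n) \<le> a + L i"
    have evT: "\<forall>\<^sub>F n in sequentially. (\<integral>p. fst t p \<partial>q n) \<le> a + snd t" if t: "t \<in> T" for t
    proof -
      obtain i where "from_nat_into T i = t" using from_nat_into_surj[OF cT t] by blast
      then show ?thesis using ev[of i] by (simp add: F_def L_def)
    qed
    have "tight_seq q" unfolding tight_seq_def
    proof (intro allI impI)
      fix d e :: real assume "d > 0" "e > 0"
      \<comment> \<open>The distances in the two components add up, hence half of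
        \<open>d\<close>.\<close>
      obtain j :: nat where j: "1 / real (Suc j) < d / 2" using nat_approx_posE[of "d/2"] \<open>d > 0\<close> by auto
      define \<delta> where "\<delta> = 1 / real (Suc j)"
      have \<delta>: "\<delta> > 0" "2 * \<delta> < d" using j by (auto simp: \<delta>_def)
      \<comment> \<open>The constraint bounds \<open>Suc c\<close> times the mean of
        \<open>g\<close> by \<open>a + 1\<close>, so this \<open>c\<close> makes the mean at most
        \<open>e\<close>.\<close>
      obtain c :: nat where "(a + 1) / e < real c" using reals_Archimedean2 by blast
      then have "(a + 1) / e \<le> real (Suc c)" by simp
      then have c: "a + 1 \<le> e * real (Suc c)" using \<open>e > 0\<close> by (simp add: field_simps)
      define B where "B = b j c"
      define g where "g p = tail \<delta> B (fst p) + tail \<delta> B (snd p)" for p :: "'z \<times> 'x"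
      have g: "blip g" unfolding g_def by (intro blip_add blip_fst blip_snd blip_tail \<delta>)
      have gnn: "0 \<le> g p" for p unfolding g_def by (intro add_nonneg_nonneg tail_bounds)
      define S where "S = (\<lambda>(i, i'). (dense_sequence i :: 'z, dense_sequence i' :: 'x)) ` ({..B} \<times> {..B})"
      have sub: "UNIV - (\<Union>s\<in>S. ball s d) \<subseteq> {p. 1 \<le> g p}"
      proof (rule subsetI, rule CollectI, rule ccontr)
        fix p assume p: "p \<in> UNIV - (\<Union>s\<in>S. ball s d)" "\<not> 1 \<le> g p"
        then have "tail \<delta> B (fst p) < 1" "tail \<delta> B (snd p) < 1"
          using tail_bounds(1)[of \<delta> B "fst p"] tail_bounds(1)[of \<delta> B "snd p"] unfolding g_def by linarith+
        then obtain i i' where i: "i \<le> B" "dist (fst p) (dense_sequence i) < \<delta>" "i' \<le> B" "dist (snd p) (dense_sequence i') < \<delta>"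
          using tail_less_one[OF \<delta>(1)] by metis
        have "dist p (dense_sequence i, dense_sequence i') \<le> dist (fst p) (dense_sequence i) + dist (snd p) (dense_sequence i')"
          unfolding dist_prod_def fst_conv snd_conv by (rule sqrt_sum_squares_le_sum) auto
        then have "p \<in> ball (dense_sequence i, dense_sequence i') d" using i \<delta> by (simp add: dist_commute)
        moreover have "(dense_sequence i, dense_sequence i') \<in> S" unfolding S_def using i by auto
        ultimately show False using p(1) by blast
      qed
      have "T2 (j, c) \<in> T" unfolding T_def by blast
      from evT[OF this] have "\<forall>\<^sub>F n in sequentially. measure (q n) (UNIV - (\<Union>s\<in>S. ball s d)) \<le> e"
      proof eventually_elim
        case (elim n)
        interpret prob_space "q n" using prob_measuresD[OF q] by simp
        note sq = prob_measuresD(2,3)[OF q[of n]]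
        have gi: "integrable (q n) g" by (rule blip_integrable[OF q g])
        have gm: "{p. 1 \<le> g p} \<in> sets (q n)"
          unfolding sq using blip_continuous[OF g] by (intro borel_closed closed_Collect_le continuous_intros)
        have "measure (q n) (UNIV - (\<Union>s\<in>S. ball s d)) \<le> measure (q n) {p. 1 \<le> g p}"
          by (rule finite_measure_mono[OF sub gm])
        also have "\<dots> \<le> (\<integral>p. g p \<partial>q n) / 1"
          using integral_Markov_inequality_measure[OF gi sets.empty_sets, of 1] gnn by (simp add: sq)
        finally have 1: "measure (q n) (UNIV - (\<Union>s\<in>S. ball s d)) \<le> (\<integral>p. g p \<partial>q n)" by simp
        have "real (Suc c) * (\<integral>p. g p \<partial>q n) \<le> a + 1"
          using elim by (simp add: T2_def g_def \<delta>_def B_def del: of_nat_Suc)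
        also have "\<dots> \<le> real (Suc c) * e" using c by (simp add: mult.commute del: of_nat_Suc)
        finally have "(\<integral>p. g p \<partial>q n) \<le> e" by (rule mult_left_le_imp_le) simp
        then show ?case using 1 by simp
      qed
      moreover have "finite S" unfolding S_def by auto
      ultimately show "\<exists>S. finite S \<and> (\<forall>\<^sub>F n in sequentially. measure (q n) (UNIV - (\<Union>s\<in>S. ball s d)) \<le> e)" by blast
    qed
    with q obtain r l where r: "strict_mono r" and l: "l \<in> prob_measures"
      and lim: "\<And>f. blip f \<Longrightarrow> (\<lambda>n. \<integral>x. f x \<partial>q (r n)) \<longlonglongrightarrow> (\<integral>x. f x \<partial>l)"
      by (rule tight_imp_convergent_subseq) blast
    interpret l: prob_space l using prob_measuresD[OF l] by simp
    have lT: "(\<integral>p. fst t p \<partial>l) \<le> a + snd t" if t: "t \<in> T" for t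
    proof (rule tendsto_upperbound)
      have "blip (fst t)" using eT[OF t] unfolding exp_bound_def by (rule conjunct1)
      then show "(\<lambda>n. \<integral>p. fst t p \<partial>q (r n)) \<longlonglongrightarrow> (\<integral>p. fst t p \<partial>l)"
        by (rule lim)
      show "\<forall>\<^sub>F n in sequentially. (\<integral>p. fst t p \<partial>q (r n)) \<le> a + snd t"
        by (rule eventually_subseq[OF r evT[OF t]])
    qed simp
    have fst_m: "fst \<in> borel_measurable l" by (rule measurable_prob_measure[OF l measurable_fst_borel])
    have marg: "distr l borel fst = \<mu>"
    proof (rule prob_measures_eqI[OF _ \<mu>_prob])
      show "distr l borel fst \<in> prob_measures" unfolding prob_measures_def using l.prob_space_distr[OF fst_m] by simp
      fix m
      define D where "D = (\<integral>p. tst m (fst p) \<partial>l) - (\<integral>z. tst m z \<partial>\<mu>)"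
      \<comment> \<open>Holding for all integers, of both signs, this leaves only
        \<open>D = 0\<close>.\<close>
      have cD: "of_int c * D \<le> a" for c :: int
      proof -
        have "T1 (m, c) \<in> T" unfolding T_def by blast
        from lT[OF this] show ?thesis by (simp add: T1_def D_def right_diff_distrib)
      qed
      have "D = 0"
      proof (rule ccontr)
        assume "D \<noteq> 0"
        obtain c :: nat where c: "a / \<bar>D\<bar> < real c" using reals_Archimedean2 by blast
        then have "a < real c * \<bar>D\<bar>" using \<open>D \<noteq> 0\<close> by (simp add: field_simps)
        then show False using cD[of "int c"] cD[of "- int c"] by (auto simp: abs_if split: if_splits)
      qed
      then show "(\<integral>x. tst m x \<partial>distr l borel fst) = (\<integral>x. tst m x \<partial>\<mu>)"
        unfolding D_def using integral_distr[OF fst_m bcont_measurable[OF blip_bcont[OF blip_tst]]] by simp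
    qed
    have ra: "(\<integral>p. rate_approx N p \<partial>l) \<le> a" for N
    proof (rule field_le_epsilon)
      fix e :: real assume "e > 0"
      then obtain j :: nat where j: "1 / real (Suc j) < e / 2" using nat_approx_posE[of "e/2"] by auto
      have "T3 (N, j) \<in> T" unfolding T_def by blast
      from lT[OF this] show "(\<integral>p. rate_approx N p \<partial>l) \<le> a + e"
        using f(2)[OF l marg, of N j] j by (simp add: T3_def)
    qed
    \<comment> \<open>\<open>rate_approx 0\<close> is 0, so the constraints rule out negative
      \<open>a\<close>; nonnegativity is what lets \<open>a\<close> pass through
      \<open>ennreal\<close> unchanged.\<close>
    have a: "0 \<le> a" using ra[of 0] by (simp add: rate_approx_def)
    have ra_nn: "0 \<le> rate_approx N p" for N p unfolding rate_approx_def by (rule runmax_nonneg)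
    have "(\<integral>\<^sup>+ p. e2ennreal (J (fst p) (snd p)) \<partial>l) \<le> ennreal a"
      unfolding nn_integral_J[OF l]
    proof (rule SUP_least)
      fix N
      have "(\<integral>\<^sup>+ p. ennreal (rate_approx N p) \<partial>l) = ennreal (\<integral>p. rate_approx N p \<partial>l)"
        by (rule nn_integral_eq_integral[OF rate_approx_integrable[OF l]]) (simp add: ra_nn)
      then show "(\<integral>\<^sup>+ p. ennreal (rate_approx N p) \<partial>l) \<le> ennreal a" using ra[of N] by (simp add: ennreal_leI)
    qed
    then have "enn2ereal (\<integral>\<^sup>+ p. e2ennreal (J (fst p) (snd p)) \<partial>l) \<le> enn2ereal (ennreal a)"
      by (simp add: less_eq_ennreal.rep_eq)
    then have "rate_i J \<mu> l \<le> ereal a" unfolding rate_i_def using marg a by (simp add: enn2ereal_ennreal)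
    then show "\<exists>r l. strict_mono r \<and> l \<in> prob_measures \<and> (\<forall>m. (\<lambda>n. coords (q (r n)) m) \<longlonglongrightarrow> coords l m) \<and> rate_i J \<mu> l \<le> ereal a"
      using r l lim[OF blip_tst] unfolding coords_def by blast
  qed
qed

end

section \<open>Approximating disintegrations by continuous weights\<close>

lemma bcontI: "continuous_on UNIV f \<Longrightarrow> (\<And>x. \<bar>f x\<bar> \<le> B) \<Longrightarrow> f \<in> bcont"
  unfolding bcont_def bounded_iff by auto

lemma bcont_cont: "f \<in> bcont \<Longrightarrow> continuous_on UNIV f" unfolding bcont_def by simp

lemma bcont_const: "(\<lambda>x. c) \<in> bcont" by (rule bcontI[of _ "\<bar>c\<bar>"]) auto

lemma bcont_add: assumes "f \<in> bcont" "g \<in> bcont" shows "(\<lambda>x. f x + g x) \<in> bcont"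
proof -
  obtain M M' where "\<And>x. \<bar>f x\<bar> \<le> M" "\<And>x. \<bar>g x\<bar> \<le> M'" using assms bcontE by metis
  then have "\<bar>f x + g x\<bar> \<le> M + M'" for x using abs_triangle_ineq[of "f x" "g x"] by (meson add_mono order_trans)
  then show ?thesis
    by (rule bcontI[OF continuous_on_add[OF bcont_cont[OF assms(1)] bcont_cont[OF assms(2)]]])
qed

lemma bcont_mult: assumes "f \<in> bcont" "g \<in> bcont" shows "(\<lambda>x. f x * g x) \<in> bcont"
proof -
  obtain M M' where "M > 0" "\<And>x. \<bar>f x\<bar> \<le> M" "\<And>x. \<bar>g x\<bar> \<le> M'" using assms bcontE by metis
  then have "\<bar>f x * g x\<bar> \<le> M * M'" for x unfolding abs_mult by (intro mult_mono) auto
  then show ?thesis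
    by (rule bcontI[OF continuous_on_mult[OF bcont_cont[OF assms(1)] bcont_cont[OF assms(2)]]])
qed

lemma bcont_sum: "(\<And>i. i \<in> I \<Longrightarrow> f i \<in> bcont) \<Longrightarrow> (\<lambda>x. \<Sum>i\<in>I. f i x) \<in> bcont"
proof (induction I rule: infinite_finite_induct)
  case (insert i I)
  then have "(\<lambda>x. f i x + (\<Sum>i\<in>I. f i x)) \<in> bcont" by (intro bcont_add) simp_all
  then show ?case using insert.hyps by simp
qed (simp_all add: bcont_const)

text \<open>Tested on \<open>A\<close>, the set where \<open>h\<close> exceeds 1, the hypothesis
  leaves a nonnegative function with integral at most 0.\<close>

lemma AE_le_one_of_integral:
  assumes m: "m \<in> prob_measures" and h: "h \<in> borel_measurable borel" "integrable m h"
    and le: "\<And>A. A \<in> sets borel \<Longrightarrow> (\<integral>x. h x * indicator A x \<partial>m) \<le> measure m A"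
  shows "AE x in m. h x \<le> (1::real)"
proof -
  interpret prob_space m using prob_measuresD[OF m] by simp
  note h(1) [measurable]
  define A where "A = {x. 1 < h x}"
  have A [measurable]: "A \<in> sets borel" unfolding A_def by measurable
  have Am: "A \<in> sets m" using A prob_measuresD(2)[OF m] by simp
  have i1: "integrable m (indicator A :: _ \<Rightarrow> real)" using Am by (simp add: less_top[symmetric])
  have i2: "integrable m (\<lambda>x. h x * indicator A x)"
    using integrable_mult_indicator[OF Am h(2)] by (simp add: mult.commute)
  have "(\<integral>x. h x * indicator A x - indicator A x \<partial>m) \<le> 0"
    using le[OF A] i1 i2 Am by simp
  moreover have nn: "0 \<le> h x * indicator A x - indicator A x" for x by (simp add: indicator_def A_def)
  then have "0 \<le> (\<integral>x. h x * indicator A x - indicator A x \<partial>m)" by simp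
  ultimately have "(\<integral>x. h x * indicator A x - indicator A x \<partial>m) = 0" by linarith
  then have "AE x in m. h x * indicator A x - indicator A x = 0"
    using integral_nonneg_eq_0_iff_AE[OF Bochner_Integration.integrable_diff[OF i2 i1]] nn by simp
  then show ?thesis by eventually_elim (auto simp: A_def indicator_def split: if_splits)
qed

text \<open>\<open>\<rho>\<close> is the conditional probability of \<open>C\<close> given the first
  coordinate, obtained as the Radon-Nikodym density of the projection of \<open>q\<close> restricted
  to \<open>C\<close>; that projection is dominated by the marginal, so the density is at most 1
  almost everywhere.\<close>

lemma marginal_density:
  fixes q :: "('z::polish_space \<times> 'x::polish_space) measure"
  assumes q: "q \<in> prob_measures" and m: "m \<in> prob_measures" and marg: "distr q borel fst = m" and C: "C \<in> sets borel"
  obtains \<rho> where "\<rho> \<in> borel_measurable borel" "\<And>z. 0 \<le> \<rho> z" "\<And>z. \<rho> z \<le> (1::real)"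
    "\<And>u B. u \<in> borel_measurable borel \<Longrightarrow> (\<And>z. \<bar>u z\<bar> \<le> B) \<Longrightarrow>
      (\<integral>z. \<rho> z * u z \<partial>m) = (\<integral>p. indicator C p * u (fst p) \<partial>q)"
proof -
  interpret q: prob_space q using prob_measuresD[OF q] by simp
  interpret m: prob_space m using prob_measuresD[OF m] by simp
  have fst_m [measurable]: "fst \<in> borel_measurable q"
    by (rule measurable_prob_measure[OF q]) (intro borel_measurable_continuous_onI continuous_intros)
  have Cq [measurable]: "C \<in> sets q" using C prob_measuresD(2)[OF q] by simp
  define \<nu> where "\<nu> = distr (density q (indicator C)) borel fst"
  have s\<nu>: "sets \<nu> = sets m" unfolding \<nu>_def using prob_measuresD(2)[OF m] by simp
  have e\<nu>: "emeasure \<nu> A = emeasure q (C \<inter> fst -` A \<inter> space q)" if "A \<in> sets borel" for A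
  proof -
    have "fst -` A \<inter> space q \<in> sets q" by (rule measurable_sets[OF fst_m that])
    then show ?thesis unfolding \<nu>_def using that
      by (simp add: emeasure_distr emeasure_restricted Int_assoc)
  qed
  have e\<nu>_le: "emeasure \<nu> A \<le> emeasure m A" if "A \<in> sets borel" for A
  proof -
    have "fst -` A \<inter> space q \<in> sets q" by (rule measurable_sets[OF fst_m that])
    then show ?thesis unfolding e\<nu>[OF that] marg[symmetric] using that
      by (subst emeasure_distr) (auto intro!: emeasure_mono)
  qed
  have fin: "finite_measure \<nu>"
  proof
    have "emeasure \<nu> (space \<nu>) \<le> emeasure m UNIV" using e\<nu>_le[of UNIV] by (simp add: \<nu>_def)
    also have "\<dots> = 1" using m.emeasure_space_1 prob_measuresD(3)[OF m] by simp
    finally show "emeasure \<nu> (space \<nu>) \<noteq> \<infinity>" by (metis ennreal_one_neq_top infinity_ennreal_def top.extremum_uniqueI)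
  qed
  have ac: "absolutely_continuous m \<nu>" unfolding absolutely_continuous_def
  proof
    fix A assume A: "A \<in> null_sets m"
    then have "A \<in> sets borel" using prob_measuresD(2)[OF m] by auto
    then show "A \<in> null_sets \<nu>" using e\<nu>_le[of A] A s\<nu> by (auto simp: null_sets_def)
  qed
  obtain D where D: "D \<in> borel_measurable m" "AE x in m. RN_deriv m \<nu> x = ennreal (D x)" "\<And>x. 0 \<le> D x"
    using m.real_RN_deriv[OF fin ac s\<nu>] by metis
  have Db [measurable]: "D \<in> borel_measurable borel" using D(1) prob_measuresD(2)[OF m] by (simp cong: measurable_cong_sets)
  have dens: "density m D = \<nu>"
  proof -
    have "density m (RN_deriv m \<nu>) = density m D" by (rule density_cong) (use D in auto)
    then show ?thesis using m.density_RN_deriv[OF ac s\<nu>] by simp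
  qed
  have "(\<integral>\<^sup>+ x. ennreal (D x) \<partial>m) = emeasure (density m D) (space m)"
    using D(1) by (subst emeasure_density) (auto intro!: nn_integral_cong)
  also have "\<dots> < \<infinity>" unfolding dens using finite_measure.emeasure_finite[OF fin] by (simp add: less_top)
  finally have Di: "integrable m D" using D by (intro integrableI_nonneg) auto
  have D_int: "(\<integral>z. D z * u z \<partial>m) = (\<integral>p. indicator C p * u (fst p) \<partial>q)" if u: "u \<in> borel_measurable borel" for u :: "'z \<Rightarrow> real"
  proof -
    have um: "u \<in> borel_measurable m" using measurable_prob_measure[OF m u] .
    have uf: "(\<lambda>p. u (fst p)) \<in> borel_measurable q" by (rule measurable_compose[OF fst_m u])
    have "(\<integral>z. D z * u z \<partial>m) = (\<integral>z. u z \<partial>density m D)"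
      using integral_density[OF um D(1)] D(3) by simp
    also have "\<dots> = (\<integral>p. u (fst p) \<partial>density q (indicator C))"
      unfolding dens \<nu>_def by (rule integral_distr) (use u in auto)
    also have "density q (indicator C) = density q (\<lambda>p. ennreal (indicator C p))" by (simp add: ennreal_indicator)
    also have "(\<integral>p. u (fst p) \<partial>density q (\<lambda>p. ennreal (indicator C p))) = (\<integral>p. indicator C p * u (fst p) \<partial>q)"
      using integral_density[OF uf, of "indicator C"] by simp
    finally show ?thesis .
  qed
  have "AE z in m. D z \<le> 1"
  proof (rule AE_le_one_of_integral[OF m Db Di])
    fix A :: "'z set" assume A: "A \<in> sets borel"
    have fA: "fst -` A \<inter> space q \<in> sets q" by (rule measurable_sets[OF fst_m A])
    have "(\<integral>z. D z * indicator A z \<partial>m) = (\<integral>p. indicator C p * indicator A (fst p) \<partial>q)" using A by (intro D_int) auto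
    also have "\<dots> = (\<integral>p. indicator (C \<inter> (fst -` A \<inter> space q)) p \<partial>q)"
      by (intro Bochner_Integration.integral_cong) (auto simp: indicator_def)
    also have "\<dots> = measure q (C \<inter> (fst -` A \<inter> space q))" using fA Cq by simp
    also have "\<dots> \<le> measure q (fst -` A \<inter> space q)" by (rule q.finite_measure_mono) (use fA in auto)
    also have "\<dots> = measure m A" unfolding marg[symmetric] using A by (simp add: measure_distr)
    finally show "(\<integral>z. D z * indicator A z \<partial>m) \<le> measure m A" .
  qed
  \<comment> \<open>Truncation at 1 changes the density only on a null set and gives the bound at
    every point.\<close>
  then have AE: "AE z in m. min 1 (D z) = D z" by eventually_elim simp
  show ?thesis
  proof (rule that[of "\<lambda>z. min 1 (D z)"])
    fix u :: "'z \<Rightarrow> real" and B assume u: "u \<in> borel_measurable borel"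
    have [measurable]: "u \<in> borel_measurable m" "D \<in> borel_measurable m"
      by (rule measurable_prob_measure[OF m u], rule measurable_prob_measure[OF m Db])
    have "(\<integral>z. min 1 (D z) * u z \<partial>m) = (\<integral>z. D z * u z \<partial>m)"
      by (rule integral_cong_AE) (use AE in auto)
    then show "(\<integral>z. min 1 (D z) * u z \<partial>m) = (\<integral>p. indicator C p * u (fst p) \<partial>q)" using D_int[OF u] by simp
  qed (use D in auto)
qed

text \<open>Layer-cake: \<open>\<rho>\<close> is within \<open>1/M\<close> of the average of the indicators of \<open>{\<rho> \<ge> i/M}\<close>.\<close>

lemma blip_approx_unit:
  fixes \<rho> :: "'a::polish_space \<Rightarrow> real"
  assumes q: "q \<in> prob_measures" and \<rho>: "\<rho> \<in> borel_measurable borel" "\<And>x. 0 \<le> \<rho> x" "\<And>x. \<rho> x \<le> 1" and "e > 0"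
  obtains g where "blip g" "\<And>x. 0 \<le> g x" "(\<integral>x. \<bar>g x - \<rho> x\<bar> \<partial>q) \<le> e"
proof -
  interpret prob_space q using prob_measuresD[OF q] by simp
  note \<rho>(1) [measurable]
  obtain M :: nat where "1 / real (Suc M) < e / 2" using nat_approx_posE[of "e/2"] \<open>e > 0\<close> by auto
  then obtain M :: nat where M: "M > 0" "1 / real M < e / 2" by (metis zero_less_Suc)
  define A where "A i = {x. real i \<le> real M * \<rho> x}" for i
  have Am [measurable]: "A i \<in> sets borel" for i unfolding A_def by measurable
  have "\<exists>g. blip g \<and> (\<forall>x. 0 \<le> g x) \<and> (\<forall>x. g x \<le> 1) \<and> (\<integral>x. \<bar>g x - indicator (A i) x\<bar> \<partial>q) \<le> e/2" for i
    using blip_approx_indicator[OF q Am, of "e/2" i] \<open>e > 0\<close> by (metis half_gt_zero)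
  then obtain h where h: "\<And>i. blip (h i)" "\<And>i x. 0 \<le> h i x" "\<And>i x. h i x \<le> 1"
    "\<And>i. (\<integral>x. \<bar>h i x - indicator (A i) x\<bar> \<partial>q) \<le> e/2" by metis
  define g where "g x = 1 / real M * (\<Sum>i=1..M. h i x)" for x
  have blip_sum: "blip (\<lambda>x. \<Sum>i=1..n. h i x)" for n by (induction n) (auto intro: blip_add blip_const h)
  have g: "blip g" unfolding g_def by (intro blip_cmult blip_sum)
  have layer: "\<bar>(\<Sum>i=1..M. indicator (A i) x) / real M - \<rho> x\<bar> \<le> 1 / real M" for x
  proof -
    define n where "n = nat \<lfloor>real M * \<rho> x\<rfloor>"
    have nn: "0 \<le> real M * \<rho> x" "real M * \<rho> x \<le> real M" using \<rho>(2,3)[of x] M(1) by (auto simp: mult_left_le)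
    have n: "real n \<le> real M * \<rho> x" "real M * \<rho> x < real n + 1" unfolding n_def using nn(1) by (simp_all add: of_nat_nat)
    have iff: "real i \<le> real M * \<rho> x \<longleftrightarrow> i \<le> n" for i using n by linarith
    have "n \<le> M" using n(1) nn(2) by linarith
    have "(\<Sum>i=1..M. indicator (A i) x :: real) = (\<Sum>i=1..M. if i \<le> n then 1 else 0)"
      by (intro sum.cong refl) (simp add: A_def indicator_def iff)
    also have "\<dots> = real (card ({1..M} \<inter> {i. i \<le> n}))" by (simp add: sum.If_cases)
    also have "{1..M} \<inter> {i. i \<le> n} = {1..n}" using \<open>n \<le> M\<close> by auto
    finally have "(\<Sum>i=1..M. indicator (A i) x :: real) = real n" by simp
    moreover have "real n / real M - \<rho> x \<le> 0" "- (1 / real M) \<le> real n / real M - \<rho> x"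
      using n M(1) by (simp_all add: field_simps)
    ultimately show ?thesis by (simp add: abs_le_iff)
  qed
  have hi: "integrable q (\<lambda>x. \<bar>h i x - indicator (A i) x\<bar>)" for i
  proof (rule bounded_integrable[OF q, of _ 1])
    have [measurable]: "h i \<in> borel_measurable borel" by (intro bcont_measurable blip_bcont h)
    show "(\<lambda>x. \<bar>h i x - indicator (A i) x\<bar>) \<in> borel_measurable borel" by measurable
    show "\<bar>\<bar>h i x - indicator (A i) x\<bar>\<bar> \<le> 1" for x using h(2)[of i x] h(3)[of i x] by (auto simp: indicator_def)
  qed
  have "(\<integral>x. \<bar>g x - \<rho> x\<bar> \<partial>q) \<le> (\<integral>x. 1 / real M * (\<Sum>i=1..M. \<bar>h i x - indicator (A i) x\<bar>) + 1 / real M \<partial>q)"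
  proof (rule integral_mono)
    show "integrable q (\<lambda>x. \<bar>g x - \<rho> x\<bar>)"
      using blip_integrable[OF q g] bounded_integrable[OF q \<rho>(1), of 1] \<rho>(2,3) by (auto simp: abs_le_iff intro: order_trans[of _ 0])
    show "integrable q (\<lambda>x. 1 / real M * (\<Sum>i=1..M. \<bar>h i x - indicator (A i) x\<bar>) + 1 / real M)"
      using hi by auto
    fix x
    have "g x - (\<Sum>i=1..M. indicator (A i) x) / real M = 1 / real M * (\<Sum>i=1..M. h i x - indicator (A i) x)"
      by (simp add: g_def sum_subtractf diff_divide_distrib)
    then have "\<bar>g x - (\<Sum>i=1..M. indicator (A i) x) / real M\<bar> = 1 / real M * \<bar>\<Sum>i=1..M. h i x - indicator (A i) x\<bar>"
      by (simp add: abs_mult)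
    also have "\<dots> \<le> 1 / real M * (\<Sum>i=1..M. \<bar>h i x - indicator (A i) x\<bar>)" by (intro mult_left_mono sum_abs) auto
    finally show "\<bar>g x - \<rho> x\<bar> \<le> 1 / real M * (\<Sum>i=1..M. \<bar>h i x - indicator (A i) x\<bar>) + 1 / real M"
      using layer[of x] by linarith
  qed
  also have "\<dots> = 1 / real M * (\<Sum>i=1..M. \<integral>x. \<bar>h i x - indicator (A i) x\<bar> \<partial>q) + 1 / real M"
    using hi by (simp add: prob_space)
  also have "\<dots> \<le> 1 / real M * (\<Sum>i=1..M. e / 2) + 1 / real M"
    by (intro add_right_mono mult_left_mono sum_mono h(4)) auto
  also have "\<dots> \<le> e" using M by simp
  finally have "(\<integral>x. \<bar>g x - \<rho> x\<bar> \<partial>q) \<le> e" .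
  moreover have "0 \<le> g x" for x unfolding g_def using h(2) by (intro mult_nonneg_nonneg sum_nonneg) auto
  ultimately show ?thesis using that g by blast
qed

text \<open>After approximating each \<open>\<rho> i\<close> separately the sum may exceed 1.
  Division by \<open>S\<close> repairs this, and the total change is at most the excess over 1,
  which is bounded by the approximation error itself because the \<open>\<rho> i\<close> sum to at
  most 1 almost everywhere.\<close>

lemma bcont_partition_approx:
  fixes \<rho> :: "'i \<Rightarrow> 'a::polish_space \<Rightarrow> real"
  assumes q: "q \<in> prob_measures" and I: "finite I"
    and \<rho>: "\<And>i. i \<in> I \<Longrightarrow> \<rho> i \<in> borel_measurable borel" "\<And>i x. i \<in> I \<Longrightarrow> 0 \<le> \<rho> i x" "\<And>i x. i \<in> I \<Longrightarrow> \<rho> i x \<le> 1"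
    and AE: "AE x in q. (\<Sum>i\<in>I. \<rho> i x) \<le> 1" and "e > 0"
  obtains \<theta> where "\<And>i. \<theta> i \<in> bcont" "\<And>i x. 0 \<le> \<theta> i x" "\<And>x. (\<Sum>i\<in>I. \<theta> i x) \<le> 1"
    "(\<Sum>i\<in>I. \<integral>x. \<bar>\<theta> i x - \<rho> i x\<bar> \<partial>q) \<le> e"
proof -
  interpret prob_space q using prob_measuresD[OF q] by simp
  \<comment> \<open>The factor 2 pays for approximation and normalisation; the added 1 keeps the
    denominator positive for empty \<open>I\<close>.\<close>
  define e' where "e' = e / (2 * real (card I) + 1)"
  have e': "e' > 0" using \<open>e > 0\<close> by (simp add: e'_def)
  have "\<exists>g. i \<in> I \<longrightarrow> blip g \<and> (\<forall>x. 0 \<le> g x) \<and> (\<integral>x. \<bar>g x - \<rho> i x\<bar> \<partial>q) \<le> e'" for i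
    using blip_approx_unit[OF q \<rho> e', of i] by metis
  then obtain g where g: "\<And>i. i \<in> I \<Longrightarrow> blip (g i)" "\<And>i x. i \<in> I \<Longrightarrow> 0 \<le> g i x"
    "\<And>i. i \<in> I \<Longrightarrow> (\<integral>x. \<bar>g i x - \<rho> i x\<bar> \<partial>q) \<le> e'" by metis
  define S where "S x = max 1 (\<Sum>i\<in>I. g i x)" for x
  define \<theta> where "\<theta> i x = (if i \<in> I then g i x / S x else 0)" for i x
  have S1: "1 \<le> S x" for x unfolding S_def by simp
  have gS: "g i x \<le> S x" if "i \<in> I" for i x
    unfolding S_def using member_le_sum[OF that, of "\<lambda>i. g i x"] g(2) I by (auto simp: le_max_iff_disj)
  have gc: "continuous_on UNIV (g i)" if "i \<in> I" for i using blip_continuous[OF g(1)[OF that]] .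
  have Sc: "continuous_on UNIV S" unfolding S_def[abs_def] using gc by (intro continuous_intros) auto
  have th: "\<theta> i \<in> bcont" for i
  proof (cases "i \<in> I")
    case True
    have "continuous_on UNIV (\<lambda>x. g i x / S x)"
      using gc[OF True] Sc S1 by (intro continuous_on_divide) (auto, metis not_one_le_zero)
    moreover have "\<bar>g i x / S x\<bar> \<le> 1" for x using gS[OF True, of x] S1[of x] g(2)[OF True, of x] by (simp add: field_simps)
    ultimately have "(\<lambda>x. g i x / S x) \<in> bcont" by (rule bcontI)
    then show ?thesis using True by (simp add: \<theta>_def[abs_def])
  qed (simp add: \<theta>_def[abs_def] bcont_const)
  have sum_th: "(\<Sum>i\<in>I. \<theta> i x) = (\<Sum>i\<in>I. g i x) / S x" for x by (simp add: \<theta>_def sum_divide_distrib)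
  have \<rho>i: "integrable q (\<rho> i)" if "i \<in> I" for i
    by (rule bounded_integrable[OF q \<rho>(1)[OF that], of 1]) (use \<rho>(2,3)[OF that] in \<open>auto simp: abs_le_iff intro: order_trans[of _ 0]\<close>)
  have gi: "integrable q (g i)" if "i \<in> I" for i by (rule blip_integrable[OF q g(1)[OF that]])
  have thi: "integrable q (\<theta> i)" for i by (rule bcont_integrable[OF q th])
  have "(\<Sum>i\<in>I. \<integral>x. \<bar>\<theta> i x - \<rho> i x\<bar> \<partial>q) = (\<integral>x. (\<Sum>i\<in>I. \<bar>\<theta> i x - \<rho> i x\<bar>) \<partial>q)"
    using \<rho>i thi by (subst Bochner_Integration.integral_sum) auto
  also have "\<dots> \<le> (\<integral>x. 2 * (\<Sum>i\<in>I. \<bar>g i x - \<rho> i x\<bar>) \<partial>q)"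
  proof (rule integral_mono_AE)
    show "integrable q (\<lambda>x. \<Sum>i\<in>I. \<bar>\<theta> i x - \<rho> i x\<bar>)" using \<rho>i thi by auto
    show "integrable q (\<lambda>x. 2 * (\<Sum>i\<in>I. \<bar>g i x - \<rho> i x\<bar>))" using \<rho>i gi by auto
    from AE show "AE x in q. (\<Sum>i\<in>I. \<bar>\<theta> i x - \<rho> i x\<bar>) \<le> 2 * (\<Sum>i\<in>I. \<bar>g i x - \<rho> i x\<bar>)"
    proof eventually_elim
      case (elim x)
      have "(\<Sum>i\<in>I. \<bar>\<theta> i x - g i x\<bar>) = (\<Sum>i\<in>I. g i x - \<theta> i x)"
      proof (intro sum.cong refl)
        fix i assume i: "i \<in> I"
        have "g i x * 1 \<le> g i x * S x" using S1[of x] g(2)[OF i, of x] by (intro mult_left_mono) auto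
        then have "g i x / S x \<le> g i x" using S1[of x] by (simp add: field_simps)
        then show "\<bar>\<theta> i x - g i x\<bar> = g i x - \<theta> i x" using i by (simp add: \<theta>_def)
      qed
      also have "\<dots> = (\<Sum>i\<in>I. g i x) - (\<Sum>i\<in>I. g i x) / S x" by (simp add: sum_subtractf sum_th)
      also have "\<dots> \<le> max 0 ((\<Sum>i\<in>I. g i x) - 1)" unfolding S_def by (auto simp: max_def)
      also have "\<dots> \<le> (\<Sum>i\<in>I. \<bar>g i x - \<rho> i x\<bar>)"
      proof -
        have "(\<Sum>i\<in>I. g i x) - (\<Sum>i\<in>I. \<rho> i x) \<le> (\<Sum>i\<in>I. \<bar>g i x - \<rho> i x\<bar>)"
          unfolding sum_subtractf[symmetric] by (intro sum_mono) auto
        moreover have "0 \<le> (\<Sum>i\<in>I. \<bar>g i x - \<rho> i x\<bar>)" by (intro sum_nonneg) auto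
        ultimately show ?thesis using elim by auto
      qed
      finally have 1: "(\<Sum>i\<in>I. \<bar>\<theta> i x - g i x\<bar>) \<le> (\<Sum>i\<in>I. \<bar>g i x - \<rho> i x\<bar>)" .
      have "(\<Sum>i\<in>I. \<bar>\<theta> i x - \<rho> i x\<bar>) \<le> (\<Sum>i\<in>I. \<bar>\<theta> i x - g i x\<bar> + \<bar>g i x - \<rho> i x\<bar>)" by (intro sum_mono) auto
      then show ?case using 1 by (simp add: sum.distrib)
    qed
  qed
  also have "\<dots> = 2 * (\<Sum>i\<in>I. \<integral>x. \<bar>g i x - \<rho> i x\<bar> \<partial>q)" using \<rho>i gi by simp
  also have "\<dots> \<le> 2 * (\<Sum>i\<in>I. e')" using g(3) by (intro mult_left_mono sum_mono) auto
  also have "\<dots> = 2 * real (card I) * e'" by simp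
  also have "\<dots> \<le> e" using \<open>e > 0\<close> by (simp add: e'_def field_simps)
  finally have 2: "(\<Sum>i\<in>I. \<integral>x. \<bar>\<theta> i x - \<rho> i x\<bar> \<partial>q) \<le> e" .
  have 3: "(\<Sum>i\<in>I. \<theta> i x) \<le> 1" for x
    unfolding sum_th using S1[of x] by (simp add: S_def field_simps)
  have 4: "0 \<le> \<theta> i x" for i x unfolding \<theta>_def using g(2)[of i x] S1[of x] by auto
  show ?thesis by (rule that[OF th 4 3 2])
qed

section \<open>Derandomised assignment of targets\<close>

text \<open>Choosing the labels one at a time, the squared Euclidean norm of the accumulated deviation
  increases on average by at most the variance, so some choice never increases it by more.\<close>

lemma greedy_assignment:
  fixes w :: "nat \<Rightarrow> 'l \<Rightarrow> real" and v :: "'r \<Rightarrow> nat \<Rightarrow> 'l \<Rightarrow> real"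
  assumes I: "finite I" and w: "\<And>i l. l \<in> I \<Longrightarrow> 0 \<le> w i l" "\<And>i. (\<Sum>l\<in>I. w i l) = 1"
    and R: "finite R" and C: "\<And>r i l. r \<in> R \<Longrightarrow> l \<in> I \<Longrightarrow> \<bar>v r i l\<bar> \<le> C"
  shows "\<exists>a. (\<forall>i\<in>{1..n}. a i \<in> I \<and> 0 < w i (a i)) \<and>
     (\<Sum>r\<in>R. (\<Sum>i=1..n. v r i (a i) - (\<Sum>l\<in>I. w i l * v r i l))\<^sup>2) \<le> real n * (real (card R) * (2 * C)\<^sup>2)"
proof (induction n)
  case (Suc n)
  define E where "E r i = (\<Sum>l\<in>I. w i l * v r i l)" for r i
  define B where "B = real (card R) * (2 * C)\<^sup>2"
  obtain a where a: "\<And>i. i\<in>{1..n} \<Longrightarrow> a i \<in> I \<and> 0 < w i (a i)"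
    "(\<Sum>r\<in>R. (\<Sum>i=1..n. v r i (a i) - E r i)\<^sup>2) \<le> real n * B"
    using Suc unfolding E_def B_def by blast
  define W where "W r = (\<Sum>i=1..n. v r i (a i) - E r i)" for r
  define d where "d r l = v r (Suc n) l - E r (Suc n)" for r l
  have E_abs: "\<bar>E r i\<bar> \<le> C" if "r \<in> R" for r i
  proof -
    have "\<bar>E r i\<bar> \<le> (\<Sum>l\<in>I. \<bar>w i l * v r i l\<bar>)" unfolding E_def by (rule sum_abs)
    also have "\<dots> \<le> (\<Sum>l\<in>I. w i l * C)" unfolding abs_mult using w(1) C[OF that] by (intro sum_mono mult_mono) auto
    also have "\<dots> = C" using w(2) by (simp add: sum_distrib_right[symmetric])
    finally show ?thesis .
  qed
  have d_sq: "(d r l)\<^sup>2 \<le> (2 * C)\<^sup>2" if "r \<in> R" "l \<in> I" for r l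
  proof -
    have "\<bar>d r l\<bar> \<le> 2 * C" unfolding d_def using C[OF that, of "Suc n"] E_abs[OF that(1), of "Suc n"] by linarith
    from power_mono[OF this abs_ge_zero, of 2] show ?thesis by simp
  qed
  \<comment> \<open>Deviations have mean 0 under the weights, so the cross terms with
    \<open>W r\<close> vanish on average.\<close>
  have d0: "(\<Sum>l\<in>I. w (Suc n) l * d r l) = 0" for r
    unfolding d_def right_diff_distrib sum_subtractf sum_distrib_right[symmetric] w(2) by (simp add: E_def)
  \<comment> \<open>Only labels of positive weight are admissible, since the cut-off weights vanish
    where a target is too improbable. At least one exists because the weights sum to 1, and it makes
    the averaged inequality strict.\<close>
  have "\<exists>l\<in>I. 0 < w (Suc n) l \<and> (\<Sum>r\<in>R. (W r + d r l)\<^sup>2) \<le> (\<Sum>r\<in>R. (W r)\<^sup>2) + B"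
  proof (rule ccontr)
    assume "\<not> ?thesis"
    then have less: "(\<Sum>r\<in>R. (W r)\<^sup>2) + B < (\<Sum>r\<in>R. (W r + d r l)\<^sup>2)" if "l \<in> I" "0 < w (Suc n) l" for l
      using that by (auto simp: not_le)
    have exp: "(\<Sum>l\<in>I. w (Suc n) l * (\<Sum>r\<in>R. (W r + d r l)\<^sup>2)) \<le> (\<Sum>r\<in>R. (W r)\<^sup>2) + B"
    proof -
      have "(\<Sum>l\<in>I. w (Suc n) l * (\<Sum>r\<in>R. (W r + d r l)\<^sup>2)) = (\<Sum>r\<in>R. \<Sum>l\<in>I. w (Suc n) l * (W r + d r l)\<^sup>2)"
        unfolding sum_distrib_left by (rule sum.swap)
      also have "\<dots> = (\<Sum>r\<in>R. (W r)\<^sup>2 * (\<Sum>l\<in>I. w (Suc n) l) + 2 * W r * (\<Sum>l\<in>I. w (Suc n) l * d r l) + (\<Sum>l\<in>I. w (Suc n) l * (d r l)\<^sup>2))"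
        unfolding sum_distrib_left sum.distrib[symmetric]
        by (intro sum.cong refl) (simp add: power2_sum algebra_simps)
      also have "\<dots> \<le> (\<Sum>r\<in>R. (W r)\<^sup>2 + (2 * C)\<^sup>2)"
      proof (rule sum_mono)
        fix r assume "r \<in> R"
        then have "(\<Sum>l\<in>I. w (Suc n) l * (d r l)\<^sup>2) \<le> (\<Sum>l\<in>I. w (Suc n) l * (2 * C)\<^sup>2)"
          using w(1) d_sq by (intro sum_mono mult_left_mono) auto
        also have "\<dots> = (2 * C)\<^sup>2" using w(2) by (simp add: sum_distrib_right[symmetric])
        finally show "(W r)\<^sup>2 * (\<Sum>l\<in>I. w (Suc n) l) + 2 * W r * (\<Sum>l\<in>I. w (Suc n) l * d r l) + (\<Sum>l\<in>I. w (Suc n) l * (d r l)\<^sup>2) \<le> (W r)\<^sup>2 + (2 * C)\<^sup>2"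
          unfolding d0 w(2) by simp
      qed
      also have "\<dots> = (\<Sum>r\<in>R. (W r)\<^sup>2) + B" by (simp add: sum.distrib B_def)
      finally show ?thesis .
    qed
    obtain l0 where l0: "l0 \<in> I" "0 < w (Suc n) l0"
    proof -
      have "\<not> (\<forall>l\<in>I. w (Suc n) l \<le> 0)" using sum_nonpos[of I "w (Suc n)"] w(2)[of "Suc n"] by auto
      then show ?thesis using that by (auto simp: not_le)
    qed
    have "(\<Sum>r\<in>R. (W r)\<^sup>2) + B = (\<Sum>l\<in>I. w (Suc n) l * ((\<Sum>r\<in>R. (W r)\<^sup>2) + B))"
      using w(2) by (simp add: sum_distrib_right[symmetric])
    also have "\<dots> < (\<Sum>l\<in>I. w (Suc n) l * (\<Sum>r\<in>R. (W r + d r l)\<^sup>2))"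
    proof (rule sum_strict_mono_ex1[OF I])
      show "\<forall>l\<in>I. w (Suc n) l * ((\<Sum>r\<in>R. (W r)\<^sup>2) + B) \<le> w (Suc n) l * (\<Sum>r\<in>R. (W r + d r l)\<^sup>2)"
      proof
        fix l assume l: "l \<in> I"
        show "w (Suc n) l * ((\<Sum>r\<in>R. (W r)\<^sup>2) + B) \<le> w (Suc n) l * (\<Sum>r\<in>R. (W r + d r l)\<^sup>2)"
        proof (cases "w (Suc n) l = 0")
          case False
          then have "0 < w (Suc n) l" using w(1)[OF l, of "Suc n"] by simp
          then show ?thesis using less[OF l] by (intro mult_left_mono) auto
        qed simp
      qed
      show "\<exists>l\<in>I. w (Suc n) l * ((\<Sum>r\<in>R. (W r)\<^sup>2) + B) < w (Suc n) l * (\<Sum>r\<in>R. (W r + d r l)\<^sup>2)"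
        using l0 less[OF l0] by (intro bexI[of _ l0] mult_strict_left_mono) auto
    qed
    finally show False using exp by simp
  qed
  then obtain l where l: "l \<in> I" "0 < w (Suc n) l" "(\<Sum>r\<in>R. (W r + d r l)\<^sup>2) \<le> (\<Sum>r\<in>R. (W r)\<^sup>2) + B" by blast
  define a' where "a' = a(Suc n := l)"
  have "(\<Sum>i=1..Suc n. v r i (a' i) - E r i) = W r + d r l" for r
  proof -
    have "(\<Sum>i=1..n. v r i (a' i) - E r i) = W r" unfolding W_def by (intro sum.cong) (auto simp: a'_def)
    then show ?thesis by (simp add: a'_def d_def)
  qed
  then have "(\<Sum>r\<in>R. (\<Sum>i=1..Suc n. v r i (a' i) - E r i)\<^sup>2) \<le> (\<Sum>r\<in>R. (W r)\<^sup>2) + B" using l(3) by simp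
  also have "\<dots> \<le> real n * B + B" using a(2) by (simp add: W_def)
  also have "\<dots> = real (Suc n) * B" by (simp add: algebra_simps)
  finally have "(\<Sum>r\<in>R. (\<Sum>i=1..Suc n. v r i (a' i) - E r i)\<^sup>2) \<le> real (Suc n) * B" .
  moreover have "\<forall>i\<in>{1..Suc n}. a' i \<in> I \<and> 0 < w i (a' i)"
    using a(1) l(1,2) by (auto simp: a'_def le_Suc_eq)
  ultimately show ?case unfolding E_def B_def by blast
qed simp

section \<open>The lower bound\<close>

context ldp_setup begin

lemma blip_tst_section: "blip (\<lambda>z::'z. tst m (z, x::'x))"
  by (rule blip_comp[OF blip_tst]) (simp add: dist_Pair_Pair)

text \<open>An index \<open>r\<close> in \<open>R'\<close> names a quantity to be kept near its
  mean: \<open>Inl m\<close> the coordinate \<open>m\<close>, \<open>Inr True\<close> the fraction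
  of samples without target, \<open>Inr False\<close> the average cost. A single assignment serves
  all of them. The box where every sample hits its target has probability at least the exponential
  of \<open>- k\<close> times the total cost, and on it the coordinates of \<open>K_emp\<close> are
  controlled.\<close>

lemma lower_prob:
  fixes th :: "nat \<times> nat \<Rightarrow> 'z \<Rightarrow> real" and t :: "nat \<times> nat \<Rightarrow> real"
  assumes "k \<ge> 1" and I: "finite I" and th: "\<And>j. th j \<in> bcont" "\<And>j z. 0 \<le> th j z" "\<And>z. (\<Sum>j\<in>I. th j z) \<le> 1"
    and t: "\<And>j. 0 \<le> t j"
    and ball_all: "\<forall>j\<in>I. \<forall>z. 0 < th j z \<longrightarrow> exp (- real k * t j) \<le> measure (P k z) (ball (dense_sequence (fst j)) (2 * \<delta>))"
    and R: "finite R" and M_all: "\<forall>m\<in>R. \<forall>p :: 'z \<times> 'x. \<bar>tst m p\<bar> \<le> M" and M_nonneg: "M \<ge> 0"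
    and K_all: "\<forall>m\<in>R. \<forall>p p' :: 'z \<times> 'x. \<bar>tst m p - tst m p'\<bar> \<le> K * dist p p'" and K_nonneg: "K \<ge> 0"
    and "\<delta> > 0" "\<tau> > 0"
  shows "\<forall>\<^sub>F n in sequentially. exp (- real k * real n * ((\<Sum>j\<in>I. t j * (\<integral>z. th j z \<partial>\<mu>)) + 2 * \<tau>))
     \<le> measure (smp k n) {\<omega> \<in> space (smp k n). \<forall>m\<in>R. \<bar>(\<integral>p. tst m p \<partial>K_emp pts n \<omega>) -
          (\<integral>z. (\<Sum>j\<in>I. th j z * tst m (z, dense_sequence (fst j) :: 'x)) \<partial>\<mu>)\<bar>
        \<le> 2 * K * \<delta> + M * (1 - (\<Sum>j\<in>I. \<integral>z. th j z \<partial>\<mu>) + 2 * \<tau>) + 2 * \<tau>}"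
proof -
  note M = M_all[rule_format] M_nonneg and K = K_all[rule_format] K_nonneg
  note ball = ball_all[rule_format]
  interpret mu: prob_space \<mu> using prob_measuresD[OF \<mu>_prob] by simp
  \<comment> \<open>\<open>None\<close> means that no target is prescribed; it contributes 0 to
    coordinates and cost and 1 to the count of free samples. \<open>G r\<close> is the mean of
    \<open>v r\<close> under the weights, as a function of \<open>z\<close>.\<close>
  define v :: "nat + bool \<Rightarrow> nat \<Rightarrow> nat \<Rightarrow> (nat \<times> nat) option \<Rightarrow> real" where
    "v r n i l = (case r of Inl m \<Rightarrow> (case l of None \<Rightarrow> 0 | Some j \<Rightarrow> tst m (pts n i, dense_sequence (fst j) :: 'x))
       | Inr b \<Rightarrow> (if b then (case l of None \<Rightarrow> 1 | Some j \<Rightarrow> 0) else (case l of None \<Rightarrow> 0 | Some j \<Rightarrow> t j)))" for r n i l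
  define G :: "nat + bool \<Rightarrow> 'z \<Rightarrow> real" where
    "G r z = (case r of Inl m \<Rightarrow> (\<Sum>j\<in>I. th j z * tst m (z, dense_sequence (fst j) :: 'x))
       | Inr b \<Rightarrow> (if b then 1 - (\<Sum>j\<in>I. th j z) else (\<Sum>j\<in>I. th j z * t j)))" for r z
  define w where "w n i l = (case l of None \<Rightarrow> 1 - (\<Sum>j\<in>I. th j (pts n i)) | Some j \<Rightarrow> th j (pts n i))" for n i l
  define I' where "I' = insert None (Some ` I)"
  define R' :: "(nat + bool) set" where "R' = Inl ` R \<union> Inr ` UNIV"
  define C where "C = M + 1 + (\<Sum>j\<in>I. t j)"
  have finI': "finite I'" and finR': "finite R'" using I R by (auto simp: I'_def R'_def)
  have sumI': "(\<Sum>l\<in>I'. f l) = f None + (\<Sum>j\<in>I. f (Some j))" for f :: "(nat \<times> nat) option \<Rightarrow> real"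
    unfolding I'_def using I by (subst sum.insert) (auto simp: sum.reindex)
  have th_int: "integrable \<mu> (th j)" for j by (rule bcont_integrable[OF \<mu>_prob th(1)])
  have G_bcont: "G r \<in> bcont" for r
  proof (cases r)
    case (Inl m)
    have "(\<lambda>z. \<Sum>j\<in>I. th j z * tst m (z, dense_sequence (fst j) :: 'x)) \<in> bcont"
      by (intro bcont_sum bcont_mult th blip_bcont blip_tst_section)
    then show ?thesis using Inl by (simp add: G_def[abs_def])
  next
    case (Inr b)
    have "(\<lambda>z. 1 + (-1) * (\<Sum>j\<in>I. th j z)) \<in> bcont" by (intro bcont_add bcont_mult bcont_const bcont_sum th)
    moreover have "(\<lambda>z. \<Sum>j\<in>I. th j z * t j) \<in> bcont" by (intro bcont_mult bcont_const bcont_sum th)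
    ultimately show ?thesis using Inr by (cases b) (simp_all add: G_def[abs_def])
  qed
  have G_eq: "(\<Sum>l\<in>I'. w n i l * v r n i l) = G r (pts n i)" for n i r
    unfolding sumI' by (cases r) (auto simp: w_def v_def G_def)
  have w_nn: "0 \<le> w n i l" for n i l using th(2,3) by (auto simp: w_def split: option.split)
  have w_sum: "(\<Sum>l\<in>I'. w n i l) = 1" for n i unfolding sumI' by (simp add: w_def)
  have t_sum: "t j \<le> (\<Sum>j\<in>I. t j)" if "j \<in> I" for j using I t that by (intro member_le_sum) auto
  have t_nn: "0 \<le> (\<Sum>j\<in>I. t j)" using t by (intro sum_nonneg) auto
  have v_abs: "\<bar>v r n i l\<bar> \<le> C" if r: "r \<in> R'" and l: "l \<in> I'" for r n i l
  proof (cases r)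
    case (Inl m)
    then have "m \<in> R" using r by (auto simp: R'_def)
    show ?thesis
    proof (cases l)
      case None
      then show ?thesis using Inl M(2) t_nn by (simp add: v_def C_def)
    next
      case (Some j)
      have "\<bar>tst m (pts n i, dense_sequence (fst j) :: 'x)\<bar> \<le> M" by (rule M(1)[OF \<open>m \<in> R\<close>])
      then show ?thesis using Inl Some t_nn by (simp add: v_def C_def)
    qed
  next
    case (Inr b)
    show ?thesis
    proof (cases l)
      case None
      then show ?thesis using Inr M(2) t_nn by (auto simp: v_def C_def)
    next
      case (Some j)
      then have "j \<in> I" using l by (auto simp: I'_def)
      then show ?thesis using Inr Some M(2) t_nn t_sum[OF \<open>j \<in> I\<close>] t[of j] by (simp add: v_def C_def)
    qed
  qed
  define c' where "c' = (\<Sum>j\<in>I. t j * (\<integral>z. th j z \<partial>\<mu>))"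
  define e0 where "e0 = 1 - (\<Sum>j\<in>I. \<integral>z. th j z \<partial>\<mu>)"
  have int_cost: "(\<integral>z. G (Inr False) z \<partial>\<mu>) = c'"
    using th_int by (simp add: G_def c'_def mult.commute)
  have int_e0: "(\<integral>z. G (Inr True) z \<partial>\<mu>) = e0"
    using th_int by (simp add: G_def e0_def mu.prob_space)
  \<comment> \<open>The greedy bound on squared deviations is linear in \<open>n\<close>; from
    \<open>n0\<close> on it is below the square of \<open>n * \<tau>\<close>.\<close>
  obtain n0 :: nat where n0: "real (card R') * (2 * C)\<^sup>2 / \<tau>\<^sup>2 < real n0" using reals_Archimedean2 by blast
  have "\<forall>\<^sub>F n in sequentially. \<forall>r\<in>R'. dist ((\<Sum>i=1..n. G r (pts n i)) / real n) (\<integral>z. G r z \<partial>\<mu>) < \<tau>"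
    using tendstoD[OF averages_tendsto[OF G_bcont] \<open>\<tau> > 0\<close>] by (intro eventually_ball_finite finR') auto
  then show ?thesis using eventually_ge_at_top[of "max 1 n0"]
  proof eventually_elim
    case (elim n)
    then have n: "n \<ge> 1" "n \<ge> n0" by auto
    define av where "av r a = (\<Sum>i=1..n. v r n i (a i)) / real n" for r a
    obtain a where a: "\<And>i. i\<in>{1..n} \<Longrightarrow> a i \<in> I' \<and> 0 < w n i (a i)"
      "(\<Sum>r\<in>R'. (\<Sum>i=1..n. v r n i (a i) - (\<Sum>l\<in>I'. w n i l * v r n i l))\<^sup>2) \<le> real n * (real (card R') * (2 * C)\<^sup>2)"
      using greedy_assignment[of I' "w n" R' "\<lambda>r. v r n" C n] finI' finR' w_nn w_sum v_abs by blast
    \<comment> \<open>One \<open>\<tau>\<close> for rounding by the greedy assignment, one for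
      replacing averages over the points by \<open>\<mu>\<close>.\<close>
    have av_G: "\<bar>av r a - (\<integral>z. G r z \<partial>\<mu>)\<bar> \<le> 2 * \<tau>" if r: "r \<in> R'" for r
    proof -
      define S where "S = (\<Sum>i=1..n. v r n i (a i) - G r (pts n i))"
      have "S\<^sup>2 \<le> (\<Sum>r\<in>R'. (\<Sum>i=1..n. v r n i (a i) - G r (pts n i))\<^sup>2)"
        unfolding S_def using r finR' by (intro member_le_sum) auto
      also have "\<dots> \<le> real n * (real (card R') * (2 * C)\<^sup>2)" using a(2) unfolding G_eq .
      also have "\<dots> \<le> real n * (real n * \<tau>\<^sup>2)"
      proof (rule mult_left_mono)
        have "real (card R') * (2 * C)\<^sup>2 / \<tau>\<^sup>2 \<le> real n" using n0 n(2) by linarith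
        then show "real (card R') * (2 * C)\<^sup>2 \<le> real n * \<tau>\<^sup>2" using \<open>\<tau> > 0\<close> by (simp add: field_simps)
      qed simp
      also have "\<dots> = (real n * \<tau>)\<^sup>2" by (simp add: power2_eq_square)
      finally have "\<bar>S\<bar> \<le> real n * \<tau>" using \<open>\<tau> > 0\<close> abs_le_square_iff[of S "real n * \<tau>"] by simp
      then have "\<bar>S / real n\<bar> \<le> \<tau>" using n(1) by (simp add: field_simps)
      moreover have "S / real n = av r a - (\<Sum>i=1..n. G r (pts n i)) / real n"
        by (simp add: S_def av_def sum_subtractf diff_divide_distrib)
      moreover have "\<bar>(\<Sum>i=1..n. G r (pts n i)) / real n - (\<integral>z. G r z \<partial>\<mu>)\<bar> < \<tau>"
        using elim(1) r by (simp add: dist_real_def)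
      ultimately show ?thesis by linarith
    qed
    have inR': "Inr True \<in> R'" "Inr False \<in> R'" "\<And>m. m \<in> R \<Longrightarrow> Inl m \<in> R'" by (auto simp: R'_def)
    define Ob :: "nat \<Rightarrow> 'x set" where "Ob i = (case a i of None \<Rightarrow> UNIV | Some j \<Rightarrow> ball (dense_sequence (fst j)) (2 * \<delta>))" for i
    have Om: "Ob i \<in> sets (P k (pts n i))" for i
      unfolding Ob_def prob_measuresD(2)[OF P_prob[OF \<open>k \<ge> 1\<close>]] by (auto split: option.split)
    define box where "box = (\<Pi>\<^sub>E i\<in>{1..n}. Ob i)"
    define target where "target = {\<omega> \<in> space (smp k n). \<forall>m\<in>R. \<bar>(\<integral>p. tst m p \<partial>K_emp pts n \<omega>) - (\<integral>z. G (Inl m) z \<partial>\<mu>)\<bar>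
        \<le> 2 * K * \<delta> + M * (e0 + 2 * \<tau>) + 2 * \<tau>}"
    interpret smp: prob_space "smp k n" by (rule prob_space_smp[OF \<open>k \<ge> 1\<close>])
    interpret pP: product_sigma_finite "\<lambda>i. P k (pts n i)" by (rule product_P[OF \<open>k \<ge> 1\<close>])
    have "measure (smp k n) box = (\<Prod>i\<in>{1..n}. measure (P k (pts n i)) (Ob i))"
    proof -
      have "emeasure (smp k n) box = (\<Prod>i\<in>{1..n}. emeasure (P k (pts n i)) (Ob i))"
        unfolding sample_space_def box_def by (rule pP.emeasure_PiM) (use Om in auto)
      also have "\<dots> = (\<Prod>i\<in>{1..n}. ennreal (measure (P k (pts n i)) (Ob i)))"
      proof (intro prod.cong refl)
        fix i
        interpret prob_space "P k (pts n i)" using prob_measuresD[OF P_prob[OF \<open>k \<ge> 1\<close>]] by simp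
        show "emeasure (P k (pts n i)) (Ob i) = ennreal (measure (P k (pts n i)) (Ob i))" by (rule emeasure_eq_measure)
      qed
      finally show ?thesis by (simp add: measure_def prod_ennreal prod_nonneg)
    qed
    also have "\<dots> \<ge> (\<Prod>i\<in>{1..n}. exp (- real k * v (Inr False) n i (a i)))"
    proof (rule prod_mono, intro conjI)
      fix i assume i: "i \<in> {1..n}"
      show "exp (- real k * v (Inr False) n i (a i)) \<le> measure (P k (pts n i)) (Ob i)"
      proof (cases "a i")
        case None
        interpret prob_space "P k (pts n i)" using prob_measuresD[OF P_prob[OF \<open>k \<ge> 1\<close>]] by simp
        show ?thesis using None prob_space prob_measuresD(3)[OF P_prob[OF \<open>k \<ge> 1\<close>], of "pts n i"]
          by (simp add: v_def Ob_def)
      next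
        case (Some j)
        then have "j \<in> I" "0 < th j (pts n i)" using a(1)[OF i] by (auto simp: I'_def w_def)
        then show ?thesis using ball[of j "pts n i"] Some by (simp add: v_def Ob_def)
      qed
    qed simp
    finally have "exp (\<Sum>i=1..n. - real k * v (Inr False) n i (a i)) \<le> measure (smp k n) box"
      by (simp add: exp_sum)
    moreover have "(\<Sum>i=1..n. - real k * v (Inr False) n i (a i)) = - real k * real n * av (Inr False) a"
      using n(1) by (simp add: av_def sum_distrib_left[symmetric] sum_negf)
    moreover have "- real k * real n * (c' + 2 * \<tau>) \<le> - real k * real n * av (Inr False) a"
    proof -
      have "av (Inr False) a \<le> c' + 2 * \<tau>" using av_G[OF inR'(2)] int_cost by linarith
      then have "real k * real n * av (Inr False) a \<le> real k * real n * (c' + 2 * \<tau>)" by (intro mult_left_mono) auto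
      then show ?thesis by simp
    qed
    ultimately have 1: "exp (- real k * real n * (c' + 2 * \<tau>)) \<le> measure (smp k n) box"
      by (metis exp_le_cancel_iff order_trans)
    have "box \<subseteq> target"
    proof
      fix \<omega> assume "\<omega> \<in> box"
      then have \<omega>: "\<omega> i \<in> Ob i" if "i \<in> {1..n}" for i using that by (auto simp: box_def)
      have sp: "\<omega> \<in> space (smp k n)" using \<open>\<omega> \<in> box\<close> unfolding space_smp[OF \<open>k \<ge> 1\<close>] box_def by (auto simp: PiE_iff)
      have "\<bar>(\<integral>p. tst m p \<partial>K_emp pts n \<omega>) - (\<integral>z. G (Inl m) z \<partial>\<mu>)\<bar> \<le> 2 * K * \<delta> + M * (e0 + 2 * \<tau>) + 2 * \<tau>" if m: "m \<in> R" for m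
      proof -
        \<comment> \<open>A sample with a target changes the test function by at most
          \<open>2 * K * \<delta>\<close>; for a free sample only the bound \<open>M\<close> is
          available.\<close>
        have pw: "\<bar>tst m (pts n i, \<omega> i) - v (Inl m) n i (a i)\<bar> \<le> 2 * K * \<delta> + M * v (Inr True) n i (a i)" if i: "i \<in> {1..n}" for i
        proof (cases "a i")
          case None
          have "0 \<le> 2 * K * \<delta>" using K(2) \<open>\<delta> > 0\<close> by simp
          then show ?thesis using None M(1)[OF m, of "(pts n i, \<omega> i)"] by (simp add: v_def)
        next
          case (Some j)
          then have "dist (\<omega> i) (dense_sequence (fst j)) < 2 * \<delta>" using \<omega>[OF i] by (simp add: Ob_def dist_commute)
          then have "K * dist (pts n i, \<omega> i) (pts n i, dense_sequence (fst j)) \<le> K * (2 * \<delta>)"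
            using K(2) by (intro mult_left_mono) (auto simp: dist_Pair_Pair)
          then show ?thesis using Some K(1)[OF m, of "(pts n i, \<omega> i)" "(pts n i, dense_sequence (fst j))"]
            by (simp add: v_def algebra_simps)
        qed
        have "(\<integral>p. tst m p \<partial>K_emp pts n \<omega>) = (\<Sum>i=1..n. tst m (pts n i, \<omega> i)) / real n"
          by (rule K_emp_integral[OF n(1) bcont_measurable[OF blip_bcont[OF blip_tst]]])
        then have "(\<integral>p. tst m p \<partial>K_emp pts n \<omega>) - av (Inl m) a = (\<Sum>i=1..n. tst m (pts n i, \<omega> i) - v (Inl m) n i (a i)) / real n"
          by (simp add: av_def sum_subtractf diff_divide_distrib)
        then have "\<bar>(\<integral>p. tst m p \<partial>K_emp pts n \<omega>) - av (Inl m) a\<bar> = \<bar>\<Sum>i=1..n. tst m (pts n i, \<omega> i) - v (Inl m) n i (a i)\<bar> / real n"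
          by simp
        also have "\<dots> \<le> (\<Sum>i=1..n. 2 * K * \<delta> + M * v (Inr True) n i (a i)) / real n"
          by (intro divide_right_mono order_trans[OF sum_abs] sum_mono pw) auto
        also have "\<dots> = 2 * K * \<delta> + M * av (Inr True) a"
          using n(1) by (simp add: sum.distrib av_def sum_distrib_left[symmetric] add_divide_distrib)
        also have "M * av (Inr True) a \<le> M * (e0 + 2 * \<tau>)"
        proof (rule mult_left_mono[OF _ M(2)])
          show "av (Inr True) a \<le> e0 + 2 * \<tau>" using av_G[OF inR'(1)] int_e0 by linarith
        qed
        finally show ?thesis using av_G[OF inR'(3)[OF m]] by linarith
      qed
      then show "\<omega> \<in> target" unfolding target_def using sp by simp
    qed
    moreover have "target \<in> sets (smp k n)"
    proof -
      have [measurable]: "(\<lambda>\<omega>. \<integral>p. tst m p \<partial>K_emp pts n \<omega>) \<in> borel_measurable (smp k n)" for m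
        by (rule measurable_K_integral[OF \<open>k \<ge> 1\<close> n(1) bcont_measurable[OF blip_bcont[OF blip_tst]]])
      show ?thesis unfolding target_def using R by measurable
    qed
    ultimately have "measure (smp k n) box \<le> measure (smp k n) target" by (rule smp.finite_measure_mono)
    then have "exp (- real k * real n * (c' + 2 * \<tau>)) \<le> measure (smp k n) target" using 1 by linarith
    then show ?case unfolding target_def c'_def e0_def by (simp add: G_def[abs_def])
  qed
qed

text \<open>What \<open>lower_prob\<close> needs from the weights \<open>th\<close>, together with
  their closeness to \<open>q\<close>. The finite set \<open>I\<close> and the costs
  \<open>t\<close> stay fixed while \<open>k\<close> varies; only \<open>th\<close> depends on
  \<open>k\<close>.\<close>

abbreviation tilting where
  "tilting c q I t R M K \<delta> \<epsilon> k th \<equiv>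
     (\<forall>j. th j \<in> bcont) \<and> (\<forall>j z. 0 \<le> th j z) \<and> (\<forall>z. (\<Sum>j\<in>I. th j z) \<le> 1) \<and>
     (\<forall>j\<in>I. \<forall>z. 0 < th j z \<longrightarrow> exp (- real k * t j) \<le> measure (P k z) (ball (dense_sequence (fst j)) (2 * \<delta>))) \<and>
     (\<Sum>j\<in>I. t j * (\<integral>z. th j z \<partial>\<mu>)) \<le> c + 4 * \<epsilon> \<and> 1 - (\<Sum>j\<in>I. \<integral>z. th j z \<partial>\<mu>) \<le> 2 * \<epsilon> \<and>
     (\<forall>m\<in>R. \<bar>(\<integral>z. (\<Sum>j\<in>I. th j z * tst m (z, dense_sequence (fst j) :: 'x)) \<partial>\<mu>) - coords q m\<bar> \<le> K * \<delta> + 2 * M * \<epsilon>)"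

text \<open>The Feller property yields continuity in \<open>z\<close> of integrals of bump
  functions, which need not hold for masses of balls. So the cut-off \<open>\<xi>\<close> is built
  from the bump \<open>\<phi>\<close>, and the target ball has twice the radius of the cell:
  \<open>\<phi>\<close> is 1 on the ball of radius \<open>\<delta>\<close> and vanishes outside
  radius \<open>2 * \<delta>\<close>.\<close>

lemma lower_weights:
  assumes q: "q \<in> prob_measures" and marg: "distr q borel fst = \<mu>"
    and c: "(\<integral>\<^sup>+ p. e2ennreal (J (fst p) (snd p)) \<partial>q) = ennreal c" "c \<ge> 0"
    and R: "finite R" and M_all: "\<forall>m\<in>R. \<forall>p :: 'z \<times> 'x. \<bar>tst m p\<bar> \<le> M" and M_nonneg: "M \<ge> 0"
    and K_all: "\<forall>m\<in>R. \<forall>p p' :: 'z \<times> 'x. \<bar>tst m p - tst m p'\<bar> \<le> K * dist p p'" and K_nonneg: "K \<ge> 0"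
    and "\<delta> > 0" "\<epsilon> > 0"
  shows "\<exists>(I :: (nat \<times> nat) set) t. finite I \<and> (\<forall>j. 0 \<le> t j) \<and> (\<forall>\<^sub>F k in sequentially. \<exists>th.
     tilting c q I t R M K \<delta> \<epsilon> k th)"
proof -
  note M = M_all[rule_format] M_nonneg and K = K_all[rule_format] K_nonneg
  interpret q: prob_space q using prob_measuresD[OF q] by simp
  interpret mu: prob_space \<mu> using prob_measuresD[OF \<mu>_prob] by simp
  note sq = prob_measuresD(2,3)[OF q]
  note J_measurable [measurable]
  \<comment> \<open>\<open>fst j\<close> is the code of \<open>x\<close> at scale
    \<open>\<delta>\<close>, \<open>snd j\<close> the level of \<open>J\<close> in steps of
    \<open>\<epsilon>\<close>.\<close>
  define cell where "cell j = {p :: 'z \<times> 'x. code \<delta> (snd p) = fst j \<and> ereal (real (snd j) * \<epsilon>) \<le> J (fst p) (snd p)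
      \<and> J (fst p) (snd p) < ereal ((real (snd j) + 1) * \<epsilon>)}" for j :: "nat \<times> nat"
  \<comment> \<open>Only finitely many cells are kept. Since the integral of \<open>J\<close> is
    finite, \<open>J\<close> is finite almost everywhere and the sets \<open>A N\<close> exhaust
    \<open>q\<close>.\<close>
  define A where "A N = {p :: 'z \<times> 'x. code \<delta> (snd p) < N \<and> J (fst p) (snd p) < ereal (real N * \<epsilon>)}" for N :: nat
  have code_snd [measurable]: "(\<lambda>p :: 'z \<times> 'x. code \<delta> (snd p)) \<in> measurable borel (count_space UNIV)"
    by (rule measurable_compose[OF measurable_snd_borel measurable_code])
  have cell_m [measurable]: "cell j \<in> sets borel" for j unfolding cell_def by measurable
  have A_m: "A N \<in> sets borel" for N unfolding A_def by measurable
  have J_fin: "AE p in q. J (fst p) (snd p) \<noteq> \<infinity>"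
  proof -
    have "(\<lambda>p. e2ennreal (J (fst p) (snd p))) \<in> borel_measurable q"
      by (intro measurable_prob_measure[OF q] measurable_compose[OF J_measurable measurable_e2ennreal])
    then have "AE p in q. e2ennreal (J (fst p) (snd p)) \<noteq> \<infinity>"
      by (rule nn_integral_PInf_AE) (simp add: c)
    then show ?thesis by eventually_elim auto
  qed
  obtain N where N: "measure q (A N) > 1 - \<epsilon>"
  proof -
    have "(\<lambda>N. measure q (A N)) \<longlonglongrightarrow> measure q (\<Union>N. A N)"
    proof (rule q.finite_Lim_measure_incseq)
      show "range A \<subseteq> sets q" using A_m sq by auto
      show "incseq A"
      proof (rule incseq_SucI)
        fix N
        have "ereal (real N * \<epsilon>) \<le> ereal (real (Suc N) * \<epsilon>)" using \<open>\<epsilon> > 0\<close> by (simp add: mult_right_mono)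
        then show "A N \<subseteq> A (Suc N)" unfolding A_def by (auto intro: less_le_trans)
      qed
    qed
    moreover have "measure q (\<Union>N. A N) = 1"
    proof -
      have "(\<Union>N. A N) \<in> sets q" using A_m sq by auto
      moreover have "AE p in q. p \<in> (\<Union>N. A N)"
        using J_fin
      proof eventually_elim
        case (elim p)
        then obtain y where y: "J (fst p) (snd p) = ereal y" using J_nonneg[of "fst p" "snd p"] by (cases "J (fst p) (snd p)") auto
        obtain N :: nat where N: "y / \<epsilon> < real N" using reals_Archimedean2 by blast
        define N' where "N' = max N (Suc (code \<delta> (snd p)))"
        have "y < real N * \<epsilon>" using N \<open>\<epsilon> > 0\<close> by (simp add: field_simps)
        also have "\<dots> \<le> real N' * \<epsilon>" using \<open>\<epsilon> > 0\<close> by (intro mult_right_mono) (auto simp: N'_def)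
        finally have "p \<in> A N'" by (auto simp: A_def y N'_def)
        then show ?case by blast
      qed
      ultimately show ?thesis by (simp add: q.prob_eq_1)
    qed
    ultimately have "(\<lambda>N. measure q (A N)) \<longlonglongrightarrow> 1" by simp
    then have "\<forall>\<^sub>F N in sequentially. 1 - \<epsilon> < measure q (A N)" by (rule order_tendstoD) (use \<open>\<epsilon> > 0\<close> in simp)
    then show ?thesis using that by (auto simp: eventually_sequentially)
  qed
  define I where "I = {..<N} \<times> {..<N}"
  have finI: "finite I" by (simp add: I_def)
  have disj: "cell j \<inter> cell j' = {}" if "j \<noteq> j'" for j j'
  proof (rule ccontr)
    assume "cell j \<inter> cell j' \<noteq> {}"
    then obtain p where p: "p \<in> cell j" "p \<in> cell j'" by blast
    have "snd j \<noteq> snd j'" using p that by (auto simp: cell_def prod_eq_iff)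
    moreover have False if "a < b" "ereal (real b * \<epsilon>) \<le> y" "y < ereal ((real a + 1) * \<epsilon>)" for a b :: nat and y
    proof -
      have "(real a + 1) * \<epsilon> \<le> real b * \<epsilon>" using that(1) \<open>\<epsilon> > 0\<close> by (intro mult_right_mono) auto
      then have "ereal ((real a + 1) * \<epsilon>) \<le> ereal (real b * \<epsilon>)" by simp
      then show False using that(2,3) by (meson leD le_less_trans less_le_trans order_trans)
    qed
    ultimately show False using p unfolding cell_def by (metis (mono_tags, lifting) linorder_neqE_nat mem_Collect_eq)
  qed
  have cellsum: "(\<Sum>j\<in>I. f j * indicator (cell j) p) = f j" if "j \<in> I" "p \<in> cell j" for f :: "nat \<times> nat \<Rightarrow> real" and j p
  proof -
    have "f i * indicator (cell i) p = (if i = j then f i else 0)" for i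
      using disj[of i j] that(2) by (auto simp: indicator_def)
    then show ?thesis using that(1) finI by simp
  qed
  have cellsum0: "(\<Sum>j\<in>I. f j * indicator (cell j) p) = 0" if "\<And>j. j \<in> I \<Longrightarrow> p \<notin> cell j" for f :: "nat \<times> nat \<Rightarrow> real" and p
    using that by (intro sum.neutral) auto
  have cell_int: "integrable q (\<lambda>p. a * indicator (cell j) p)" for a :: real and j
    using cell_m[of j] sq by (simp add: less_top[symmetric])
  have cell_meas: "(\<Sum>j\<in>I. f j * measure q (cell j)) = (\<integral>p. (\<Sum>j\<in>I. f j * indicator (cell j) p) \<partial>q)" for f :: "nat \<times> nat \<Rightarrow> real"
    using cell_int cell_m sq by (subst Bochner_Integration.integral_sum) auto
  have mass: "1 - \<epsilon> \<le> (\<Sum>j\<in>I. measure q (cell j))"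
  proof -
    have "A N \<subseteq> (\<Union>j\<in>I. cell j)"
    proof
      fix p assume p: "p \<in> A N"
      then obtain y where y: "J (fst p) (snd p) = ereal y" using J_nonneg[of "fst p" "snd p"] by (cases "J (fst p) (snd p)") (auto simp: A_def)
      have y0: "0 \<le> y" using J_nonneg[of "fst p" "snd p"] y by simp
      define s where "s = nat \<lfloor>y / \<epsilon>\<rfloor>"
      have nn: "0 \<le> y / \<epsilon>" using y0 \<open>\<epsilon> > 0\<close> by simp
      have s: "real s \<le> y / \<epsilon>" "y / \<epsilon> < real s + 1" unfolding s_def using nn by (simp_all add: of_nat_nat)
      have s': "real s * \<epsilon> \<le> y" "y < (real s + 1) * \<epsilon>" using s \<open>\<epsilon> > 0\<close> by (simp_all add: field_simps)
      have "y / \<epsilon> < real N" using p y \<open>\<epsilon> > 0\<close> by (simp add: A_def field_simps)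
      then have "s < N" using s(1) by linarith
      moreover have "p \<in> cell (code \<delta> (snd p), s)" unfolding cell_def using s' y by simp
      ultimately show "p \<in> (\<Union>j\<in>I. cell j)" using p by (auto simp: I_def A_def)
    qed
    then have "measure q (A N) \<le> measure q (\<Union>j\<in>I. cell j)"
      using cell_m finI sq by (intro q.finite_measure_mono) auto
    also have "\<dots> \<le> (\<Sum>j\<in>I. measure q (cell j))" using cell_m sq finI by (intro measure_UNION_le) auto
    finally show ?thesis using N by simp
  qed
  have "\<exists>\<rho>. \<rho> \<in> borel_measurable borel \<and> (\<forall>z. 0 \<le> \<rho> z) \<and> (\<forall>z. \<rho> z \<le> (1::real)) \<and>
    (\<forall>u B. u \<in> borel_measurable borel \<longrightarrow> (\<forall>z. \<bar>u z\<bar> \<le> B) \<longrightarrow>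
      (\<integral>z. \<rho> z * u z \<partial>\<mu>) = (\<integral>p. indicator (cell j) p * u (fst p) \<partial>q))" for j
    by (rule marginal_density[OF q \<mu>_prob marg cell_m[of j]]) blast
  then obtain \<rho> where \<rho>: "\<And>j. \<rho> j \<in> borel_measurable borel" "\<And>j z. 0 \<le> \<rho> j z" "\<And>j z. \<rho> j z \<le> (1::real)"
    and \<rho>_int: "\<And>j u B. u \<in> borel_measurable borel \<Longrightarrow> (\<And>z. \<bar>u z\<bar> \<le> B) \<Longrightarrow>
      (\<integral>z. \<rho> j z * u z \<partial>\<mu>) = (\<integral>p. indicator (cell j) p * u (fst p) \<partial>q)"
    by metis
  have \<rho>i: "integrable \<mu> (\<rho> j)" for j
    by (rule bounded_integrable[OF \<mu>_prob \<rho>(1), of _ 1]) (use \<rho>(2,3) in \<open>auto simp: abs_of_nonneg\<close>)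
  have \<rho>_mass: "(\<integral>z. \<rho> j z \<partial>\<mu>) = measure q (cell j)" for j
    using \<rho>_int[of "\<lambda>_. 1" 1 j] cell_m[of j] sq by simp
  have AE_sum: "AE z in \<mu>. (\<Sum>j\<in>I. \<rho> j z) \<le> 1"
  proof (rule AE_le_one_of_integral[OF \<mu>_prob])
    show "(\<lambda>z. \<Sum>j\<in>I. \<rho> j z) \<in> borel_measurable borel" using \<rho>(1) by auto
    show "integrable \<mu> (\<lambda>z. \<Sum>j\<in>I. \<rho> j z)" using \<rho>i by auto
    fix B :: "'z set" assume B: "B \<in> sets borel"
    have B': "B \<in> sets \<mu>" using B prob_measuresD(2)[OF \<mu>_prob] by simp
    have Bf: "fst -` B \<in> sets (borel :: ('z \<times> 'x) measure)" using measurable_sets[OF measurable_fst_borel B] by simp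
    have i1: "integrable \<mu> (\<lambda>z. \<rho> j z * indicator B z)" for j
      using integrable_mult_indicator[OF B' \<rho>i[of j]] by (simp add: mult.commute)
    have i2: "integrable q (\<lambda>p. indicator (cell j) p * indicator B (fst p) :: real)" for j
    proof (rule bounded_integrable[OF q, of _ 1])
      show "(\<lambda>p. indicator (cell j) p * indicator B (fst p) :: real) \<in> borel_measurable borel"
        by (intro borel_measurable_times borel_measurable_indicator cell_m
            measurable_compose[OF measurable_fst_borel borel_measurable_indicator[OF B]])
    qed (auto simp: indicator_def)
    have "(\<integral>z. (\<Sum>j\<in>I. \<rho> j z) * indicator B z \<partial>\<mu>) = (\<Sum>j\<in>I. \<integral>z. \<rho> j z * indicator B z \<partial>\<mu>)"
      unfolding sum_distrib_right using i1 by (subst Bochner_Integration.integral_sum) auto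
    also have "\<dots> = (\<Sum>j\<in>I. \<integral>p. indicator (cell j) p * indicator B (fst p) \<partial>q)"
      by (intro sum.cong refl \<rho>_int[of _ 1]) (use B in auto)
    also have "\<dots> = (\<integral>p. (\<Sum>j\<in>I. indicator (cell j) p * indicator B (fst p)) \<partial>q)"
      using i2 by (subst Bochner_Integration.integral_sum) auto
    also have "\<dots> \<le> (\<integral>p. indicator (fst -` B) p \<partial>q)"
    proof (rule integral_mono)
      show "integrable q (\<lambda>p. \<Sum>j\<in>I. indicator (cell j) p * indicator B (fst p) :: real)" using i2 by auto
      show "integrable q (indicator (fst -` B) :: _ \<Rightarrow> real)" using Bf sq by (simp add: less_top[symmetric])
      fix p
      show "(\<Sum>j\<in>I. indicator (cell j) p * indicator B (fst p)) \<le> (indicator (fst -` B) p :: real)"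
      proof (cases "\<exists>j\<in>I. p \<in> cell j")
        case True
        then obtain j where "j \<in> I" "p \<in> cell j" by blast
        from cellsum[OF this, of "\<lambda>_. indicator B (fst p)"] show ?thesis by (simp add: mult.commute indicator_def)
      next
        case False
        then have "(\<Sum>j\<in>I. indicator B (fst p) * indicator (cell j) p) = (0::real)" by (intro cellsum0) auto
        then show ?thesis by (simp add: mult.commute)
      qed
    qed
    also have "\<dots> = measure q (fst -` B)" using Bf sq by simp
    also have "\<dots> = measure \<mu> B" unfolding marg[symmetric] using B sq
      by (simp add: measure_distr measurable_prob_measure[OF q measurable_fst_borel])
    finally show "(\<integral>z. (\<Sum>j\<in>I. \<rho> j z) * indicator B z \<partial>\<mu>) \<le> measure \<mu> B" .
  qed
  \<comment> \<open>On the cell \<open>J\<close> is below \<open>(snd j + 1) * \<epsilon>\<close>;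
    one more \<open>\<epsilon>\<close> is the error of the large deviation lower bound, and the
    third is the gap over which the cut-off rises continuously from 0 to 1.\<close>
  define t where "t j = (real (snd j) + 3) * \<epsilon>" for j :: "nat \<times> nat"
  define T where "T = (real N + 3) * \<epsilon>"
  have T: "T > 0" using \<open>\<epsilon> > 0\<close> by (simp add: T_def)
  have t: "0 \<le> t j" for j using \<open>\<epsilon> > 0\<close> by (simp add: t_def)
  have tT: "t j \<le> T" if "j \<in> I" for j
    unfolding t_def T_def using that \<open>\<epsilon> > 0\<close> by (intro mult_right_mono) (auto simp: I_def)
  \<comment> \<open>Keeps both the error in mass and the error in cost, which is magnified by
    \<open>T\<close>, below \<open>\<epsilon>\<close>.\<close>
  define \<kappa> where "\<kappa> = min \<epsilon> (\<epsilon> / T)"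
  have \<kappa>: "\<kappa> > 0" "\<kappa> \<le> \<epsilon>" "T * \<kappa> \<le> \<epsilon>"
  proof -
    show "\<kappa> > 0" "\<kappa> \<le> \<epsilon>" using \<open>\<epsilon> > 0\<close> T by (auto simp: \<kappa>_def)
    have "T * \<kappa> \<le> T * (\<epsilon> / T)" unfolding \<kappa>_def using T by (intro mult_left_mono) auto
    then show "T * \<kappa> \<le> \<epsilon>" using T by simp
  qed
  have "\<kappa> / 2 > 0" using \<kappa> by simp
  obtain \<theta> where \<theta>: "\<And>j. \<theta> j \<in> bcont" "\<And>j z. 0 \<le> \<theta> j z" "\<And>z. (\<Sum>j\<in>I. \<theta> j z) \<le> 1"
    "(\<Sum>j\<in>I. \<integral>z. \<bar>\<theta> j z - \<rho> j z\<bar> \<partial>\<mu>) \<le> \<kappa> / 2"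
    by (rule bcont_partition_approx[OF \<mu>_prob finI \<rho> AE_sum \<open>\<kappa> / 2 > 0\<close>]) blast
  define \<phi> where "\<phi> l x = max 0 (min 1 (2 - dist x (dense_sequence l) / \<delta>))" for l and x :: 'x
  have \<phi>_bounds: "0 \<le> \<phi> l x" "\<phi> l x \<le> 1" for l x by (auto simp: \<phi>_def)
  have \<phi>: "\<phi> l \<in> bcont" for l
    by (rule bcontI[of _ 1]) (use \<phi>_bounds[of l] in \<open>auto simp: abs_of_nonneg \<phi>_def intro!: continuous_intros simp: \<open>\<delta> > 0\<close>[THEN less_imp_neq, THEN not_sym]\<close>)
  have \<phi>_one: "\<phi> l x = 1" if "x \<in> ball (dense_sequence l) \<delta>" for l x
    using that \<open>\<delta> > 0\<close> by (simp add: \<phi>_def dist_commute field_simps)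
  have \<phi>_zero: "\<phi> l x = 0" if "x \<notin> ball (dense_sequence l) (2 * \<delta>)" for l x
    using that \<open>\<delta> > 0\<close> by (simp add: \<phi>_def dist_commute field_simps)
  define p where "p k l z = (\<integral>x. \<phi> l x \<partial>P k z)" for k l z
  \<comment> \<open>A continuous ramp in the bump mass \<open>p\<close>, from 0 at the lower
    exponential threshold to 1 at the higher one. For \<open>k = 0\<close> the two thresholds
    coincide and no Feller property is assumed, so the value is set to 0.\<close>
  define \<xi> where "\<xi> k j z = (if k = 0 then 0 else max 0 (min 1 ((p k (fst j) z - exp (- real k * t j)) /
      (exp (- real k * (t j - \<epsilon>)) - exp (- real k * t j)))))" for k j z
  have \<xi>_bounds: "0 \<le> \<xi> k j z" "\<xi> k j z \<le> 1" for k j z by (auto simp: \<xi>_def)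
  have gap: "exp (- real k * t j) < exp (- real k * (t j - \<epsilon>))" if "k \<ge> 1" for k j
    using that \<open>\<epsilon> > 0\<close> by simp
  have \<xi>: "\<xi> k j \<in> bcont" for k j
  proof (cases "k = 0")
    case False
    then have "continuous_on UNIV (p k (fst j))"
      using feller[of k] \<phi> unfolding feller_system_def p_def by auto
    then have "continuous_on UNIV (\<xi> k j)" unfolding \<xi>_def[abs_def] using False gap[of k j]
      by (simp add: continuous_intros)
    then show ?thesis by (rule bcontI[of _ 1]) (use \<xi>_bounds[of k j] in \<open>simp add: abs_of_nonneg\<close>)
  qed (simp add: \<xi>_def[abs_def] bcont_const)
  have \<xi>_one: "\<forall>\<^sub>F k in sequentially. \<xi> k j z = 1" if "(z, x) \<in> cell j" for j z x
  proof -
    define U :: "'x set" where "U = ball (dense_sequence (fst j)) \<delta>"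
    have "x \<in> U" using that code_dist[OF \<open>\<delta> > 0\<close>, of x] by (auto simp: cell_def U_def dist_commute)
    moreover have "J z x \<le> ereal ((real (snd j) + 1) * \<epsilon>)" using that by (auto simp: cell_def)
    ultimately have "\<forall>\<^sub>F k in sequentially. exp (- real k * ((real (snd j) + 1) * \<epsilon> + \<epsilon>)) \<le> measure (P k z) U"
      using \<open>\<epsilon> > 0\<close> by (intro ldp_lower[OF ldp]) (auto simp: U_def)
    then show ?thesis using eventually_ge_at_top[of 1]
    proof eventually_elim
      case (elim k)
      note Pk = P_prob[OF elim(2), of z]
      interpret Pk: prob_space "P k z" using prob_measuresD[OF Pk] by simp
      have U: "U \<in> sets (P k z)" using prob_measuresD(2)[OF Pk] by (simp add: U_def)
      have "measure (P k z) U = (\<integral>x. indicator U x \<partial>P k z)" using U by simp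
      also have "\<dots> \<le> p k (fst j) z" unfolding p_def
      proof (rule integral_mono)
        show "integrable (P k z) (indicator U :: _ \<Rightarrow> real)" using U by (simp add: less_top[symmetric])
        show "integrable (P k z) (\<phi> (fst j))" by (rule bcont_integrable[OF Pk \<phi>])
        show "indicator U x \<le> \<phi> (fst j) x" for x using \<phi>_one[of x "fst j"] \<phi>_bounds by (auto simp: U_def indicator_def)
      qed
      finally have "exp (- real k * (t j - \<epsilon>)) \<le> p k (fst j) z" using elim(1) by (simp add: t_def algebra_simps)
      then have "1 \<le> (p k (fst j) z - exp (- real k * t j)) / (exp (- real k * (t j - \<epsilon>)) - exp (- real k * t j))"
        using gap[OF elim(2), of j] by (simp add: field_simps)
      then show ?case using elim(2) by (simp add: \<xi>_def)
    qed
  qed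
  have "(\<lambda>k. \<Sum>j\<in>I. \<integral>z. \<rho> j z * (1 - \<xi> k j z) \<partial>\<mu>) \<longlonglongrightarrow> (\<Sum>j\<in>I. 0)"
  proof (rule tendsto_sum)
    fix j
    \<comment> \<open>Under \<open>\<mu>\<close> the cut-off need not tend to 1 at every
      \<open>z\<close>; moved to \<open>q\<close>, the integrand lives on the cell, where
      \<open>\<xi>_one\<close> gives pointwise convergence.\<close>
    have "(\<integral>z. \<rho> j z * (1 - \<xi> k j z) \<partial>\<mu>) = (\<integral>p. indicator (cell j) p * (1 - \<xi> k j (fst p)) \<partial>q)" for k
    proof (rule \<rho>_int[of _ 1])
      show "(\<lambda>z. 1 - \<xi> k j z) \<in> borel_measurable borel" using bcont_measurable[OF \<xi>] by auto
      show "\<bar>1 - \<xi> k j z\<bar> \<le> 1" for z using \<xi>_bounds[of k j z] by auto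
    qed
    moreover have "(\<lambda>k. \<integral>p. indicator (cell j) p * (1 - \<xi> k j (fst p)) \<partial>q) \<longlonglongrightarrow> 0"
    proof (rule tendsto_integral_zero[OF q, where B = 1])
      show "(\<lambda>p. indicator (cell j) p * (1 - \<xi> k j (fst p))) \<in> borel_measurable borel" for k
        by (intro borel_measurable_times borel_measurable_diff borel_measurable_const borel_measurable_indicator cell_m
            measurable_compose[OF measurable_fst_borel bcont_measurable[OF \<xi>]])
      show "\<bar>indicator (cell j) p * (1 - \<xi> k j (fst p))\<bar> \<le> 1" for k p
        using \<xi>_bounds[of k j "fst p"] by (auto simp: indicator_def)
      show "(\<lambda>k. indicator (cell j) p * (1 - \<xi> k j (fst p))) \<longlonglongrightarrow> 0" for p
      proof (cases "p \<in> cell j")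
        case True
        then have "\<forall>\<^sub>F k in sequentially. indicator (cell j) p * (1 - \<xi> k j (fst p)) = 0"
          using \<xi>_one[of "fst p" "snd p" j] by (auto elim: eventually_mono)
        then show ?thesis by (rule tendsto_eventually)
      qed simp
    qed
    ultimately show "(\<lambda>k. \<integral>z. \<rho> j z * (1 - \<xi> k j z) \<partial>\<mu>) \<longlonglongrightarrow> 0" by simp
  qed
  then have "\<forall>\<^sub>F k in sequentially. (\<Sum>j\<in>I. \<integral>z. \<rho> j z * (1 - \<xi> k j z) \<partial>\<mu>) < \<kappa> / 2"
    by (rule order_tendstoD) (use \<kappa> in simp)
  then have "\<forall>\<^sub>F k in sequentially. \<exists>th.
     tilting c q I t R M K \<delta> \<epsilon> k th"
    using eventually_ge_at_top[of 1]
  proof eventually_elim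
    case (elim k)
    define th where "th j z = \<theta> j z * \<xi> k j z" for j z
    have th: "th j \<in> bcont" for j unfolding th_def by (intro bcont_mult \<theta> \<xi>)
    have th_nn: "0 \<le> th j z" for j z unfolding th_def using \<theta>(2) \<xi>_bounds by simp
    have th_le: "th j z \<le> \<theta> j z" for j z
      unfolding th_def using \<theta>(2) \<xi>_bounds by (simp add: mult_left_le)
    have th_sum: "(\<Sum>j\<in>I. th j z) \<le> 1" for z
      using sum_mono[of I "\<lambda>j. th j z" "\<lambda>j. \<theta> j z"] th_le \<theta>(3)[of z] by (meson order_trans)
    have thi: "integrable \<mu> (th j)" for j by (rule bcont_integrable[OF \<mu>_prob th])
    have th_ball: "exp (- real k * t j) \<le> measure (P k z) (ball (dense_sequence (fst j)) (2 * \<delta>))" if "0 < th j z" for j z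
    proof -
      note Pk = P_prob[OF elim(2), of z]
      interpret Pk: prob_space "P k z" using prob_measuresD[OF Pk] by simp
      have "\<xi> k j z \<noteq> 0" using that by (auto simp: th_def)
      moreover have k0: "k \<noteq> 0" using elim(2) by simp
      moreover have "0 < y" if "max 0 (min 1 y) \<noteq> 0" for y :: real
        using that by (auto simp: max_def min_def split: if_splits)
      ultimately have "0 < (p k (fst j) z - exp (- real k * t j)) / (exp (- real k * (t j - \<epsilon>)) - exp (- real k * t j))"
        unfolding \<xi>_def if_not_P[OF k0] by blast
      then have "exp (- real k * t j) \<le> p k (fst j) z"
        using gap[OF elim(2), of j] by (simp add: zero_less_divide_iff)
      also have "\<dots> \<le> (\<integral>x. indicator (ball (dense_sequence (fst j)) (2 * \<delta>)) x \<partial>P k z)"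
        unfolding p_def
      proof (rule integral_mono)
        show "integrable (P k z) (\<phi> (fst j))" by (rule bcont_integrable[OF Pk \<phi>])
        show "integrable (P k z) (indicator (ball (dense_sequence (fst j)) (2 * \<delta>)) :: _ \<Rightarrow> real)"
          using prob_measuresD(2)[OF Pk] by (simp add: less_top[symmetric])
        show "\<phi> (fst j) x \<le> indicator (ball (dense_sequence (fst j)) (2 * \<delta>)) x" for x
          using \<phi>_zero[of x "fst j"] \<phi>_bounds by (auto simp: indicator_def)
      qed
      also have "\<dots> = measure (P k z) (ball (dense_sequence (fst j)) (2 * \<delta>))"
        using prob_measuresD(2,3)[OF Pk] by simp
      finally show ?thesis .
    qed
    have di: "integrable \<mu> (\<lambda>z. \<bar>th j z - \<rho> j z\<bar>)" for j using thi \<rho>i by auto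
    have L1: "(\<Sum>j\<in>I. \<integral>z. \<bar>th j z - \<rho> j z\<bar> \<partial>\<mu>) \<le> \<kappa>"
    proof -
      have \<theta>i: "integrable \<mu> (\<lambda>z. \<bar>\<theta> j z - \<rho> j z\<bar>)" for j
        using bcont_integrable[OF \<mu>_prob \<theta>(1)[of j]] \<rho>i[of j] by auto
      have \<xi>i: "integrable \<mu> (\<lambda>z. \<rho> j z * (1 - \<xi> k j z))" for j
      proof (rule bounded_integrable[OF \<mu>_prob, of _ 1])
        show "(\<lambda>z. \<rho> j z * (1 - \<xi> k j z)) \<in> borel_measurable borel" using \<rho>(1) bcont_measurable[OF \<xi>] by auto
        show "\<bar>\<rho> j z * (1 - \<xi> k j z)\<bar> \<le> 1" for z
          using \<rho>(2,3)[of j z] \<xi>_bounds[of k j z] by (simp add: abs_mult mult_le_one)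
      qed
      have "(\<integral>z. \<bar>th j z - \<rho> j z\<bar> \<partial>\<mu>) \<le> (\<integral>z. \<bar>\<theta> j z - \<rho> j z\<bar> + \<rho> j z * (1 - \<xi> k j z) \<partial>\<mu>)" for j
      proof (rule integral_mono[OF di])
        fix z
        \<comment> \<open>Separates the error of approximating \<open>\<rho>\<close> by
          \<open>\<theta>\<close> from the loss through the cut-off; summed over \<open>I\<close>,
          each has integral at most half of \<open>\<kappa>\<close>.\<close>
        have "th j z - \<rho> j z = (\<theta> j z - \<rho> j z) * \<xi> k j z - \<rho> j z * (1 - \<xi> k j z)" by (simp add: th_def algebra_simps)
        then have "\<bar>th j z - \<rho> j z\<bar> \<le> \<bar>(\<theta> j z - \<rho> j z) * \<xi> k j z\<bar> + \<bar>\<rho> j z * (1 - \<xi> k j z)\<bar>" by linarith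
        also have "\<bar>(\<theta> j z - \<rho> j z) * \<xi> k j z\<bar> \<le> \<bar>\<theta> j z - \<rho> j z\<bar>"
          using \<xi>_bounds[of k j z] by (simp add: abs_mult mult_left_le)
        also have "\<bar>\<rho> j z * (1 - \<xi> k j z)\<bar> = \<rho> j z * (1 - \<xi> k j z)"
          using \<rho>(2)[of j z] \<xi>_bounds[of k j z] by simp
        finally show "\<bar>th j z - \<rho> j z\<bar> \<le> \<bar>\<theta> j z - \<rho> j z\<bar> + \<rho> j z * (1 - \<xi> k j z)" by simp
      qed (use \<theta>i \<xi>i in auto)
      then have "(\<Sum>j\<in>I. \<integral>z. \<bar>th j z - \<rho> j z\<bar> \<partial>\<mu>) \<le> (\<Sum>j\<in>I. (\<integral>z. \<bar>\<theta> j z - \<rho> j z\<bar> \<partial>\<mu>) + (\<integral>z. \<rho> j z * (1 - \<xi> k j z) \<partial>\<mu>))"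
        using \<theta>i \<xi>i by (intro sum_mono) simp
      then show ?thesis using \<theta>(4) elim(1) unfolding sum.distrib by linarith
    qed
    have dj: "\<bar>(\<integral>z. th j z \<partial>\<mu>) - measure q (cell j)\<bar> \<le> (\<integral>z. \<bar>th j z - \<rho> j z\<bar> \<partial>\<mu>)" for j
    proof -
      have "(\<integral>z. th j z \<partial>\<mu>) - measure q (cell j) = (\<integral>z. th j z - \<rho> j z \<partial>\<mu>)"
        unfolding \<rho>_mass[symmetric] using thi \<rho>i by simp
      then show ?thesis using integral_abs_bound[of \<mu> "\<lambda>z. th j z - \<rho> j z"] by simp
    qed
    have c1: "(\<Sum>j\<in>I. t j * (\<integral>z. th j z \<partial>\<mu>)) \<le> c + 4 * \<epsilon>"
    proof -
      have "(\<Sum>j\<in>I. t j * (\<integral>z. th j z \<partial>\<mu>)) \<le> (\<Sum>j\<in>I. t j * measure q (cell j) + T * (\<integral>z. \<bar>th j z - \<rho> j z\<bar> \<partial>\<mu>))"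
      proof (rule sum_mono)
        fix j assume j: "j \<in> I"
        have "t j * (\<integral>z. th j z \<partial>\<mu>) \<le> t j * (measure q (cell j) + (\<integral>z. \<bar>th j z - \<rho> j z\<bar> \<partial>\<mu>))"
          using dj[of j] t[of j] by (intro mult_left_mono) auto
        also have "\<dots> \<le> t j * measure q (cell j) + T * (\<integral>z. \<bar>th j z - \<rho> j z\<bar> \<partial>\<mu>)"
          unfolding distrib_left using tT[OF j] by (intro add_left_mono mult_right_mono) auto
        finally show "t j * (\<integral>z. th j z \<partial>\<mu>) \<le> t j * measure q (cell j) + T * (\<integral>z. \<bar>th j z - \<rho> j z\<bar> \<partial>\<mu>)" .
      qed
      also have "\<dots> = (\<Sum>j\<in>I. t j * measure q (cell j)) + T * (\<Sum>j\<in>I. \<integral>z. \<bar>th j z - \<rho> j z\<bar> \<partial>\<mu>)"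
        by (simp add: sum.distrib sum_distrib_left)
      also have "T * (\<Sum>j\<in>I. \<integral>z. \<bar>th j z - \<rho> j z\<bar> \<partial>\<mu>) \<le> T * \<kappa>" using L1 T by (intro mult_left_mono) auto
      also have "(\<Sum>j\<in>I. t j * measure q (cell j)) \<le> c + 3 * \<epsilon>"
      proof -
        \<comment> \<open>\<open>g\<close> is the lower value of \<open>J\<close> on each cell, so
          its integral is at most \<open>c\<close>; the three extra \<open>\<epsilon>\<close> in
          \<open>t j\<close> against a total mass of at most 1 give the
          \<open>3 * \<epsilon>\<close>. The fourth \<open>\<epsilon>\<close> of \<open>c1\<close>
          comes from \<open>T * \<kappa>\<close>.\<close>
        define g where "g p = (\<Sum>j\<in>I. (real (snd j) * \<epsilon>) * indicator (cell j) p)" for p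
        have g_le: "0 \<le> g p \<and> ereal (g p) \<le> J (fst p) (snd p)" for p
        proof (cases "\<exists>j\<in>I. p \<in> cell j")
          case True
          then obtain j where j: "j \<in> I" "p \<in> cell j" by blast
          have "g p = real (snd j) * \<epsilon>" unfolding g_def by (rule cellsum[OF j])
          then show ?thesis using j(2) \<open>\<epsilon> > 0\<close> by (simp add: cell_def)
        next
          case False
          then have "g p = 0" unfolding g_def by (intro cellsum0) auto
          then show ?thesis using J_nonneg[of "fst p" "snd p"] by (simp add: zero_ereal_def)
        qed
        have gi: "integrable q g" unfolding g_def using cell_int by auto
        have "ennreal (\<integral>p. g p \<partial>q) = (\<integral>\<^sup>+ p. ennreal (g p) \<partial>q)"
          by (rule nn_integral_eq_integral[OF gi, symmetric]) (use g_le in auto)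
        also have "\<dots> \<le> (\<integral>\<^sup>+ p. e2ennreal (J (fst p) (snd p)) \<partial>q)"
          using g_le by (intro nn_integral_mono) (metis e2ennreal_ereal e2ennreal_mono)
        finally have "(\<integral>p. g p \<partial>q) \<le> c" using c by (simp add: ennreal_le_iff)
        moreover have "(\<Sum>j\<in>I. t j * measure q (cell j)) = (\<integral>p. g p \<partial>q) + 3 * \<epsilon> * (\<Sum>j\<in>I. measure q (cell j))"
          unfolding g_def cell_meas[symmetric] by (simp add: t_def sum_distrib_left sum.distrib[symmetric] algebra_simps)
        moreover have s1: "(\<Sum>j\<in>I. measure q (cell j)) \<le> 1"
        proof -
          have "(\<Sum>j\<in>I. 1 * measure q (cell j)) \<le> (\<integral>p. 1 \<partial>q)"
            unfolding cell_meas
          proof (rule integral_mono)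
            fix p show "(\<Sum>j\<in>I. 1 * indicator (cell j) p) \<le> (1::real)"
              using cellsum[of _ p "\<lambda>_. 1"] cellsum0[of p "\<lambda>_. 1"] by (cases "\<exists>j\<in>I. p \<in> cell j") fastforce+
          qed (use cell_int[of 1] in auto)
          then show ?thesis by (simp add: q.prob_space)
        qed
        moreover have "3 * \<epsilon> * (\<Sum>j\<in>I. measure q (cell j)) \<le> 3 * \<epsilon> * 1"
          by (rule mult_left_mono[OF s1]) (use \<open>\<epsilon> > 0\<close> in simp)
        ultimately show ?thesis by linarith
      qed
      finally show ?thesis using \<kappa>(3) by linarith
    qed
    have c2: "1 - (\<Sum>j\<in>I. \<integral>z. th j z \<partial>\<mu>) \<le> 2 * \<epsilon>"
    proof -
      have "(\<Sum>j\<in>I. measure q (cell j)) - (\<Sum>j\<in>I. \<integral>z. th j z \<partial>\<mu>) \<le> (\<Sum>j\<in>I. \<integral>z. \<bar>th j z - \<rho> j z\<bar> \<partial>\<mu>)"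
        unfolding sum_subtractf[symmetric] using dj by (intro sum_mono) (auto simp: abs_le_iff)
      then show ?thesis using L1 \<kappa>(2) mass by linarith
    qed
    have c3: "\<bar>(\<integral>z. (\<Sum>j\<in>I. th j z * tst m (z, dense_sequence (fst j) :: 'x)) \<partial>\<mu>) - coords q m\<bar> \<le> K * \<delta> + 2 * M * \<epsilon>"
      if m: "m \<in> R" for m
    proof -
      define s :: "nat \<times> nat \<Rightarrow> 'z \<Rightarrow> real" where "s j z = tst m (z, dense_sequence (fst j) :: 'x)" for j z
      have s: "blip (s j)" for j unfolding s_def by (rule blip_tst_section)
      have sM: "\<bar>s j z\<bar> \<le> M" for j z unfolding s_def by (rule M(1)[OF m])
      have sm [measurable]: "s j \<in> borel_measurable borel" for j by (intro bcont_measurable blip_bcont s)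
      have i1: "integrable \<mu> (\<lambda>z. th j z * s j z)" for j
        by (intro bcont_integrable[OF \<mu>_prob] bcont_mult th blip_bcont s)
      have i2: "integrable \<mu> (\<lambda>z. \<rho> j z * s j z)" for j
      proof (rule bounded_integrable[OF \<mu>_prob, of _ M])
        show "(\<lambda>z. \<rho> j z * s j z) \<in> borel_measurable borel" using \<rho>(1) sm by auto
        show "\<bar>\<rho> j z * s j z\<bar> \<le> M" for z
          using \<rho>(2,3)[of j z] sM[of j z] mult_mono[of "\<rho> j z" 1 "\<bar>s j z\<bar>" M] by (simp add: abs_mult)
      qed
      have i3: "integrable q (\<lambda>p. indicator (cell j) p * s j (fst p))" for j
      proof (rule bounded_integrable[OF q, of _ M])
        show "(\<lambda>p. indicator (cell j) p * s j (fst p)) \<in> borel_measurable borel"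
          by (intro borel_measurable_times borel_measurable_indicator cell_m measurable_compose[OF measurable_fst_borel sm])
        show "\<bar>indicator (cell j) p * s j (fst p)\<bar> \<le> M" for p using sM[of j "fst p"] M(2) by (auto simp: indicator_def)
      qed
      have "\<bar>(\<integral>z. (\<Sum>j\<in>I. th j z * s j z) \<partial>\<mu>) - (\<Sum>j\<in>I. \<integral>z. \<rho> j z * s j z \<partial>\<mu>)\<bar> = \<bar>\<Sum>j\<in>I. \<integral>z. (th j z - \<rho> j z) * s j z \<partial>\<mu>\<bar>"
        using i1 i2 by (simp add: left_diff_distrib sum_subtractf)
      also have "\<dots> \<le> (\<Sum>j\<in>I. M * (\<integral>z. \<bar>th j z - \<rho> j z\<bar> \<partial>\<mu>))"
      proof (rule order_trans[OF sum_abs], rule sum_mono)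
        fix j
        have "\<bar>\<integral>z. (th j z - \<rho> j z) * s j z \<partial>\<mu>\<bar> \<le> (\<integral>z. \<bar>(th j z - \<rho> j z) * s j z\<bar> \<partial>\<mu>)" by (rule integral_abs_bound)
        also have "\<dots> \<le> (\<integral>z. M * \<bar>th j z - \<rho> j z\<bar> \<partial>\<mu>)"
        proof (rule integral_mono)
          show "integrable \<mu> (\<lambda>z. \<bar>(th j z - \<rho> j z) * s j z\<bar>)" unfolding left_diff_distrib using i1 i2 by auto
          show "\<bar>(th j z - \<rho> j z) * s j z\<bar> \<le> M * \<bar>th j z - \<rho> j z\<bar>" for z
            using mult_right_mono[OF sM[of j z], of "\<bar>th j z - \<rho> j z\<bar>"] by (simp add: abs_mult mult.commute)
        qed (use di in auto)
        finally show "\<bar>\<integral>z. (th j z - \<rho> j z) * s j z \<partial>\<mu>\<bar> \<le> M * (\<integral>z. \<bar>th j z - \<rho> j z\<bar> \<partial>\<mu>)" by simp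
      qed
      also have "\<dots> \<le> M * \<epsilon>" unfolding sum_distrib_left[symmetric] using L1 \<kappa>(2) M(2) by (intro mult_left_mono) auto
      finally have d1: "\<bar>(\<integral>z. (\<Sum>j\<in>I. th j z * s j z) \<partial>\<mu>) - (\<Sum>j\<in>I. \<integral>z. \<rho> j z * s j z \<partial>\<mu>)\<bar> \<le> M * \<epsilon>" .
      have "(\<Sum>j\<in>I. \<integral>z. \<rho> j z * s j z \<partial>\<mu>) = (\<Sum>j\<in>I. \<integral>p. indicator (cell j) p * s j (fst p) \<partial>q)"
        by (intro sum.cong refl \<rho>_int[of _ M] sm sM)
      also have "\<dots> = (\<integral>p. (\<Sum>j\<in>I. indicator (cell j) p * s j (fst p)) \<partial>q)"
        using i3 by (subst Bochner_Integration.integral_sum) auto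
      finally have eq: "(\<Sum>j\<in>I. \<integral>z. \<rho> j z * s j z \<partial>\<mu>) = (\<integral>p. (\<Sum>j\<in>I. indicator (cell j) p * s j (fst p)) \<partial>q)" .
      have ti: "integrable q (tst m)" by (rule blip_integrable[OF q blip_tst])
      have "\<bar>(\<integral>p. (\<Sum>j\<in>I. indicator (cell j) p * s j (fst p)) \<partial>q) - coords q m\<bar> = \<bar>\<integral>p. (\<Sum>j\<in>I. indicator (cell j) p * s j (fst p)) - tst m p \<partial>q\<bar>"
        unfolding coords_def using i3 ti by simp
      also have "\<dots> \<le> (\<integral>p. \<bar>(\<Sum>j\<in>I. indicator (cell j) p * s j (fst p)) - tst m p\<bar> \<partial>q)" by (rule integral_abs_bound)
      also have "\<dots> \<le> (\<integral>p. K * \<delta> + M * (1 - (\<Sum>j\<in>I. 1 * indicator (cell j) p)) \<partial>q)"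
      proof (rule integral_mono)
        show "integrable q (\<lambda>p. \<bar>(\<Sum>j\<in>I. indicator (cell j) p * s j (fst p)) - tst m p\<bar>)" using i3 ti by auto
        show "integrable q (\<lambda>p. K * \<delta> + M * (1 - (\<Sum>j\<in>I. 1 * indicator (cell j) p)))"
          using cell_int[of 1] by auto
        fix p :: "'z \<times> 'x"
        show "\<bar>(\<Sum>j\<in>I. indicator (cell j) p * s j (fst p)) - tst m p\<bar> \<le> K * \<delta> + M * (1 - (\<Sum>j\<in>I. 1 * indicator (cell j) p))"
        proof (cases "\<exists>j\<in>I. p \<in> cell j")
          case True
          then obtain j where j: "j \<in> I" "p \<in> cell j" by blast
          have 1: "(\<Sum>j\<in>I. indicator (cell j) p * s j (fst p)) = s j (fst p)"
            using cellsum[OF j, of "\<lambda>j. s j (fst p)"] by (simp add: mult.commute)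
          have "dist (snd p) (dense_sequence (fst j)) < \<delta>" using j(2) code_dist[OF \<open>\<delta> > 0\<close>, of "snd p"] by (auto simp: cell_def)
          then have "K * dist (fst p, dense_sequence (fst j)) p \<le> K * \<delta>"
            using K(2) by (intro mult_left_mono) (auto simp: dist_prod_def dist_commute)
          then have "\<bar>s j (fst p) - tst m p\<bar> \<le> K * \<delta>"
            using K(1)[OF m, of "(fst p, dense_sequence (fst j))" p] by (simp add: s_def)
          then show ?thesis unfolding 1 using cellsum[OF j, of "\<lambda>_. 1"] by simp
        next
          case False
          then have 1: "(\<Sum>j\<in>I. indicator (cell j) p * s j (fst p)) = 0" "(\<Sum>j\<in>I. 1 * indicator (cell j) p) = (0::real)"
            by (auto intro!: sum.neutral)
          have "0 \<le> K * \<delta>" using K(2) \<open>\<delta> > 0\<close> by simp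
          then show ?thesis unfolding 1 using M(1)[OF m, of p] by simp
        qed
      qed
      also have "\<dots> = K * \<delta> + M * (1 - (\<Sum>j\<in>I. 1 * measure q (cell j)))"
        unfolding cell_meas using cell_int[of 1] by (simp add: q.prob_space)
      also have "\<dots> \<le> K * \<delta> + M * \<epsilon>" using mass M(2) by (intro add_left_mono mult_left_mono) auto
      finally have "\<bar>(\<integral>p. (\<Sum>j\<in>I. indicator (cell j) p * s j (fst p)) \<partial>q) - coords q m\<bar> \<le> K * \<delta> + M * \<epsilon>" .
      moreover have "2 * M * \<epsilon> = M * \<epsilon> + M * \<epsilon>" by simp
      ultimately show ?thesis using d1 eq unfolding s_def by linarith
    qed
    show ?case using th th_nn th_sum th_ball c1 c2 c3 by (intro exI[of _ th]) blast
  qed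
  then show ?thesis using finI t by blast
qed

end

lemma coords_box:
  fixes V :: "(nat \<Rightarrow> real) set"
  assumes "open V" "y \<in> V"
  obtains R \<eta> where "finite R" "\<eta> > 0" "\<And>y'. (\<And>m. m \<in> R \<Longrightarrow> \<bar>y' m - y m\<bar> < \<eta>) \<Longrightarrow> y' \<in> V"
proof -
  have "openin (product_topology (\<lambda>_. euclidean) UNIV) V"
    using assms(1) by (simp add: euclidean_product_topology)
  from product_topology_open_contains_basis[OF this assms(2)] obtain X where X: "y \<in> (\<Pi>\<^sub>E i\<in>UNIV. X i)"
    "\<And>i. open (X i)" "finite {i. X i \<noteq> UNIV}" "(\<Pi>\<^sub>E i\<in>UNIV. X i) \<subseteq> V"
    by auto
  define R where "R = {i. X i \<noteq> UNIV}"
  have "\<exists>e>0. ball (y i) e \<subseteq> X i" for i using X(1,2) open_contains_ball by (metis PiE_mem UNIV_I)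
  then obtain e where e: "\<And>i. e i > 0" "\<And>i. ball (y i) (e i) \<subseteq> X i" by metis
  \<comment> \<open>The 1 keeps the minimum meaningful when no coordinate is restricted.\<close>
  define \<eta> where "\<eta> = Min (insert 1 (e ` R))"
  have fin: "finite (insert 1 (e ` R))" using X(3) by (simp add: R_def)
  have \<eta>: "\<eta> > 0" unfolding \<eta>_def using fin e(1) by (subst Min_gr_iff) auto
  have "y' \<in> V" if "\<And>m. m \<in> R \<Longrightarrow> \<bar>y' m - y m\<bar> < \<eta>" for y'
  proof -
    have "y' i \<in> X i" for i
    proof (cases "i \<in> R")
      case True
      then have "\<eta> \<le> e i" unfolding \<eta>_def using fin by (intro Min_le) auto
      then have "y' i \<in> ball (y i) (e i)" using that[OF True] by (simp add: dist_real_def)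
      then show ?thesis using e(2) by blast
    qed (simp add: R_def)
    then show ?thesis using X(4) by (auto simp: PiE_iff)
  qed
  then show ?thesis using that[of R \<eta>] X(3) \<eta> by (simp add: R_def)
qed

context ldp_setup begin

text \<open>Narrow open sets are preimages of open sets under \<open>coords\<close>, and
  \<open>coords\<close> of \<open>K_emp\<close> is measurable coordinate by coordinate. Outside the
  \<sigma>-algebra \<open>measure\<close> is 0 by convention, so bounding \<open>prob_K\<close> from
  below rests on this.\<close>

lemma K_emp_measurable:
  assumes "k \<ge> 1" "n \<ge> 1" and B: "B \<in> borel_sets_of narrow_topology"
  shows "{\<omega> \<in> space (smp k n). K_emp pts n \<omega> \<in> B} \<in> sets (smp k n)"
proof -
  have coords_m: "(\<lambda>\<omega>. coords (K_emp pts n \<omega> :: ('z \<times> 'x) measure)) \<in> borel_measurable (smp k n)"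
    unfolding coords_def
    by (intro measurable_coordinatewise_then_product measurable_K_integral assms bcont_measurable blip_bcont blip_tst)
  from B show ?thesis unfolding borel_sets_of_def
  proof (induction rule: sigma_sets.induct)
    case (Basic a)
    then obtain V where V: "open V" "a = {q \<in> prob_measures. coords q \<in> V}" using openin_narrow_coords by blast
    have "{\<omega> \<in> space (smp k n). K_emp pts n \<omega> \<in> a} = (\<lambda>\<omega>. coords (K_emp pts n \<omega> :: ('z \<times> 'x) measure)) -` V \<inter> space (smp k n)"
      using K_emp_prob[OF assms(2)] V(2) by auto
    then show ?case using measurable_sets[OF coords_m borel_open[OF V(1)]] by simp
  next
    case (Compl a)
    have "{\<omega> \<in> space (smp k n). K_emp pts n \<omega> \<in> topspace narrow_topology - a} =
        space (smp k n) - {\<omega> \<in> space (smp k n). K_emp pts n \<omega> \<in> a}"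
      using K_emp_prob[OF assms(2)] by (auto simp: topspace_narrow)
    then show ?case using Compl by auto
  next
    case (Union a)
    have "{\<omega> \<in> space (smp k n). K_emp pts n \<omega> \<in> (\<Union>i. a i)} = (\<Union>i. {\<omega> \<in> space (smp k n). K_emp pts n \<omega> \<in> a i})" by auto
    then show ?case using Union by auto
  qed simp
qed

lemma lower_bound:
  assumes W: "openin narrow_topology W" "W \<subseteq> B" and B: "B \<in> borel_sets_of narrow_topology"
    and q: "q \<in> W" "rate_i J \<mu> q = ereal c" and "e > 0"
  shows "\<forall>\<^sub>F k in sequentially. \<forall>\<^sub>F n in sequentially. exp (- real k * real n * (c + e)) \<le> prob_K P pts k n B"
proof -
  have qP: "q \<in> prob_measures" using openin_subset[OF W(1)] q(1) by (auto simp: topspace_narrow)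
  have marg: "distr q borel fst = \<mu>" using q(2) by (auto simp: rate_i_def split: if_splits)
  then have "enn2ereal (\<integral>\<^sup>+ p. e2ennreal (J (fst p) (snd p)) \<partial>q) = ereal c" using q(2) by (simp add: rate_i_def)
  then have c: "(\<integral>\<^sup>+ p. e2ennreal (J (fst p) (snd p)) \<partial>q) = ennreal c" "c \<ge> 0"
    by (metis e2ennreal_enn2ereal e2ennreal_ereal, metis enn2ereal_nonneg ereal_less_eq(5))
  obtain V where V: "open V" "W = {q \<in> prob_measures. coords q \<in> V}" using openin_narrow_coords[OF W(1)] by blast
  obtain R \<eta> where R: "finite R" "\<eta> > 0" "\<And>y. (\<And>m. m \<in> R \<Longrightarrow> \<bar>y m - coords q m\<bar> < \<eta>) \<Longrightarrow> y \<in> V"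
    using coords_box[OF V(1), of "coords q"] q(1) V(2) by blast
  have "\<exists>M K. M > 0 \<and> K > 0 \<and> (\<forall>p::'z \<times> 'x. \<bar>tst m p\<bar> \<le> M) \<and> (\<forall>p p'::'z \<times> 'x. \<bar>tst m p - tst m p'\<bar> \<le> K * dist p p')" for m
    using blipE[OF blip_tst, of m] by metis
  then obtain M0 K0 where M0: "\<And>m. M0 m > 0" "\<And>m (p::'z \<times> 'x). \<bar>tst m p\<bar> \<le> M0 m"
    and K0: "\<And>m. K0 m > 0" "\<And>m (p::'z \<times> 'x) p'. \<bar>tst m p - tst m p'\<bar> \<le> K0 m * dist p p'" by metis
  \<comment> \<open>One bound and one Lipschitz constant for all \<open>m\<close> in
    \<open>R\<close>; \<open>M \<ge> 1\<close> allows \<open>\<epsilon>\<close> itself to be bounded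
    by \<open>M * \<epsilon>\<close>.\<close>
  define M where "M = 1 + (\<Sum>m\<in>R. M0 m)"
  define K where "K = 1 + (\<Sum>m\<in>R. K0 m)"
  have M1: "M \<ge> 1" unfolding M_def using M0(1) by (simp add: sum_nonneg less_imp_le)
  have K1: "K \<ge> 1" unfolding K_def using K0(1) by (simp add: sum_nonneg less_imp_le)
  have MR: "\<forall>m\<in>R. \<forall>p :: 'z \<times> 'x. \<bar>tst m p\<bar> \<le> M"
  proof (intro ballI allI)
    fix m and p :: "'z \<times> 'x" assume that: "m \<in> R"
    have "M0 m \<le> (\<Sum>m\<in>R. M0 m)" using that R(1) M0(1) by (intro member_le_sum) (auto simp: less_imp_le)
    then show "\<bar>tst m p\<bar> \<le> M" using M0(2)[of m p] by (simp add: M_def)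
  qed
  have KR: "\<forall>m\<in>R. \<forall>p p' :: 'z \<times> 'x. \<bar>tst m p - tst m p'\<bar> \<le> K * dist p p'"
  proof (intro ballI allI)
    fix m and p p' :: "'z \<times> 'x" assume that: "m \<in> R"
    have "K0 m \<le> (\<Sum>m\<in>R. K0 m)" using that R(1) K0(1) by (intro member_le_sum) (auto simp: less_imp_le)
    then have "K0 m * dist p p' \<le> K * dist p p'" by (intro mult_right_mono) (auto simp: K_def)
    then show "\<bar>tst m p - tst m p'\<bar> \<le> K * dist p p'" using K0(2)[of m p p'] by linarith
  qed
  \<comment> \<open>The deviations add up to at most
    \<open>3 * K * \<delta> + 6 * M * \<epsilon> + 2 * \<epsilon>\<close>, which is at most eleven
    twentieths of \<open>\<eta>\<close>; the cost is at most \<open>c + 6 * \<epsilon>\<close>,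
    which is below \<open>c + e\<close>.\<close>
  define \<delta> where "\<delta> = \<eta> / (20 * K)"
  define \<epsilon> where "\<epsilon> = min (\<eta> / (20 * M)) (e / 20)"
  have \<delta>: "\<delta> > 0" "K * \<delta> = \<eta> / 20" using R(2) K1 by (auto simp: \<delta>_def)
  have \<epsilon>: "\<epsilon> > 0" "\<epsilon> \<le> e / 20" using R(2) M1 \<open>e > 0\<close> by (auto simp: \<epsilon>_def)
  have M\<epsilon>: "M * \<epsilon> \<le> \<eta> / 20"
  proof -
    have "M * \<epsilon> \<le> M * (\<eta> / (20 * M))" using M1 by (intro mult_left_mono) (auto simp: \<epsilon>_def)
    then show ?thesis using M1 by simp
  qed
  have \<epsilon>\<eta>: "\<epsilon> \<le> M * \<epsilon>" using M1 \<epsilon>(1) by simp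
  have M0': "0 \<le> M" and K0': "0 \<le> K" using M1 K1 by auto
  obtain I :: "(nat \<times> nat) set" and t where I: "finite I" "\<forall>j. 0 \<le> t j" and ev: "\<forall>\<^sub>F k in sequentially. \<exists>th.
     tilting c q I t R M K \<delta> \<epsilon> k th"
    using lower_weights[OF qP marg c R(1) MR M0' KR K0' \<delta>(1) \<epsilon>(1)] by (elim exE conjE)
  show ?thesis using ev eventually_ge_at_top[of 1]
  proof eventually_elim
    case (elim k)
    from elim(1) obtain th where th: "\<forall>j. th j \<in> bcont" "\<forall>j z. 0 \<le> th j z" "\<forall>z. (\<Sum>j\<in>I. th j z) \<le> 1"
      and ball: "\<forall>j\<in>I. \<forall>z. 0 < th j z \<longrightarrow> exp (- real k * t j) \<le> measure (P k z) (ball (dense_sequence (fst j)) (2 * \<delta>))"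
      and cost: "(\<Sum>j\<in>I. t j * (\<integral>z. th j z \<partial>\<mu>)) \<le> c + 4 * \<epsilon>" and e0: "1 - (\<Sum>j\<in>I. \<integral>z. th j z \<partial>\<mu>) \<le> 2 * \<epsilon>"
      and near: "\<forall>m\<in>R. \<bar>(\<integral>z. (\<Sum>j\<in>I. th j z * tst m (z, dense_sequence (fst j) :: 'x)) \<partial>\<mu>) - coords q m\<bar> \<le> K * \<delta> + 2 * M * \<epsilon>"
      by (elim exE conjE)
    from lower_prob[OF elim(2) I(1) th[rule_format] I(2)[rule_format] ball R(1) MR M0' KR K0' \<delta>(1) \<epsilon>(1)]
    show ?case using eventually_ge_at_top[of 1]
    proof eventually_elim
      case (elim n)
      define target where "target = {\<omega> \<in> space (smp k n). \<forall>m\<in>R. \<bar>(\<integral>p. tst m p \<partial>K_emp pts n \<omega>) -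
          (\<integral>z. (\<Sum>j\<in>I. th j z * tst m (z, dense_sequence (fst j) :: 'x)) \<partial>\<mu>)\<bar>
        \<le> 2 * K * \<delta> + M * (1 - (\<Sum>j\<in>I. \<integral>z. th j z \<partial>\<mu>) + 2 * \<epsilon>) + 2 * \<epsilon>}"
      interpret smp: prob_space "smp k n" by (rule prob_space_smp[OF \<open>1 \<le> k\<close>])
      have "(real k * real n) * ((\<Sum>j\<in>I. t j * (\<integral>z. th j z \<partial>\<mu>)) + 2 * \<epsilon>) \<le> (real k * real n) * (c + e)"
        using cost \<epsilon>(2) \<open>e > 0\<close> by (intro mult_left_mono) auto
      then have "exp (- real k * real n * (c + e)) \<le> exp (- real k * real n * ((\<Sum>j\<in>I. t j * (\<integral>z. th j z \<partial>\<mu>)) + 2 * \<epsilon>))" by simp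
      also have "\<dots> \<le> measure (smp k n) target" using elim(1) unfolding target_def .
      also have "\<dots> \<le> measure (smp k n) {\<omega> \<in> space (smp k n). K_emp pts n \<omega> \<in> B}"
      proof (rule smp.finite_measure_mono[OF _ K_emp_measurable[OF \<open>1 \<le> k\<close> elim(2) B]], rule subsetI)
        fix \<omega> assume \<omega>: "\<omega> \<in> target"
        have "coords (K_emp pts n \<omega>) \<in> V"
        proof (rule R(3))
          fix m assume m: "m \<in> R"
          have 1: "\<bar>coords (K_emp pts n \<omega>) m - (\<integral>z. (\<Sum>j\<in>I. th j z * tst m (z, dense_sequence (fst j) :: 'x)) \<partial>\<mu>)\<bar>
            \<le> 2 * K * \<delta> + M * (1 - (\<Sum>j\<in>I. \<integral>z. th j z \<partial>\<mu>) + 2 * \<epsilon>) + 2 * \<epsilon>"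
            using \<omega> m by (simp add: target_def coords_def)
          have 2: "M * (1 - (\<Sum>j\<in>I. \<integral>z. th j z \<partial>\<mu>) + 2 * \<epsilon>) \<le> 4 * (M * \<epsilon>)"
          proof -
            have "M * (1 - (\<Sum>j\<in>I. \<integral>z. th j z \<partial>\<mu>) + 2 * \<epsilon>) \<le> M * (4 * \<epsilon>)" using e0 M0' by (intro mult_left_mono) auto
            then show ?thesis by simp
          qed
          have 3: "2 * K * \<delta> = 2 * (K * \<delta>)" "2 * M * \<epsilon> = 2 * (M * \<epsilon>)" by simp_all
          show "\<bar>coords (K_emp pts n \<omega>) m - coords q m\<bar> < \<eta>"
            using 1 2 near[rule_format, OF m] M\<epsilon> \<epsilon>\<eta> R(2) unfolding 3 \<delta>(2) by linarith
        qed
        then have "K_emp pts n \<omega> \<in> W" using K_emp_prob[OF elim(2)] V(2) by simp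
        then show "\<omega> \<in> {\<omega> \<in> space (smp k n). K_emp pts n \<omega> \<in> B}" using \<omega> W(2) by (auto simp: target_def)
      qed
      finally show ?case unfolding prob_K_def .
    qed
  qed
qed

section \<open>Goodness, the upper bound and conclusion\<close>

lemma rate_i_nonneg: "0 \<le> rate_i J \<mu> q"
  unfolding rate_i_def by (simp add: enn2ereal_nonneg)

text \<open>Compare the lower bound with the Chernoff bound on an open half space.\<close>

lemma exp_bound_le_rate:
  assumes f: "exp_bound f L" and q: "q \<in> prob_measures" "rate_i J \<mu> q = ereal c"
  shows "(\<integral>p. f p \<partial>q) \<le> c + L"
proof (rule ccontr)
  assume "\<not> ?thesis"
  then obtain e where e: "e > 0" "c + L + 4 * e < (\<integral>p. f p \<partial>q)"
    using that[of "((\<integral>p. f p \<partial>q) - (c + L)) / 5"] by (auto intro: that simp: field_simps)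
  \<comment> \<open>With this level the Chernoff exponent \<open>s - L - e\<close> equals
    \<open>c + 2 * e\<close> and beats the exponent \<open>c + e\<close> of the lower bound.\<close>
  define s where "s = c + L + 3 * e"
  have fb: "blip f" using f unfolding exp_bound_def by (rule conjunct1)
  define W where "W = {q \<in> prob_measures. (\<integral>p. f p \<partial>q) \<in> {s<..}}"
  have W: "openin narrow_topology W" unfolding W_def by (rule openin_narrow_basis[OF blip_bcont[OF fb]]) simp
  have WB: "W \<in> borel_sets_of narrow_topology" unfolding borel_sets_of_def using W by (intro sigma_sets.Basic) simp
  have "q \<in> W" using q(1) e by (simp add: W_def s_def)
  have lo: "\<forall>\<^sub>F k in sequentially. \<forall>\<^sub>F n in sequentially. exp (- real k * real n * (c + e)) \<le> prob_K P pts k n W"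
    by (rule lower_bound[OF W order_refl WB \<open>q \<in> W\<close> q(2) e(1)])
  have hi: "\<forall>\<^sub>F k in sequentially. \<forall>\<^sub>F n in sequentially. \<forall>s.
     measure (smp k n) (half_space k n f s) \<le> exp (- real k * real n * (s - L - e))"
    using f e(1) unfolding exp_bound_def by blast
  have "\<forall>\<^sub>F k in sequentially. False"
    using lo hi eventually_ge_at_top[of 1]
  proof eventually_elim
    case (elim k)
    have "\<forall>\<^sub>F n in sequentially. False"
      using elim(1,2) eventually_ge_at_top[of 1]
    proof eventually_elim
      case (elim n)
      interpret smp: prob_space "smp k n" by (rule prob_space_smp[OF \<open>1 \<le> k\<close>])
      have m: "half_space k n f s \<in> sets (smp k n)"
        using measurable_K_integral[OF \<open>1 \<le> k\<close> elim(3) bcont_measurable[OF blip_bcont[OF fb]]] by measurable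
      have "prob_K P pts k n W \<le> measure (smp k n) (half_space k n f s)"
        unfolding prob_K_def by (rule smp.finite_measure_mono[OF _ m]) (auto simp: W_def)
      also have "\<dots> \<le> exp (- real k * real n * (s - L - e))" using elim(2) by blast
      finally have "- real k * real n * (c + e) \<le> - real k * real n * (s - L - e)"
        using elim(1) by (meson exp_le_cancel_iff order_trans)
      then have "(real k * real n) * (c + 2 * e) \<le> (real k * real n) * (c + e)" by (simp add: s_def algebra_simps)
      moreover have "0 < real k * real n" using \<open>1 \<le> k\<close> elim(3) by simp
      ultimately have "c + 2 * e \<le> c + e" by (rule mult_left_le_imp_le)
      then show False using e(1) by simp
    qed
    then show False by simp
  qed
  then show False by simp
qed

text \<open>By \<open>exp_bound_le_rate\<close> a measure of rate at most \<open>c\<close> meets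
  every constraint of the detecting family at level \<open>c\<close>, so
  \<open>rate_detecting_half_spaces\<close> provides a convergent subsequence and keeps its limit in
  the level set.\<close>

lemma good_rate: "good_rate_function_on narrow_topology (rate_i J \<mu>)"
  unfolding good_rate_function_on_def topspace_narrow
proof (intro conjI ballI allI)
  show "0 \<le> rate_i J \<mu> q" for q by (rule rate_i_nonneg)
  fix c :: real
  obtain F :: "nat \<Rightarrow> 'z \<times> 'x \<Rightarrow> real" and L :: "nat \<Rightarrow> real" where F: "\<And>i. exp_bound (F i) (L i)"
    and FL: "\<And>(a::real) q. (\<And>n. q n \<in> prob_measures) \<Longrightarrow> (\<And>i. \<forall>\<^sub>F n in sequentially. (\<integral>p. F i p \<partial>q n) \<le> a + L i) \<Longrightarrow>
       \<exists>r l. strict_mono r \<and> l \<in> prob_measures \<and> (\<forall>m. (\<lambda>n. coords (q (r n)) m) \<longlonglongrightarrow> coords l m) \<and> rate_i J \<mu> l \<le> ereal a"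
    using rate_detecting_half_spaces by blast
  show "compactin narrow_topology {q \<in> prob_measures. rate_i J \<mu> q \<le> ereal c}"
  proof (rule narrow_compactI)
    fix q :: "nat \<Rightarrow> ('z \<times> 'x) measure"
    assume q: "\<And>n. q n \<in> {q \<in> prob_measures. rate_i J \<mu> q \<le> ereal c}"
    have "(\<integral>p. F i p \<partial>q n) \<le> c + L i" for i n
    proof -
      obtain r where r: "rate_i J \<mu> (q n) = ereal r" "r \<le> c"
        using q[of n] rate_i_nonneg[of "q n"] by (cases "rate_i J \<mu> (q n)") auto
      then show ?thesis using exp_bound_le_rate[OF F[of i], of "q n" r] q[of n] by simp
    qed
    then show "\<exists>r l. strict_mono r \<and> l \<in> {q \<in> prob_measures. rate_i J \<mu> q \<le> ereal c} \<and> (\<forall>m. (\<lambda>n. coords (q (r n)) m) \<longlonglongrightarrow> coords l m)"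
      using FL[of q c] q by auto
  qed auto
qed

text \<open>Otherwise a sequence in \<open>F\<close> whose \<open>n\<close>-th term avoids the first \<open>n\<close> half spaces would have a limit
  point in \<open>F\<close> of rate at most \<open>a\<close>; this replaces exponential tightness.\<close>

lemma finite_cover_half_spaces:
  assumes F: "closedin narrow_topology F" and a: "\<And>q. q \<in> F \<Longrightarrow> ereal a < rate_i J \<mu> q"
  obtains N :: nat and f :: "nat \<Rightarrow> 'z \<times> 'x \<Rightarrow> real" and L :: "nat \<Rightarrow> real" where
    "\<And>i. exp_bound (f i) (L i)" "\<And>q. q \<in> F \<Longrightarrow> \<exists>i<N. a + L i < (\<integral>p. f i p \<partial>q)"
proof -
  obtain f :: "nat \<Rightarrow> 'z \<times> 'x \<Rightarrow> real" and L :: "nat \<Rightarrow> real" where f: "\<And>i. exp_bound (f i) (L i)"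
    and fL: "\<And>(a::real) q. (\<And>n. q n \<in> prob_measures) \<Longrightarrow> (\<And>i. \<forall>\<^sub>F n in sequentially. (\<integral>p. f i p \<partial>q n) \<le> a + L i) \<Longrightarrow>
       \<exists>r l. strict_mono r \<and> l \<in> prob_measures \<and> (\<forall>m. (\<lambda>n. coords (q (r n)) m) \<longlonglongrightarrow> coords l m) \<and> rate_i J \<mu> l \<le> ereal a"
    using rate_detecting_half_spaces by blast
  have "\<exists>N. \<forall>q\<in>F. \<exists>i<N. a + L i < (\<integral>p. f i p \<partial>q)"
  proof (rule ccontr)
    assume "\<not> ?thesis"
    then have "\<forall>N. \<exists>q. q \<in> F \<and> (\<forall>i<N. (\<integral>p. f i p \<partial>q) \<le> a + L i)" by (meson linorder_not_less)
    from choice[OF this] obtain q where q: "\<And>n. q n \<in> F" "\<And>n i. i < n \<Longrightarrow> (\<integral>p. f i p \<partial>q n) \<le> a + L i" by blast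
    have qP: "q n \<in> prob_measures" for n using q(1) closedin_subset[OF F] by (auto simp: topspace_narrow)
    have "\<forall>\<^sub>F n in sequentially. (\<integral>p. f i p \<partial>q n) \<le> a + L i" for i
      by (rule eventually_sequentiallyI[of "Suc i"]) (use q(2) in auto)
    from fL[OF qP this] obtain r l where l: "l \<in> prob_measures" "\<And>m. (\<lambda>n. coords (q (r n)) m) \<longlonglongrightarrow> coords l m"
      "rate_i J \<mu> l \<le> ereal a" by blast
    have "l \<in> F" by (rule narrow_closed_coords[OF F l(1) _ l(2)]) (rule q(1))
    then show False using a l(3) by (meson leD)
  qed
  then show ?thesis using that f by blast
qed

text \<open>A union bound over \<open>N\<close> half spaces, each with exponent at least
  \<open>a\<close> up to \<open>e / 2\<close>. The other \<open>e / 2\<close> absorbs the factor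
  \<open>N\<close> once \<open>n\<close> is large; since \<open>k \<ge> 1\<close>, the threshold
  \<open>n0\<close> can be chosen without regard to \<open>k\<close>.\<close>

lemma upper_bound:
  assumes B: "B \<subseteq> F" and F: "closedin narrow_topology F" and a: "\<And>q. q \<in> F \<Longrightarrow> ereal a < rate_i J \<mu> q" and "e > 0"
  shows "\<forall>\<^sub>F k in sequentially. \<forall>\<^sub>F n in sequentially. prob_K P pts k n B \<le> exp (- real k * real n * (a - e))"
proof -
  obtain N :: nat and f :: "nat \<Rightarrow> 'z \<times> 'x \<Rightarrow> real" and L :: "nat \<Rightarrow> real" where f: "\<And>i. exp_bound (f i) (L i)"
    and cover: "\<And>q. q \<in> F \<Longrightarrow> \<exists>i<N. a + L i < (\<integral>p. f i p \<partial>q)"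
    by (rule finite_cover_half_spaces[OF F]) (use a in blast)+
  have ev: "\<forall>\<^sub>F k in sequentially. \<forall>\<^sub>F n in sequentially. \<forall>s.
     measure (smp k n) (half_space k n (f i) s) \<le> exp (- real k * real n * (s - L i - e / 2))" for i
    using f[of i] half_gt_zero[OF \<open>e > 0\<close>] unfolding exp_bound_def by blast
  have "\<forall>\<^sub>F k in sequentially. \<forall>i\<in>{..<N}. \<forall>\<^sub>F n in sequentially. \<forall>s.
     measure (smp k n) (half_space k n (f i) s) \<le> exp (- real k * real n * (s - L i - e / 2))"
    by (rule eventually_ball_finite[OF finite_lessThan ballI[OF ev]])
  then show ?thesis using eventually_ge_at_top[of 1]
  proof eventually_elim
    case (elim k)
    have 1: "\<forall>\<^sub>F n in sequentially. \<forall>i\<in>{..<N}. \<forall>s.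
       measure (smp k n) (half_space k n (f i) s) \<le> exp (- real k * real n * (s - L i - e / 2))"
      by (rule eventually_ball_finite[OF finite_lessThan elim(1)])
    obtain n0 :: nat where n0: "ln (real (Suc N)) / (e / 2) < real n0" using reals_Archimedean2 by blast
    from 1 eventually_ge_at_top[of "max 1 n0"] show ?case
    proof eventually_elim
      case (elim n)
      then have n: "n \<ge> 1" "n \<ge> n0" by auto
      interpret smp: prob_space "smp k n" by (rule prob_space_smp[OF \<open>1 \<le> k\<close>])
      define H where "H i = half_space k n (f i) (a + L i)" for i
      have H: "H i \<in> sets (smp k n)" for i
      proof -
        have "blip (f i)" using f[of i] unfolding exp_bound_def by (rule conjunct1)
        from measurable_K_integral[OF \<open>1 \<le> k\<close> n(1) bcont_measurable[OF blip_bcont[OF this]]]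
        show ?thesis unfolding H_def by measurable
      qed
      have "prob_K P pts k n B \<le> measure (smp k n) (\<Union>i\<in>{..<N}. H i)"
        unfolding prob_K_def
      proof (rule smp.finite_measure_mono)
        show "{\<omega> \<in> space (smp k n). K_emp pts n \<omega> \<in> B} \<subseteq> (\<Union>i\<in>{..<N}. H i)"
        proof
          fix \<omega> assume \<omega>: "\<omega> \<in> {\<omega> \<in> space (smp k n). K_emp pts n \<omega> \<in> B}"
          then obtain i where "i < N" "a + L i < (\<integral>p. f i p \<partial>K_emp pts n \<omega>)" using cover B by blast
          then show "\<omega> \<in> (\<Union>i\<in>{..<N}. H i)" using \<omega> by (auto simp: H_def intro!: bexI[of _ i])
        qed
        show "(\<Union>i\<in>{..<N}. H i) \<in> sets (smp k n)" using H by auto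
      qed
      also have "\<dots> \<le> (\<Sum>i<N. measure (smp k n) (H i))" using H by (intro measure_UNION_le) auto
      also have "\<dots> \<le> (\<Sum>i<N. exp (- real k * real n * (a - e / 2)))"
      proof (rule sum_mono)
        fix i assume "i \<in> {..<N}"
        then have "measure (smp k n) (H i) \<le> exp (- real k * real n * ((a + L i) - L i - e / 2))"
          using elim(1) unfolding H_def by blast
        then show "measure (smp k n) (H i) \<le> exp (- real k * real n * (a - e / 2))" by simp
      qed
      also have "\<dots> = real N * exp (- real k * real n * (a - e / 2))" by simp
      also have "\<dots> \<le> exp (real k * real n * (e / 2)) * exp (- real k * real n * (a - e / 2))"
      proof (rule mult_right_mono)
        have "ln (real (Suc N)) / (e / 2) < real n" using n0 n(2) by linarith
        then have "ln (real (Suc N)) \<le> real n * (e / 2)" using \<open>e > 0\<close> by (simp add: field_simps)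
        also have "\<dots> \<le> real k * (real n * (e / 2))"
          using \<open>1 \<le> k\<close> \<open>e > 0\<close> mult_right_mono[of 1 "real k" "real n * (e / 2)"] by simp
        finally have "exp (ln (real (Suc N))) \<le> exp (real k * real n * (e / 2))" by (simp only: exp_le_cancel_iff mult.assoc)
        then show "real N \<le> exp (real k * real n * (e / 2))" by simp
      qed simp
      also have "\<dots> = exp (- real k * real n * (a - e))" by (simp add: exp_add[symmetric] algebra_simps)
      finally show ?case .
    qed
  qed
qed

lemma LDP: "kn_LDP narrow_topology (prob_K P pts) (rate_i J \<mu>)"
  unfolding kn_LDP_def
proof (intro ballI conjI)
  fix B :: "('z \<times> 'x) measure set" assume B: "B \<in> borel_sets_of narrow_topology"
  have Bsub: "B \<subseteq> topspace narrow_topology"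
    using B sigma_sets_into_sp[of "{U. openin narrow_topology U}" "topspace narrow_topology" B] openin_subset
    unfolding borel_sets_of_def by blast
  define lo where "lo = liminf (\<lambda>k. liminf (\<lambda>n. ereal (1 / (real k * real n)) * elog (prob_K P pts k n B)))"
  define hi where "hi = limsup (\<lambda>k. limsup (\<lambda>n. ereal (1 / (real k * real n)) * elog (prob_K P pts k n B)))"
  have "- lo \<le> rate_i J \<mu> q" if q: "q \<in> narrow_topology interior_of B" for q
  proof (cases "rate_i J \<mu> q")
    case (real c)
    have "- lo \<le> ereal c + ereal e" if "e > 0" for e
    proof -
      have "\<forall>\<^sub>F k in sequentially. \<forall>\<^sub>F n in sequentially. exp (- real k * real n * (c + e)) \<le> prob_K P pts k n B"
        by (rule lower_bound[OF openin_interior_of interior_of_subset B q real that])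
      then have "\<forall>\<^sub>F k in sequentially. ereal (- (c + e)) \<le> liminf (\<lambda>n. ereal (1 / (real k * real n)) * elog (prob_K P pts k n B))"
        using eventually_ge_at_top[of 1]
      proof eventually_elim
        case (elim k)
        from elim(1) eventually_ge_at_top[of 1]
        have "\<forall>\<^sub>F n in sequentially. ereal (- (c + e)) \<le> ereal (1 / (real k * real n)) * elog (prob_K P pts k n B)"
        proof eventually_elim
          case (elim n)
          show ?case
          proof (rule elog_geI)
            show "0 < 1 / (real k * real n)" using \<open>1 \<le> k\<close> elim(2) by simp
            have "- (c + e) / (1 / (real k * real n)) = - real k * real n * (c + e)" by (simp add: algebra_simps)
            then show "exp (- (c + e) / (1 / (real k * real n))) \<le> prob_K P pts k n B" using elim(1) by (simp only:)
          qed
        qed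
        then show ?case by (rule Liminf_bounded)
      qed
      then have "ereal (- (c + e)) \<le> lo" unfolding lo_def by (rule Liminf_bounded)
      then have "- lo \<le> - ereal (- (c + e))" by (simp only: ereal_minus_le_minus)
      then show ?thesis by (simp add: add.commute)
    qed
    then show ?thesis unfolding real by (rule ereal_le_epsilon2[rule_format])
  next
    case MInf
    then show ?thesis using rate_i_nonneg[of q] by simp
  qed simp
  then have "- lo \<le> (INF q\<in>narrow_topology interior_of B. rate_i J \<mu> q)" by (rule INF_greatest)
  then show "- (INF q\<in>narrow_topology interior_of B. rate_i J \<mu> q) \<le> lo"
    by (simp add: ereal_uminus_le_reorder)
  have "(INF q\<in>narrow_topology closure_of B. rate_i J \<mu> q) \<le> - hi"
  proof (rule ccontr)
    assume "\<not> ?thesis"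
    \<comment> \<open>A real number strictly in between treats finite and infinite infima
      alike.\<close>
    then obtain a where a: "- hi < ereal a" "ereal a < (INF q\<in>narrow_topology closure_of B. rate_i J \<mu> q)"
      using ereal_dense2[of "- hi" "INF q\<in>narrow_topology closure_of B. rate_i J \<mu> q"] by (auto simp: not_le)
    have a': "ereal a < rate_i J \<mu> q" if "q \<in> narrow_topology closure_of B" for q
      using a(2) INF_lower[OF that, of "rate_i J \<mu>"] by (rule less_le_trans)
    have "hi \<le> - ereal a + ereal e" if "e > 0" for e
    proof -
      have "\<forall>\<^sub>F k in sequentially. \<forall>\<^sub>F n in sequentially. prob_K P pts k n B \<le> exp (- real k * real n * (a - e))"
        by (rule upper_bound[OF closure_of_subset[OF Bsub] closedin_closure_of a' that])
      then have "\<forall>\<^sub>F k in sequentially. limsup (\<lambda>n. ereal (1 / (real k * real n)) * elog (prob_K P pts k n B)) \<le> ereal (- (a - e))"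
        using eventually_ge_at_top[of 1]
      proof eventually_elim
        case (elim k)
        from elim(1) eventually_ge_at_top[of 1]
        have "\<forall>\<^sub>F n in sequentially. ereal (1 / (real k * real n)) * elog (prob_K P pts k n B) \<le> ereal (- (a - e))"
        proof eventually_elim
          case (elim n)
          show ?case
          proof (rule elog_leI)
            show "0 < 1 / (real k * real n)" using \<open>1 \<le> k\<close> elim(2) by simp
            have "- (a - e) / (1 / (real k * real n)) = - real k * real n * (a - e)" by (simp add: algebra_simps)
            then show "prob_K P pts k n B \<le> exp (- (a - e) / (1 / (real k * real n)))" using elim(1) by (simp only:)
          qed
        qed
        then show ?case by (rule Limsup_bounded)
      qed
      then have "hi \<le> ereal (- (a - e))" unfolding hi_def by (rule Limsup_bounded)
      then show ?thesis by simp
    qed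
    then have "hi \<le> - ereal a" by (rule ereal_le_epsilon2[rule_format])
    then have "ereal a \<le> - hi" by (metis ereal_minus_le_minus ereal_uminus_uminus)
    then show False using a(1) by simp
  qed
  then show "hi \<le> - (INF q\<in>narrow_topology closure_of B. rate_i J \<mu> q)"
    by (metis ereal_minus_le_minus ereal_uminus_uminus)
qed

end

theorem mainTheorem9:
  fixes z :: "nat \<Rightarrow> nat \<Rightarrow> 'z::polish_space"
    and \<mu> :: "'z measure"
    and P :: "nat \<Rightarrow> 'z \<Rightarrow> 'x::polish_space measure"
    and J :: "'z \<Rightarrow> 'x \<Rightarrow> ereal"
  assumes conv: "limitin narrow_topology (\<lambda>n. empirical n (z n)) \<mu> sequentially"
    and feller: "\<And>k. k \<ge> 1 \<Longrightarrow> feller_system (P k)"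
    and rate: "\<And>z. good_rate_function (J z)"
    and ldp: "\<And>z. k_LDP (\<lambda>k. P k z) (J z)"
  shows "good_rate_function_on narrow_topology (rate_i J \<mu>)
       \<and> kn_LDP narrow_topology (prob_K P z) (rate_i J \<mu>)"
proof -
  interpret ldp_setup P J z \<mu> by unfold_locales fact+
  show ?thesis using good_rate LDP by blast
qed

end
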